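(* Let $1\le s<d$, let $X\in\mathbb R^{d\times s}$ have independent $N(0,1/d)$ entries, and put $W=XX^\top$. Consider a measurable adaptive policy with seed $\xi$ independent of $X$, orthonormal queries $v_1,\dots,v_q\in\mathbb R^d$, and $q\le s$. Set $$\mathcal F_t=\sigma(\xi,v_1,Wv_1,\dots,v_t,Wv_t),\qquad \mathcal F_0=\sigma(\xi).$$ For every $0\le t\le q$, there are an $\mathcal F_t$-measurable orthogonal matrix $U_t\in\mathbb R^{d\times d}$ whose first $t$ rows are $v_1^\top,\dots,v_t^\top$, an enlarged sigma-field $\mathcal G_t\supseteq\mathcal F_t$, and a $\mathcal G_t$-measurable orthogonal matrix $O_t\in\mathbb R^{s\times s}$ such that $$U_tXO_t=\begin{bmatrix}A_t&0\\ C_t&D_t\end{bmatrix},\qquad A_t\in\mathbb R^{t\times t},\quad D_t\in\mathbb R^{(d-t)\times(s-t)}.$$ The blocks $A_t,C_t$ are $\mathcal F_t$-measurable, and $A_t$ is lower triangular with positive diagonal almost surely. Moreover, for every bounded Borel function $\varphi$, $$\mathbb E[\varphi(D_t)\mid\mathcal G_t]=\int\varphi\,d\gamma_t\quad\text{almost surely},$$ where $\gamma_t$ is the fixed law on $\mathbb R^{(d-t)\times(s-t)}$ of a matrix with independent $N(0,1/d)$ entries. In particular, $D_t$ is independent of $\mathcal G_t$, and $$\mathbb E[\varphi(D_t)\mid\mathcal F_t]=\int\varphi\,d\gamma_t\quad\text{almost surely}.$$ Thus the regular conditional law of $D_t$ given $\mathcal F_t$ is $\gamma_t$ for almost every realized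 query transcript. (No assertion is made about conditional-law versions on null sets of transcripts.)
   Context: A measurable adaptive policy means that the query $v_{t+1}$ is $\mathcal F_t$-measurable for each $t$, i.e. depends measurably on the seed and on the previous queries and replies $Wv_i$. All random variables take values in standard Borel spaces. When $t=s$ the block $D_t$ has zero columns and $\gamma_t$ is a point mass.
   Formalization: The block identity for U_tXO_t is asserted almost surely rather than for every outcome, since with exactly F_t-measurable A_t and C_t it can fail on the null event where X^T v_1, ..., X^T v_t are linearly dependent. *)

theory Defs
  imports "HOL-Probability.Probability" "Jordan_Normal_Form.Matrix"
begin

definition standard_borel :: "'a measure \<Rightarrow> bool" where
  "standard_borel S \<longleftrightarrow>
     (\<exists>T. completely_metrizable_space T \<and> second_countable T \<and> topspace T = space S \<and>
          sets S = sigma_sets (topspace T) {U. openin T U})"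

text \<open>
  The types of vectors and matrices with explicit dimensions carry no topology. Their Borel
  sigma-algebras are pulled back from the finite product of copies of the Borel sigma-algebra
  on the reals along the coordinate map. If there are no coordinates, the space is a single point.
\<close>

definition vec_borel :: "nat \<Rightarrow> real Matrix.vec measure" where
  "vec_borel n = vimage_algebra (carrier_vec n)
     (\<lambda>v. \<lambda>i\<in>{..<n}. v $ i) (PiM {..<n} (\<lambda>_. borel))"

definition mat_borel :: "nat \<Rightarrow> nat \<Rightarrow> real Matrix.mat measure" where
  "mat_borel m n = vimage_algebra (carrier_mat m n)
     (\<lambda>A. \<lambda>ij\<in>{..<m} \<times> {..<n}. A $$ ij) (PiM ({..<m} \<times> {..<n}) (\<lambda>_. borel))"

text \<open>
  Law of an \<open>m \<times> n\<close> matrix with independent centred normal entries of variance \<open>\<sigma>2\<close>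
  (the library's \<^const>\<open>normal_density\<close> takes the standard deviation). For \<open>n = 0\<close> it is the
  point mass at the empty matrix.
\<close>

definition gaussian_mat :: "real \<Rightarrow> nat \<Rightarrow> nat \<Rightarrow> real Matrix.mat measure" where
  "gaussian_mat \<sigma>2 m n =
     distr (PiM ({..<m} \<times> {..<n}) (\<lambda>_. density lborel (normal_density 0 (sqrt \<sigma>2))))
           (mat_borel m n) (Matrix.mat m n)"

text \<open>Not the library's \<^const>\<open>orthogonal_mat\<close>, which does not normalise the columns.\<close>

definition orthogonal_real_mat :: "nat \<Rightarrow> real Matrix.mat \<Rightarrow> bool" where
  "orthogonal_real_mat n Q \<longleftrightarrow>
     Q \<in> carrier_mat n n \<and> Q * transpose_mat Q = 1\<^sub>m n \<and> transpose_mat Q * Q = 1\<^sub>m n"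

definition lower_triangular_pos :: "real Matrix.mat \<Rightarrow> bool" where
  "lower_triangular_pos A \<longleftrightarrow>
     (\<forall>i<dim_row A. \<forall>j<dim_col A. i < j \<longrightarrow> A $$ (i, j) = 0) \<and> (\<forall>i<dim_row A. 0 < A $$ (i, i))"

text \<open>
  The transcript \<open>(\<xi>, v\<^sub>1, W v\<^sub>1, \<dots>, v\<^sub>t, W v\<^sub>t)\<close> after \<open>t\<close> queries, with its
  product sigma-algebra; \<open>query_algebra\<close> is the sigma-field \<open>\<F>\<^sub>t\<close> that it generates. Queries are
  numbered from 1, whereas rows and columns of matrices are numbered from 0.
\<close>

definition transcript ::
  "('w \<Rightarrow> 'e) \<Rightarrow> ('w \<Rightarrow> real Matrix.mat) \<Rightarrow> (nat \<Rightarrow> 'w \<Rightarrow> real Matrix.vec) \<Rightarrow> nat \<Rightarrow>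
   'w \<Rightarrow> 'e \<times> (nat \<Rightarrow> real Matrix.vec \<times> real Matrix.vec)" where
  "transcript \<xi> W v t \<omega> = (\<xi> \<omega>, \<lambda>i\<in>{1..t}. (v i \<omega>, W \<omega> *\<^sub>v v i \<omega>))"

definition transcript_space ::
  "'e measure \<Rightarrow> nat \<Rightarrow> nat \<Rightarrow> ('e \<times> (nat \<Rightarrow> real Matrix.vec \<times> real Matrix.vec)) measure" where
  "transcript_space S d t = S \<Otimes>\<^sub>M PiM {1..t} (\<lambda>_. vec_borel d \<Otimes>\<^sub>M vec_borel d)"

definition query_algebra ::
  "'w measure \<Rightarrow> 'e measure \<Rightarrow> nat \<Rightarrow> ('w \<Rightarrow> 'e) \<Rightarrow> ('w \<Rightarrow> real Matrix.mat) \<Rightarrow>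
   (nat \<Rightarrow> 'w \<Rightarrow> real Matrix.vec) \<Rightarrow> nat \<Rightarrow> 'w measure" where
  "query_algebra M S d \<xi> W v t =
     vimage_algebra (space M) (transcript \<xi> W v t) (transcript_space S d t)"

text \<open>\<open>\<kappa>\<close> is a regular conditional law of the \<open>N\<close>-valued random variable \<open>Y\<close> given \<open>F\<close>.\<close>

definition regular_cond_law ::
  "'w measure \<Rightarrow> 'w measure \<Rightarrow> 'a measure \<Rightarrow> ('w \<Rightarrow> 'a) \<Rightarrow> ('w \<Rightarrow> 'a measure) \<Rightarrow> bool" where
  "regular_cond_law M F N Y \<kappa> \<longleftrightarrow>
     \<kappa> \<in> F \<rightarrow>\<^sub>M prob_algebra N \<and>
     (\<forall>B\<in>sets N. AE \<omega> in M.
        real_cond_exp M F (\<lambda>\<omega>. indicator B (Y \<omega>)) \<omega> = measure (\<kappa> \<omega>) B)"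

end

theory Submission
  imports Defs
begin

text \<open>
  Write \<open>L = U X Q\<close>, and suppose that \<open>L\<close> vanishes above the diagonal in its first \<open>t\<close> rows and that
  the block \<open>D\<close> of \<open>L\<close> outside its first \<open>t\<close> rows and columns is Gaussian and independent of \<open>\<G>\<^sub>t\<close>.
  The next query is orthogonal to the first \<open>t\<close> rows of \<open>U\<close>, so some \<open>\<F>\<^sub>t\<close>-measurable Householder
  reflection, acting only on rows from \<open>t\<close> on, turns it into row \<open>t\<close> of \<open>U\<close>. By rotation invariance
  the reflected block is still Gaussian and independent of \<open>\<G>\<^sub>t\<close>. Adjoin its first row \<open>r\<close> to \<open>\<G>\<^sub>t\<close>: the
  other rows stay Gaussian and independent, and this survives the column reflection that takes
  \<open>r\<close> to \<open>(\<rho>, 0, \<dots>, 0)\<close>, \<open>\<rho> = \<bar>r\<bar>\<close>. Finally adjoin the first column of the remaining rows; this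
  gives \<open>\<G>\<^sub>t\<^sub>+\<^sub>1\<close>. As \<open>U X X\<^sup>T U\<^sup>T = L L\<^sup>T\<close>, the reply \<open>W v\<^sub>t\<^sub>+\<^sub>1\<close> is a function of the
  first \<open>t + 1\<close> columns of \<open>L\<close>, so \<open>\<F>\<^sub>t\<^sub>+\<^sub>1 \<subseteq> \<G>\<^sub>t\<^sub>+\<^sub>1\<close>; conversely, where \<open>\<rho> > 0\<close>, i.e. almost
  surely, it determines the new column.
\<close>

subsection \<open>Borel structure on vectors and matrices\<close>

text \<open>The matrix \<open>W\<close> does not change when \<open>X\<close> is multiplied on the
  right by an orthogonal matrix, so the replies show \<open>r\<close> only through inner products
  with rows of \<open>L\<close>, never its direction. The column reflection is built from that
  direction and need not be measurable for the query field. This is why a larger field has to carry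
  the hidden rotation; the claim for the query field then follows because independence passes to
  smaller fields. Two kinds of statement must be kept apart. The inclusion of the query field in the
  larger one has to be exact, so it rests on formulas that hold at every sample point and contain no
  division by \<rho>. Recovering columns of \<open>L\<close> from the transcript does divide by
  \<rho> and yields only versions that are correct almost surely. Reflections are chosen because
  their entries are explicit measurable functions of one vector, because division by zero turns the
  degenerate ones into the identity, and because their invariance property reduces to affine
  substitutions in one variable.\<close>

lemma space_mat_borel [simp]: "space (mat_borel m n) = carrier_mat m n"
  by (simp add: mat_borel_def)

lemma space_vec_borel [simp]: "space (vec_borel n) = carrier_vec n"
  by (simp add: vec_borel_def)

text \<open>Matrices carry no topology here, so measurability of products and reflections is always
  checked entry by entry, together with the dimensions.\<close>

lemma measurable_mat_borel_iff:
  "f \<in> N \<rightarrow>\<^sub>M mat_borel m n \<longleftrightarrow>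
     f \<in> space N \<rightarrow> carrier_mat m n \<and> (\<forall>i<m. \<forall>j<n. (\<lambda>\<omega>. f \<omega> $$ (i, j)) \<in> borel_measurable N)"
  (is "?l \<longleftrightarrow> ?r")
proof
  assume l: ?l
  have c: "(\<lambda>A. \<lambda>ij\<in>{..<m} \<times> {..<n}. A $$ ij) \<in> mat_borel m n \<rightarrow>\<^sub>M PiM ({..<m} \<times> {..<n}) (\<lambda>_. borel :: real measure)"
    unfolding mat_borel_def by (rule measurable_vimage_algebra1) (auto simp: space_PiM)
  have "(\<lambda>\<omega>. f \<omega> $$ (i, j)) \<in> borel_measurable N" if "i < m" "j < n" for i j
    using measurable_compose[OF measurable_compose[OF l c] measurable_component_singleton[of "(i,j)"]] that
    by simp
  with measurable_space[OF l] show ?r by auto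
next
  assume r: ?r
  show ?l
    unfolding mat_borel_def
  proof (rule measurable_vimage_algebra2)
    show "(\<lambda>\<omega>. \<lambda>ij\<in>{..<m} \<times> {..<n}. f \<omega> $$ ij) \<in> N \<rightarrow>\<^sub>M PiM ({..<m} \<times> {..<n}) (\<lambda>_. borel)"
      using r by (intro measurable_restrict) auto
  qed (use r in auto)
qed

lemma measurable_vec_borel_iff:
  "f \<in> N \<rightarrow>\<^sub>M vec_borel n \<longleftrightarrow>
     f \<in> space N \<rightarrow> carrier_vec n \<and> (\<forall>i<n. (\<lambda>\<omega>. f \<omega> $ i) \<in> borel_measurable N)"
  (is "?l \<longleftrightarrow> ?r")
proof
  assume l: ?l
  have c: "(\<lambda>x. \<lambda>i\<in>{..<n}. x $ i) \<in> vec_borel n \<rightarrow>\<^sub>M PiM {..<n} (\<lambda>_. borel :: real measure)"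
    unfolding vec_borel_def by (rule measurable_vimage_algebra1) (auto simp: space_PiM)
  have "(\<lambda>\<omega>. f \<omega> $ i) \<in> borel_measurable N" if "i < n" for i
    using measurable_compose[OF measurable_compose[OF l c] measurable_component_singleton[of i]] that
    by simp
  with measurable_space[OF l] show ?r by auto
next
  assume r: ?r
  show ?l
    unfolding vec_borel_def
  proof (rule measurable_vimage_algebra2)
    show "(\<lambda>\<omega>. \<lambda>i\<in>{..<n}. f \<omega> $ i) \<in> N \<rightarrow>\<^sub>M PiM {..<n} (\<lambda>_. borel)"
      using r by (intro measurable_restrict) auto
  qed (use r in auto)
qed

subsection \<open>Reflections preserve product Gaussian measures\<close>

text \<open>An arbitrary index set allows a block of a matrix to keep its original row and column
  numbers throughout the induction; renumbering happens only once, in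
  \<open>gaussian_mat_shift\<close>.\<close>

definition gauss :: "real \<Rightarrow> 'i set \<Rightarrow> ('i \<Rightarrow> real) measure" where
  "gauss \<sigma> I = PiM I (\<lambda>_. density lborel (normal_density 0 \<sigma>))"

lemma sets_gauss [simp, measurable_cong]: "sets (gauss \<sigma> I) = sets (PiM I (\<lambda>_. borel))"
  unfolding gauss_def by (intro sets_PiM_cong) auto

lemma space_gauss [simp]: "space (gauss \<sigma> I) = (\<Pi>\<^sub>E i\<in>I. UNIV)"
  by (simp add: gauss_def space_PiM)

lemma prob_space_gauss: "0 < \<sigma> \<Longrightarrow> prob_space (gauss \<sigma> I)"
  unfolding gauss_def by (intro prob_space_PiM prob_space_normal_density)

text \<open>By Fubini the coordinate \<open>k\<close> can be integrated first. With the other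
  coordinates fixed, \<open>g\<close> is a constant and the map is an affine map of the line with
  slope 1 or -1, which preserves Lebesgue measure. Slope 1 gives a shear, slope -1 a sign
  flip.\<close>

lemma nn_integral_PiM_shear:
  fixes g :: "('i \<Rightarrow> real) \<Rightarrow> real"
  assumes "finite I" "k \<in> I" and f [measurable]: "f \<in> borel_measurable (PiM I (\<lambda>_. lborel))"
    and g [measurable]: "g \<in> borel_measurable (PiM I (\<lambda>_. lborel))"
    and gk: "\<And>x a. x \<in> space (PiM I (\<lambda>_. lborel :: real measure)) \<Longrightarrow> g (x(k := a)) = g x"
    and e: "\<bar>e\<bar> = 1"
  shows "(\<integral>\<^sup>+x. f (x(k := e * x k + g x)) \<partial>PiM I (\<lambda>_. lborel)) = (\<integral>\<^sup>+x. f x \<partial>PiM I (\<lambda>_. lborel))"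
proof -
  interpret product_sigma_finite "\<lambda>_::'i. lborel :: real measure" ..
  define J where "J = I - {k}"
  have I: "I = insert k J" "finite J" "k \<notin> J" using assms by (auto simp: J_def)
  have [measurable]: "(\<lambda>x. x(k := e * x k + g x)) \<in> PiM I (\<lambda>_. lborel) \<rightarrow>\<^sub>M PiM I (\<lambda>_. lborel)"
    by (rule measurable_fun_upd[where J=I]) (use \<open>k \<in> I\<close> in auto)
  have "(\<integral>\<^sup>+x. f (x(k := e * x k + g x)) \<partial>PiM I (\<lambda>_. lborel))
      = (\<integral>\<^sup>+x. (\<integral>\<^sup>+y. f (x(k := e * y + g (x(k := y)))) \<partial>lborel) \<partial>PiM J (\<lambda>_. lborel))"
    unfolding I(1) by (subst product_nn_integral_insert) (use I in \<open>auto simp flip: I(1)\<close>)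
  also have "\<dots> = (\<integral>\<^sup>+x. (\<integral>\<^sup>+y. f (x(k := y)) \<partial>lborel) \<partial>PiM J (\<lambda>_. lborel))"
  proof (rule nn_integral_cong)
    fix x :: "'i \<Rightarrow> real" assume x: "x \<in> space (PiM J (\<lambda>_. lborel))"
    have x0: "x(k := y) \<in> space (PiM I (\<lambda>_. lborel))" for y
      using x I by (auto simp: space_PiM PiE_def extensional_def)
    define c where "c = g (x(k := 0))"
    have "g (x(k := y)) = c" for y using gk[OF x0[of 0], of y] by (simp add: c_def)
    then have "(\<integral>\<^sup>+y. f (x(k := e * y + g (x(k := y)))) \<partial>lborel)
        = (\<integral>\<^sup>+y. f (x(k := c + e * y)) \<partial>lborel)"
      by (simp add: add.commute)
    also have "\<dots> = (\<integral>\<^sup>+y. f (x(k := y)) \<partial>lborel)"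
    proof -
      have [measurable]: "(\<lambda>y. x(k := y)) \<in> borel \<rightarrow>\<^sub>M PiM I (\<lambda>_. lborel)"
        by (rule measurable_fun_upd[where J=J]) (use I x in auto)
      have "(\<lambda>y. f (x(k := y))) \<in> borel_measurable borel" by measurable
      from nn_integral_real_affine[OF this, of e c] e show ?thesis
        by auto
    qed
    finally show "(\<integral>\<^sup>+y. f (x(k := e * y + g (x(k := y)))) \<partial>lborel) = (\<integral>\<^sup>+y. f (x(k := y)) \<partial>lborel)" .
  qed
  also have "\<dots> = (\<integral>\<^sup>+x. f x \<partial>PiM I (\<lambda>_. lborel))"
    unfolding I(1) by (subst product_nn_integral_insert) (use I in \<open>auto simp flip: I(1)\<close>)
  finally show ?thesis .
qed

text \<open>Both measures agree on boxes, where the density factorises; boxes determine a product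
  measure.\<close>

lemma gauss_eq_density:
  assumes "finite I" "0 < \<sigma>"
  shows "gauss \<sigma> I = density (PiM I (\<lambda>_. lborel)) (\<lambda>x. ennreal (\<Prod>i\<in>I. normal_density 0 \<sigma> (x i)))"
proof -
  interpret N: prob_space "density lborel (normal_density 0 \<sigma>)"
    using assms by (intro prob_space_normal_density)
  interpret L: product_sigma_finite "\<lambda>_::'a. lborel :: real measure" ..
  interpret P: product_sigma_finite "\<lambda>_::'a. density lborel (normal_density 0 \<sigma>)" ..
  show ?thesis unfolding gauss_def
  proof (rule P.PiM_eqI[symmetric])
    fix A :: "'a \<Rightarrow> real set" assume A: "\<And>i. i \<in> I \<Longrightarrow> A i \<in> sets (density lborel (normal_density 0 \<sigma>))"
    then have A': "\<And>i. i \<in> I \<Longrightarrow> A i \<in> sets borel" by auto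
    have S: "Pi\<^sub>E I A \<in> sets (PiM I (\<lambda>_. lborel))"
      using A \<open>finite I\<close> by (intro sets_PiM_I_finite) auto
    have "emeasure (density (PiM I (\<lambda>_. lborel)) (\<lambda>x. ennreal (\<Prod>i\<in>I. normal_density 0 \<sigma> (x i)))) (Pi\<^sub>E I A)
        = (\<integral>\<^sup>+x. ennreal (\<Prod>i\<in>I. normal_density 0 \<sigma> (x i)) * indicator (Pi\<^sub>E I A) x \<partial>PiM I (\<lambda>_. lborel))"
      using S by (intro emeasure_density) auto
    also have "\<dots> = (\<integral>\<^sup>+x. (\<Prod>i\<in>I. ennreal (normal_density 0 \<sigma> (x i)) * indicator (A i) (x i)) \<partial>PiM I (\<lambda>_. lborel))"
      by (intro nn_integral_cong)
        (auto simp: prod.distrib prod_ennreal space_PiM PiE_def Pi_iff \<open>finite I\<close> indicator_def prod_eq_1_iff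
           intro!: prod_zero[symmetric] split: if_splits)
    also have "\<dots> = (\<Prod>i\<in>I. \<integral>\<^sup>+x. ennreal (normal_density 0 \<sigma> x) * indicator (A i) x \<partial>lborel)"
      using A' by (intro L.product_nn_integral_prod) (auto simp: \<open>finite I\<close>)
    also have "\<dots> = (\<Prod>i\<in>I. emeasure (density lborel (normal_density 0 \<sigma>)) (A i))"
      using A' by (intro prod.cong refl) (auto simp: emeasure_density)
    finally show "emeasure (density (PiM I (\<lambda>_. lborel)) (\<lambda>x. ennreal (\<Prod>i\<in>I. normal_density 0 \<sigma> (x i)))) (Pi\<^sub>E I A)
        = (\<Prod>i\<in>I. emeasure (density lborel (normal_density 0 \<sigma>)) (A i))" .
  qed (use \<open>finite I\<close> in \<open>auto intro!: sets_PiM_cong\<close>)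
qed

definition reflect :: "'i set \<Rightarrow> ('i \<Rightarrow> real) \<Rightarrow> ('i \<Rightarrow> real) \<Rightarrow> 'i \<Rightarrow> real" where
  "reflect I w x = (\<lambda>i\<in>I. x i - 2 * w i * (\<Sum>k\<in>I. w k * x k) / (\<Sum>k\<in>I. (w k)\<^sup>2))"

lemma measurable_reflect [measurable]:
  assumes "sets N = sets (PiM I (\<lambda>_. borel))"
  shows "reflect I w \<in> N \<rightarrow>\<^sub>M PiM I (\<lambda>_. borel)"
  unfolding reflect_def using assms by (subst measurable_cong_sets[OF assms refl]) measurable

text \<open>A reflection only flips the component along \<open>w\<close>: after expansion the cross
  term and the square term cancel. If the sum of squares of \<open>w\<close> is 0, division by zero
  makes it the identity.\<close>

lemma sum_square_reflect:
  assumes "finite I"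
  shows "(\<Sum>i\<in>I. (reflect I w x i)\<^sup>2) = (\<Sum>i\<in>I. (x i)\<^sup>2)"
proof (cases "(\<Sum>k\<in>I. (w k)\<^sup>2) = 0")
  case False
  define N where "N = (\<Sum>k\<in>I. (w k)\<^sup>2)"
  define p where "p = (\<Sum>k\<in>I. w k * x k)"
  have N0: "N \<noteq> 0" using False by (simp add: N_def)
  have "(\<Sum>i\<in>I. (reflect I w x i)\<^sup>2) = (\<Sum>i\<in>I. (x i)\<^sup>2 - 4 * p / N * (w i * x i) + 4 * p\<^sup>2 / N\<^sup>2 * (w i)\<^sup>2)"
  proof (intro sum.cong refl)
    fix i assume i: "i \<in> I"
    have "reflect I w x i = x i - 2 * w i * p / N"
      using i by (simp add: reflect_def N_def p_def)
    show "(reflect I w x i)\<^sup>2 = (x i)\<^sup>2 - 4 * p / N * (w i * x i) + 4 * p\<^sup>2 / N\<^sup>2 * (w i)\<^sup>2"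
      unfolding \<open>reflect I w x i = _\<close> using N0 by (simp add: power2_eq_square field_simps)
  qed
  also have "\<dots> = (\<Sum>i\<in>I. (x i)\<^sup>2) - 4 * p / N * p + 4 * p\<^sup>2 / N\<^sup>2 * N"
    by (simp only: sum.distrib sum_subtractf p_def N_def sum_distrib_left)
  also have "\<dots> = (\<Sum>i\<in>I. (x i)\<^sup>2)"
    using False by (simp add: power2_eq_square flip: N_def)
  finally show ?thesis .
qed (simp add: reflect_def)

text \<open>Every shear adds a multiple of the same coordinate \<open>x k\<close>, which none of
  them changes because \<open>k\<close> is not in \<open>J\<close>; hence they can be carried out
  one at a time.\<close>

lemma nn_integral_PiM_shears:
  fixes a :: "'i \<Rightarrow> real"
  assumes "finite I" "k \<in> I" "J \<subseteq> I - {k}" and f: "f \<in> borel_measurable (PiM I (\<lambda>_. lborel))"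
  shows "(\<integral>\<^sup>+x. f (\<lambda>i\<in>I. if i \<in> J then x i + a i * x k else x i) \<partial>PiM I (\<lambda>_. lborel))
       = (\<integral>\<^sup>+x. f x \<partial>PiM I (\<lambda>_. lborel))"
proof -
  have "finite J" using assms finite_subset by blast
  then show ?thesis using assms(3) f
  proof (induction J arbitrary: f)
    case empty
    have "(\<integral>\<^sup>+x. f (\<lambda>i\<in>I. x i) \<partial>PiM I (\<lambda>_. lborel)) = (\<integral>\<^sup>+x. f x \<partial>PiM I (\<lambda>_. lborel))"
      by (intro nn_integral_cong) (simp add: space_PiM)
    then show ?case by (simp del: restrict_apply)
  next
    case (insert j J)
    note [measurable] = insert.prems(2)
    have j: "j \<in> I" "j \<noteq> k" using insert by auto
    define h where "h x = f (x(j := 1 * x j + a j * x k))" for x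
    have "(\<lambda>x. x(j := 1 * x j + a j * x k)) \<in> PiM I (\<lambda>_. lborel) \<rightarrow>\<^sub>M PiM I (\<lambda>_. lborel)"
      by (rule measurable_fun_upd[where J=I]) (use j \<open>k \<in> I\<close> in auto)
    then have h [measurable]: "h \<in> borel_measurable (PiM I (\<lambda>_. lborel))"
      unfolding h_def by (rule measurable_compose) fact
    have "(\<integral>\<^sup>+x. f (\<lambda>i\<in>I. if i \<in> insert j J then x i + a i * x k else x i) \<partial>PiM I (\<lambda>_. lborel))
        = (\<integral>\<^sup>+x. h (\<lambda>i\<in>I. if i \<in> J then x i + a i * x k else x i) \<partial>PiM I (\<lambda>_. lborel))"
      unfolding h_def using insert j \<open>k \<in> I\<close>
      by (intro nn_integral_cong arg_cong[of _ _ f]) (auto simp: fun_eq_iff)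
    also have "\<dots> = (\<integral>\<^sup>+x. h x \<partial>PiM I (\<lambda>_. lborel))"
      using insert by (intro insert.IH) auto
    also have "\<dots> = (\<integral>\<^sup>+x. f x \<partial>PiM I (\<lambda>_. lborel))"
      unfolding h_def using j assms
      by (intro nn_integral_PiM_shear) (auto intro!: borel_measurable_times)
    finally show ?case .
  qed
qed

text \<open>If \<open>w k \<noteq> 0\<close>, then in the coordinates where \<open>x k\<close> is replaced by \<open>(\<Sum>i. w i * x i) / w k\<close>
  the reflection flips the sign of the new coordinate and shears the others along it.\<close>

lemma nn_integral_PiM_reflect:
  assumes "finite I" "k \<in> I" "w k \<noteq> 0" and f [measurable]: "f \<in> borel_measurable (PiM I (\<lambda>_. lborel))"
  shows "(\<integral>\<^sup>+x. f (reflect I w x) \<partial>PiM I (\<lambda>_. lborel)) = (\<integral>\<^sup>+x. f x \<partial>PiM I (\<lambda>_. lborel))"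
proof -
  define N where "N = (\<Sum>k\<in>I. (w k)\<^sup>2)"
  define g where "g x = (\<Sum>i\<in>I - {k}. w i / w k * x i)" for x :: "'a \<Rightarrow> real"
  define T1 where "T1 x = x(k := 1 * x k + g x)" for x :: "'a \<Rightarrow> real"
  \<comment> \<open>The sum of all \<open>w i * x i\<close> is \<open>w k\<close> times the new
    coordinate, so the reflection subtracts \<open>2 * w i * w k / N\<close> times that coordinate
    from each of the others.\<close>
  define T2 where "T2 x = (\<lambda>i\<in>I. if i \<in> I - {k} then x i + (- 2 * w i * w k / N) * x k else x i)" for x :: "'a \<Rightarrow> real"
  \<comment> \<open>The new coordinate comes out negated; to return to the old coordinate
    \<open>k\<close>, \<open>g\<close> has to be subtracted at the coordinates already
    reflected.\<close>
  define T3 where "T3 x = x(k := (-1) * x k + (- g x))" for x :: "'a \<Rightarrow> real"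
  have N0: "N \<noteq> 0"
    using assms sum_nonneg_eq_0_iff[of I "\<lambda>k. (w k)\<^sup>2"] by (auto simp: N_def)
  have g [measurable]: "g \<in> borel_measurable (PiM I (\<lambda>_. lborel))"
    unfolding g_def by measurable
  have gk: "g (x(k := a)) = g x" for x a
    unfolding g_def by (intro sum.cong) auto
  have [measurable]: "T1 \<in> PiM I (\<lambda>_. lborel) \<rightarrow>\<^sub>M PiM I (\<lambda>_. lborel)"
      "T3 \<in> PiM I (\<lambda>_. lborel) \<rightarrow>\<^sub>M PiM I (\<lambda>_. lborel)"
    unfolding T1_def T3_def
    by (rule measurable_fun_upd[where J=I]; use \<open>k \<in> I\<close> in auto)+
  have [measurable]: "T2 \<in> PiM I (\<lambda>_. lborel) \<rightarrow>\<^sub>M PiM I (\<lambda>_. lborel)"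
    unfolding T2_def using \<open>k \<in> I\<close> by (intro measurable_restrict) auto
  have eq: "reflect I w x = T3 (T2 (T1 x))" if x: "x \<in> space (PiM I (\<lambda>_. lborel :: real measure))" for x
  proof
    fix i
    have p: "(\<Sum>i\<in>I. w i * x i) = w k * (x k + g x)"
      unfolding g_def using assms by (subst sum.remove[of _ k]) (auto simp: sum_distrib_left algebra_simps)
    have r: "reflect I w x i = x i - 2 * w i * w k / N * (x k + g x)" if "i \<in> I" for i
      using that by (simp add: reflect_def p flip: N_def)
    show "reflect I w x i = T3 (T2 (T1 x)) i"
    proof (cases "i = k")
      case False
      then show ?thesis
        using \<open>k \<in> I\<close> r[of i] x by (cases "i \<in> I") (auto simp: T1_def T2_def T3_def reflect_def)
    next
      case True
      have "g (T2 (T1 x)) = (\<Sum>i\<in>I - {k}. w i / w k * (x i - 2 * w i * w k / N * (x k + g x)))"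
        unfolding g_def[of "T2 (T1 x)"] using \<open>k \<in> I\<close> by (intro sum.cong refl) (auto simp: T1_def T2_def)
      also have "\<dots> = (\<Sum>i\<in>I - {k}. w i / w k * x i - (w i)\<^sup>2 * (2 / N * (x k + g x)))"
        using assms by (intro sum.cong refl) (auto simp: field_simps power2_eq_square)
      also have "\<dots> = g x - (\<Sum>i\<in>I - {k}. (w i)\<^sup>2) * (2 / N * (x k + g x))"
        by (simp only: sum_subtractf g_def sum_distrib_right)
      also have "(\<Sum>i\<in>I - {k}. (w i)\<^sup>2) = N - (w k)\<^sup>2"
        unfolding N_def using assms by (subst (2) sum.remove[of _ k]) auto
      finally have "g (T2 (T1 x)) = g x - (N - (w k)\<^sup>2) * (2 / N * (x k + g x))" .
      then have "T3 (T2 (T1 x)) k = - (x k + g x) - (g x - (N - (w k)\<^sup>2) * (2 / N * (x k + g x)))"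
        using \<open>k \<in> I\<close> by (simp add: T3_def T2_def T1_def)
      also have "\<dots> = x k - 2 * w k * w k / N * (x k + g x)"
        using N0 by (simp add: field_simps power2_eq_square)
      finally show ?thesis using r[of k] \<open>k \<in> I\<close> True by simp
    qed
  qed
  have "(\<integral>\<^sup>+x. f (reflect I w x) \<partial>PiM I (\<lambda>_. lborel)) = (\<integral>\<^sup>+x. f (T3 (T2 (T1 x))) \<partial>PiM I (\<lambda>_. lborel))"
    by (intro nn_integral_cong) (simp add: eq)
  also have "\<dots> = (\<integral>\<^sup>+x. f (T3 (T2 x)) \<partial>PiM I (\<lambda>_. lborel))"
    unfolding T1_def using assms by (intro nn_integral_PiM_shear) (auto simp: gk[unfolded fun_upd_def] fun_upd_def)
  also have "\<dots> = (\<integral>\<^sup>+x. f (T3 x) \<partial>PiM I (\<lambda>_. lborel))"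
    unfolding T2_def using assms by (intro nn_integral_PiM_shears) auto
  also have "\<dots> = (\<integral>\<^sup>+x. f x \<partial>PiM I (\<lambda>_. lborel))"
    unfolding T3_def using assms by (intro nn_integral_PiM_shear) (auto simp: gk[unfolded fun_upd_def] fun_upd_def)
  finally show ?thesis .
qed

text \<open>The density depends on \<open>x\<close> only through the sum of squares, which the
  reflection keeps, and the Lebesgue product measure is invariant by
  \<open>nn_integral_PiM_reflect\<close>. If \<open>w\<close> vanishes on \<open>I\<close>, there is
  no pivot \<open>k\<close>, but the reflection is the identity.\<close>

lemma distr_gauss_reflect:
  assumes "finite I" "0 < \<sigma>"
  shows "distr (gauss \<sigma> I) (PiM I (\<lambda>_. borel)) (reflect I w) = gauss \<sigma> I"
proof (cases "\<forall>k\<in>I. w k = 0")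
  case True
  have "distr (gauss \<sigma> I) (PiM I (\<lambda>_. borel)) (reflect I w) = distr (gauss \<sigma> I) (gauss \<sigma> I) (\<lambda>x. x)"
    by (rule distr_cong) (use True in \<open>auto simp: reflect_def fun_eq_iff PiE_def extensional_def\<close>)
  then show ?thesis by simp
next
  case False
  then obtain k where k: "k \<in> I" "w k \<noteq> 0" by auto
  define p where "p x = ennreal (\<Prod>i\<in>I. normal_density 0 \<sigma> (x i))" for x :: "'a \<Rightarrow> real"
  have p: "p x = ennreal ((1 / sqrt (2 * pi * \<sigma>\<^sup>2)) ^ card I * exp (- (\<Sum>i\<in>I. (x i)\<^sup>2) / (2 * \<sigma>\<^sup>2)))" for x
  proof -
    have "(\<Prod>i\<in>I. normal_density 0 \<sigma> (x i)) = (\<Prod>i\<in>I. 1 / sqrt (2 * pi * \<sigma>\<^sup>2) * exp (- (x i)\<^sup>2 / (2 * \<sigma>\<^sup>2)))"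
      by (simp add: normal_density_def)
    also have "\<dots> = (1 / sqrt (2 * pi * \<sigma>\<^sup>2)) ^ card I * exp (\<Sum>i\<in>I. - (x i)\<^sup>2 / (2 * \<sigma>\<^sup>2))"
      by (simp only: prod.distrib prod_constant exp_sum[OF assms(1)])
    also have "(\<Sum>i\<in>I. - (x i)\<^sup>2 / (2 * \<sigma>\<^sup>2)) = - (\<Sum>i\<in>I. (x i)\<^sup>2) / (2 * \<sigma>\<^sup>2)"
      by (simp only: sum_divide_distrib[symmetric] sum_negf)
    finally show ?thesis unfolding p_def by simp
  qed
  have pr: "p (reflect I w x) = p x" for x
    unfolding p using assms by (simp only: sum_square_reflect)
  have [measurable]: "p \<in> borel_measurable (PiM I (\<lambda>_. lborel))"
    unfolding p_def by measurable
  have g: "gauss \<sigma> I = density (PiM I (\<lambda>_. lborel)) p"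
    unfolding p_def using assms by (rule gauss_eq_density)
  have s: "sets (PiM I (\<lambda>_. lborel :: real measure)) = sets (PiM I (\<lambda>_. borel))"
    by (intro sets_PiM_cong) auto
  note [measurable_cong] = s
  show ?thesis
  proof (rule measure_eqI)
    fix B assume "B \<in> sets (distr (gauss \<sigma> I) (PiM I (\<lambda>_. borel)) (reflect I w))"
    then have B [measurable]: "B \<in> sets (PiM I (\<lambda>_. borel))" by simp
    have r [measurable]: "reflect I w \<in> PiM I (\<lambda>_. lborel) \<rightarrow>\<^sub>M PiM I (\<lambda>_. borel)"
      by (intro measurable_reflect s)
    have r2 [measurable]: "reflect I w \<in> gauss \<sigma> I \<rightarrow>\<^sub>M PiM I (\<lambda>_. borel)"
      by (intro measurable_reflect) simp
    have "emeasure (distr (gauss \<sigma> I) (PiM I (\<lambda>_. borel)) (reflect I w)) B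
        = (\<integral>\<^sup>+x. indicator B (reflect I w x) \<partial>gauss \<sigma> I)"
      using nn_integral_distr[OF r2, of "indicator B"] by simp
    also have "\<dots> = (\<integral>\<^sup>+x. p (reflect I w x) * indicator B (reflect I w x) \<partial>PiM I (\<lambda>_. lborel))"
      unfolding g pr by (subst nn_integral_density) auto
    also have "\<dots> = (\<integral>\<^sup>+x. p x * indicator B x \<partial>PiM I (\<lambda>_. lborel))"
      using assms k by (intro nn_integral_PiM_reflect[where f="\<lambda>x. p x * indicator B x"]) auto
    also have "\<dots> = emeasure (gauss \<sigma> I) B"
      unfolding g by (subst emeasure_density) (auto simp: s)
    finally show "emeasure (distr (gauss \<sigma> I) (PiM I (\<lambda>_. borel)) (reflect I w)) B = emeasure (gauss \<sigma> I) B" .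
  qed simp
qed

text \<open>For mutually orthogonal directions this is the composition of the reflections in the
  \<open>w l\<close>, written as one sum. It serves to apply one reflection to all columns, or to
  all rows, of a matrix whose entries are treated as a single vector.\<close>

definition reflects :: "'i set \<Rightarrow> 'l set \<Rightarrow> ('l \<Rightarrow> 'i \<Rightarrow> real) \<Rightarrow> ('i \<Rightarrow> real) \<Rightarrow> 'i \<Rightarrow> real" where
  "reflects I L w x =
     (\<lambda>i\<in>I. x i - (\<Sum>l\<in>L. 2 * w l i * (\<Sum>k\<in>I. w l k * x k) / (\<Sum>k\<in>I. (w l k)\<^sup>2)))"

text \<open>The reflections in the other directions leave the inner product with \<open>w l\<close>
  unchanged, by orthogonality. Subtracting all terms at once therefore agrees with performing the
  reflections one after the other.\<close>

lemma distr_gauss_reflects: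
  assumes "finite I" "0 < \<sigma>" "finite L"
    and orth: "\<And>l l'. l \<in> L \<Longrightarrow> l' \<in> L \<Longrightarrow> l \<noteq> l' \<Longrightarrow> (\<Sum>k\<in>I. w l k * w l' k) = 0"
  shows "distr (gauss \<sigma> I) (PiM I (\<lambda>_. borel)) (reflects I L w) = gauss \<sigma> I"
  using assms(3,4)
proof (induction L)
  case empty
  have "distr (gauss \<sigma> I) (PiM I (\<lambda>_. borel)) (reflects I {} w) = distr (gauss \<sigma> I) (gauss \<sigma> I) (\<lambda>x. x)"
    by (rule distr_cong) (auto simp: reflects_def fun_eq_iff PiE_def extensional_def)
  then show ?case by simp
next
  case (insert l L)
  have [measurable]: "reflects I L w \<in> gauss \<sigma> I \<rightarrow>\<^sub>M PiM I (\<lambda>_. borel)"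
    unfolding reflects_def by measurable
  have eq: "reflects I (insert l L) w x = reflect I (w l) (reflects I L w x)" for x
  proof -
    have "(\<Sum>k\<in>I. w l k * reflects I L w x k)
        = (\<Sum>k\<in>I. w l k * x k) - (\<Sum>k\<in>I. \<Sum>l'\<in>L. w l k * w l' k * (2 * (\<Sum>k\<in>I. w l' k * x k) / (\<Sum>k\<in>I. (w l' k)\<^sup>2)))"
      by (auto simp: reflects_def sum_subtractf[symmetric] sum_distrib_left algebra_simps intro!: sum.cong)
    also have "(\<Sum>k\<in>I. \<Sum>l'\<in>L. w l k * w l' k * (2 * (\<Sum>k\<in>I. w l' k * x k) / (\<Sum>k\<in>I. (w l' k)\<^sup>2)))
        = (\<Sum>l'\<in>L. (\<Sum>k\<in>I. w l k * w l' k) * (2 * (\<Sum>k\<in>I. w l' k * x k) / (\<Sum>k\<in>I. (w l' k)\<^sup>2)))"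
      by (subst sum.swap) (simp only: sum_distrib_right)
    also have "\<dots> = 0"
      using insert by (intro sum.neutral) (metis insertCI mult_zero_left)
    finally show ?thesis
      using insert by (auto simp: reflects_def reflect_def fun_eq_iff)
  qed
  have "distr (gauss \<sigma> I) (PiM I (\<lambda>_. borel)) (reflects I (insert l L) w)
      = distr (distr (gauss \<sigma> I) (PiM I (\<lambda>_. borel)) (reflects I L w)) (PiM I (\<lambda>_. borel)) (reflect I (w l))"
    unfolding eq by (subst distr_distr) (auto simp: comp_def)
  also have "\<dots> = gauss \<sigma> I"
    using insert assms by (simp add: distr_gauss_reflect)
  finally show ?case .
qed

subsection \<open>Gaussian families independent of a sigma-field\<close>

text \<open>One product formula holds both facts: \<open>A = space M\<close> gives the law of the
  family, a general \<open>A\<close> its independence of \<open>G\<close>. The restriction to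
  \<open>I\<close> allows \<open>Z\<close> to be the entry function of a whole matrix of which only
  a block is concerned.\<close>

definition gaussian_given ::
  "'w measure \<Rightarrow> 'w measure \<Rightarrow> real \<Rightarrow> 'i set \<Rightarrow> ('w \<Rightarrow> 'i \<Rightarrow> real) \<Rightarrow> bool" where
  "gaussian_given M G \<sigma> I Z \<longleftrightarrow> subalgebra M G \<and> (\<forall>i\<in>I. (\<lambda>\<omega>. Z \<omega> i) \<in> borel_measurable M) \<and>
     (\<forall>A\<in>sets G. \<forall>B\<in>sets (PiM I (\<lambda>_. borel)).
        emeasure M {\<omega>\<in>A. restrict (Z \<omega>) I \<in> B} = emeasure M A * emeasure (gauss \<sigma> I) B)"

lemma subalgebra_id: "subalgebra M G \<Longrightarrow> (\<lambda>\<omega>. \<omega>) \<in> M \<rightarrow>\<^sub>M G"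
  by (auto simp: subalgebra_def measurable_def)

lemma gaussian_given_measurable:
  "gaussian_given M G \<sigma> I Z \<Longrightarrow> (\<lambda>\<omega>. restrict (Z \<omega>) I) \<in> M \<rightarrow>\<^sub>M PiM I (\<lambda>_. borel)"
  by (intro measurable_restrict) (auto simp: gaussian_given_def)

lemma gaussian_given_cong:
  assumes Z: "gaussian_given M G \<sigma> I Z"
    and eq: "\<And>\<omega> i. \<omega> \<in> space M \<Longrightarrow> i \<in> I \<Longrightarrow> Z' \<omega> i = Z \<omega> i"
  shows "gaussian_given M G \<sigma> I Z'"
proof -
  have sub: "subalgebra M G" using Z by (simp add: gaussian_given_def)
  have "(\<lambda>\<omega>. Z' \<omega> i) \<in> borel_measurable M" if "i \<in> I" for i
    using Z that by (subst measurable_cong[OF eq]) (auto simp: gaussian_given_def)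
  moreover have "{\<omega>\<in>A. restrict (Z' \<omega>) I \<in> B} = {\<omega>\<in>A. restrict (Z \<omega>) I \<in> B}" if "A \<in> sets G" for A B
  proof -
    have "A \<subseteq> space M" using sets.sets_into_space[OF that] sub by (simp add: subalgebra_def)
    then have "restrict (Z' \<omega>) I = restrict (Z \<omega>) I" if "\<omega> \<in> A" for \<omega>
      using that eq by (auto simp: fun_eq_iff)
    then show ?thesis by auto
  qed
  ultimately show ?thesis using Z by (simp add: gaussian_given_def)
qed

text \<open>Independence makes the joint law of the sample point, seen through \<open>G\<close>, and
  of the family a product measure. Fubini then allows the sample point to be frozen while the family
  is integrated out.\<close>

lemma gaussian_given_emeasure:
  fixes Z :: "'w \<Rightarrow> 'i \<Rightarrow> real"
  assumes "prob_space M" "0 < \<sigma>" and Z: "gaussian_given M G \<sigma> I Z"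
    and K: "K \<in> sets (G \<Otimes>\<^sub>M PiM I (\<lambda>_. borel))"
  shows "emeasure M {\<omega>\<in>space M. (\<omega>, restrict (Z \<omega>) I) \<in> K}
       = (\<integral>\<^sup>+\<omega>. emeasure (gauss \<sigma> I) (Pair \<omega> -` K) \<partial>M)"
proof -
  interpret M: prob_space M by fact
  have sub: "subalgebra M G" using Z by (simp add: gaussian_given_def)
  \<comment> \<open>The product formula is available for events of \<open>G\<close> only, so the
    first factor must be \<open>M\<close> restricted to \<open>G\<close>.\<close>
  let ?P = "restr_to_subalg M G"
  interpret P: prob_space ?P by (rule prob_space_restr_to_subalg[OF sub assms(1)])
  interpret N: prob_space "gauss \<sigma> I" using assms by (simp add: prob_space_gauss)
  note [measurable] = gaussian_given_measurable[OF Z] subalgebra_id[OF sub]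
  let ?f = "\<lambda>\<omega>. (\<omega>, restrict (Z \<omega>) I)"
  have sG: "space G = space M" using sub by (simp add: subalgebra_def)
  have sP: "sets (?P \<Otimes>\<^sub>M gauss \<sigma> I) = sets (G \<Otimes>\<^sub>M PiM I (\<lambda>_. borel))"
    by (intro sets_pair_measure_cong) (auto simp: sets_restr_to_subalg[OF sub])
  have "?P \<Otimes>\<^sub>M gauss \<sigma> I = distr M (G \<Otimes>\<^sub>M PiM I (\<lambda>_. borel)) ?f"
  proof (rule pair_measure_eqI)
    fix A B assume "A \<in> sets ?P" "B \<in> sets (gauss \<sigma> I)"
    then have A: "A \<in> sets G" and B: "B \<in> sets (PiM I (\<lambda>_. borel))"
      by (auto simp: sets_restr_to_subalg[OF sub])
    have "A \<subseteq> space M" using sets.sets_into_space[OF A] sG by simp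
    then have e: "?f -` (A \<times> B) \<inter> space M = {\<omega>\<in>A. restrict (Z \<omega>) I \<in> B}" by auto
    show "emeasure ?P A * emeasure (gauss \<sigma> I) B = emeasure (distr M (G \<Otimes>\<^sub>M PiM I (\<lambda>_. borel)) ?f) (A \<times> B)"
      using A B Z by (subst emeasure_distr) (auto simp: e emeasure_restr_to_subalg[OF sub] gaussian_given_def)
  qed (use sP in \<open>auto intro: P.sigma_finite_measure_axioms N.sigma_finite_measure_axioms\<close>)
  then have "emeasure (?P \<Otimes>\<^sub>M gauss \<sigma> I) K = emeasure (distr M (G \<Otimes>\<^sub>M PiM I (\<lambda>_. borel)) ?f) K"
    by simp
  also have "\<dots> = emeasure M {\<omega>\<in>space M. (\<omega>, restrict (Z \<omega>) I) \<in> K}"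
    using K by (subst emeasure_distr) (auto intro!: arg_cong[where f="emeasure M"])
  finally have "emeasure M {\<omega>\<in>space M. (\<omega>, restrict (Z \<omega>) I) \<in> K} = emeasure (?P \<Otimes>\<^sub>M gauss \<sigma> I) K" ..
  also have "\<dots> = (\<integral>\<^sup>+\<omega>. emeasure (gauss \<sigma> I) (Pair \<omega> -` K) \<partial>?P)"
    using K sP by (intro N.emeasure_pair_measure_alt) simp
  also have "\<dots> = (\<integral>\<^sup>+\<omega>. emeasure (gauss \<sigma> I) (Pair \<omega> -` K) \<partial>M)"
    using K N.measurable_emeasure_Pair[of K G] sP
    by (intro nn_integral_subalgebra2[OF sub]) (simp add: sets_pair_measure_cong[OF refl sets_gauss])
  finally show ?thesis .
qed

text \<open>Freezing argument: \<open>\<omega>\<close> enters \<open>T\<close> only through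
  \<open>G\<close>, of which \<open>Z\<close> is independent, and each frozen
  \<open>T \<omega>\<close> preserves \<open>gauss\<close>. A transformation may thus depend on
  everything known so far.\<close>

lemma gaussian_given_map:
  fixes Z :: "'w \<Rightarrow> 'i \<Rightarrow> real"
  assumes "prob_space M" "0 < \<sigma>" and Z: "gaussian_given M G \<sigma> I Z"
    and T: "(\<lambda>(\<omega>, x). T \<omega> x) \<in> G \<Otimes>\<^sub>M PiM I (\<lambda>_. borel) \<rightarrow>\<^sub>M PiM I (\<lambda>_. borel)"
    and inv: "\<And>\<omega>. \<omega> \<in> space M \<Longrightarrow> distr (gauss \<sigma> I) (PiM I (\<lambda>_. borel)) (T \<omega>) = gauss \<sigma> I"
    and Z': "\<And>\<omega> i. \<omega> \<in> space M \<Longrightarrow> i \<in> I \<Longrightarrow> Z' \<omega> i = T \<omega> (restrict (Z \<omega>) I) i"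
  shows "gaussian_given M G \<sigma> I Z'"
proof -
  have sub: "subalgebra M G" using Z by (simp add: gaussian_given_def)
  have sG: "space G = space M" using sub by (simp add: subalgebra_def)
  note [measurable] = gaussian_given_measurable[OF Z] subalgebra_id[OF sub]
  have TZ: "(\<lambda>\<omega>. T \<omega> (restrict (Z \<omega>) I)) \<in> M \<rightarrow>\<^sub>M PiM I (\<lambda>_. borel)"
    using measurable_compose[OF _ T, of "\<lambda>\<omega>. (\<omega>, restrict (Z \<omega>) I)" M] by simp
  have eq: "restrict (Z' \<omega>) I = T \<omega> (restrict (Z \<omega>) I)" if "\<omega> \<in> space M" for \<omega>
    using measurable_space[OF TZ that] Z'[OF that]
    by (auto simp: space_PiM fun_eq_iff PiE_def extensional_def)
  have meas: "(\<lambda>\<omega>. Z' \<omega> i) \<in> borel_measurable M" if "i \<in> I" for i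
    using measurable_compose[OF TZ measurable_component_singleton[OF that]]
    by (rule measurable_cong[THEN iffD1, rotated]) (simp add: Z' that)
  have "emeasure M {\<omega>\<in>A. restrict (Z' \<omega>) I \<in> B} = emeasure M A * emeasure (gauss \<sigma> I) B"
    if A [measurable]: "A \<in> sets G" and B [measurable]: "B \<in> sets (PiM I (\<lambda>_. borel))" for A B
  proof -
    have AM: "A \<subseteq> space M" "A \<in> sets M" using sets.sets_into_space[OF A] sG sub A by (auto simp: subalgebra_def)
    \<comment> \<open>\<open>K\<close> combines the event \<open>A\<close> with the transformed
      family; its section at \<open>\<omega>\<close> is the preimage of \<open>B\<close> under
      \<open>T \<omega>\<close> if \<open>\<omega>\<close> is in \<open>A\<close>, and empty
      otherwise.\<close>
    define K where "K = {p \<in> space (G \<Otimes>\<^sub>M PiM I (\<lambda>_. borel :: real measure)). fst p \<in> A \<and> (case p of (\<omega>, x) \<Rightarrow> T \<omega> x) \<in> B}"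
    have K: "K \<in> sets (G \<Otimes>\<^sub>M PiM I (\<lambda>_. borel))"
      unfolding K_def using T by measurable
    have "{\<omega>\<in>A. restrict (Z' \<omega>) I \<in> B} = {\<omega>\<in>space M. (\<omega>, restrict (Z \<omega>) I) \<in> K}"
      using AM(1) by (auto simp: K_def eq sG space_pair_measure space_PiM)
    then have "emeasure M {\<omega>\<in>A. restrict (Z' \<omega>) I \<in> B} = (\<integral>\<^sup>+\<omega>. emeasure (gauss \<sigma> I) (Pair \<omega> -` K) \<partial>M)"
      using gaussian_given_emeasure[OF assms(1-3) K] by simp
    also have "\<dots> = (\<integral>\<^sup>+\<omega>. emeasure (gauss \<sigma> I) B * indicator A \<omega> \<partial>M)"
    proof (intro nn_integral_cong)
      fix \<omega> assume w: "\<omega> \<in> space M"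
      have Tw: "T \<omega> \<in> gauss \<sigma> I \<rightarrow>\<^sub>M PiM I (\<lambda>_. borel)"
        using measurable_Pair2[OF T, of \<omega>] w sG by (simp add: measurable_cong_sets[OF sets_gauss refl])
      have "Pair \<omega> -` K = (if \<omega> \<in> A then T \<omega> -` B \<inter> space (gauss \<sigma> I) else {})"
        using w sG by (auto simp: K_def space_pair_measure space_PiM)
      moreover have "emeasure (gauss \<sigma> I) (T \<omega> -` B \<inter> space (gauss \<sigma> I)) = emeasure (gauss \<sigma> I) B"
        using emeasure_distr[OF Tw B] inv[OF w] by simp
      ultimately show "emeasure (gauss \<sigma> I) (Pair \<omega> -` K) = emeasure (gauss \<sigma> I) B * indicator A \<omega>"
        by (simp split: split_indicator)
    qed
    also have "\<dots> = emeasure M A * emeasure (gauss \<sigma> I) B"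
      using AM by (subst nn_integral_cmult_indicator) (auto simp: mult.commute)
    finally show ?thesis .
  qed
  with sub meas show ?thesis by (simp add: gaussian_given_def)
qed

text \<open>The field generated by \<open>G\<close> and the coordinates of \<open>Y\<close> in
  \<open>I\<close>. As a pull-back along one pair map, each of its events has the form "the pair
  lies in \<open>K\<close>", which is the form that \<open>gaussian_given_emeasure\<close>
  evaluates.\<close>

definition adjoin :: "'w measure \<Rightarrow> 'i set \<Rightarrow> ('w \<Rightarrow> 'i \<Rightarrow> real) \<Rightarrow> 'w measure" where
  "adjoin G I Y = vimage_algebra (space G) (\<lambda>\<omega>. (\<omega>, restrict (Y \<omega>) I)) (G \<Otimes>\<^sub>M PiM I (\<lambda>_. borel))"

lemma adjoin_pair: "(\<lambda>\<omega>. (\<omega>, restrict (Y \<omega>) I)) \<in> adjoin G I Y \<rightarrow>\<^sub>M G \<Otimes>\<^sub>M PiM I (\<lambda>_. borel)"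
  unfolding adjoin_def by (rule measurable_vimage_algebra1) (auto simp: space_pair_measure space_PiM)

lemma subalgebra_adjoin: "subalgebra (adjoin G I Y) G"
proof -
  have "(\<lambda>\<omega>. \<omega>) \<in> adjoin G I Y \<rightarrow>\<^sub>M G"
    using measurable_compose[OF adjoin_pair measurable_fst] by simp
  from measurable_sets[OF this] have "A \<in> sets (adjoin G I Y)" if "A \<in> sets G" for A
    using that sets.sets_into_space[OF that] by (auto simp: adjoin_def Int_absorb2)
  then show ?thesis by (auto simp: subalgebra_def adjoin_def)
qed

lemma measurable_adjoin: "i \<in> I \<Longrightarrow> (\<lambda>\<omega>. Y \<omega> i) \<in> borel_measurable (adjoin G I Y)"
  using measurable_compose[OF measurable_compose[OF adjoin_pair measurable_snd] measurable_component_singleton[of i]]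
  by simp

text \<open>Under the product measure the coordinates in \<open>I\<close> are independent of those
  in \<open>J\<close>. Hence revealing the former in addition to \<open>G\<close> leaves the law of
  the latter unchanged.\<close>

lemma gaussian_given_split:
  fixes Z :: "'w \<Rightarrow> 'i \<Rightarrow> real"
  assumes "prob_space M" "0 < \<sigma>" and fin: "finite I" "finite J" and disj: "I \<inter> J = {}"
    and Z: "gaussian_given M G \<sigma> (I \<union> J) Z"
  shows "gaussian_given M (adjoin G I Z) \<sigma> J Z"
proof -
  interpret M: prob_space M by fact
  interpret I: prob_space "gauss \<sigma> I" using assms by (simp add: prob_space_gauss)
  interpret J: prob_space "gauss \<sigma> J" using assms by (simp add: prob_space_gauss)
  interpret n: prob_space "density lborel (normal_density 0 \<sigma>)"
    using assms by (intro prob_space_normal_density)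
  interpret PS: product_sigma_finite "\<lambda>_::'i. density lborel (normal_density 0 \<sigma>)" ..
  have sub: "subalgebra M G" using Z by (simp add: gaussian_given_def)
  have sG: "space G = space M" using sub by (simp add: subalgebra_def)
  note [measurable] = gaussian_given_measurable[OF Z] subalgebra_id[OF sub]
  have Zi: "(\<lambda>\<omega>. Z \<omega> i) \<in> borel_measurable M" if "i \<in> I \<union> J" for i
    using Z that by (simp add: gaussian_given_def)
  have [measurable]: "(\<lambda>\<omega>. restrict (Z \<omega>) I) \<in> M \<rightarrow>\<^sub>M PiM I (\<lambda>_. borel)"
    using Zi by (intro measurable_restrict) auto
  have pairM: "(\<lambda>\<omega>. (\<omega>, restrict (Z \<omega>) I)) \<in> M \<rightarrow>\<^sub>M G \<Otimes>\<^sub>M PiM I (\<lambda>_. borel)"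
    by measurable
  have prod: "emeasure (gauss \<sigma> (I \<union> J)) {x \<in> space (gauss \<sigma> (I \<union> J)). restrict x I \<in> B \<and> restrict x J \<in> C}
      = emeasure (gauss \<sigma> I) B * emeasure (gauss \<sigma> J) C"
    if B: "B \<in> sets (PiM I (\<lambda>_. borel))" and C: "C \<in> sets (PiM J (\<lambda>_. borel))" for B C
  proof -
    have mm: "merge I J \<in> gauss \<sigma> I \<Otimes>\<^sub>M gauss \<sigma> J \<rightarrow>\<^sub>M gauss \<sigma> (I \<union> J)"
      unfolding gauss_def by (rule measurable_merge)
    let ?S = "{x \<in> space (gauss \<sigma> (I \<union> J)). restrict x I \<in> B \<and> restrict x J \<in> C}"
    have [measurable]: "B \<in> sets (PiM I (\<lambda>_. borel))" "C \<in> sets (PiM J (\<lambda>_. borel))" by fact+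
    have [measurable]: "(\<lambda>x. restrict x I) \<in> gauss \<sigma> (I \<union> J) \<rightarrow>\<^sub>M PiM I (\<lambda>_. borel)"
        "(\<lambda>x. restrict x J) \<in> gauss \<sigma> (I \<union> J) \<rightarrow>\<^sub>M PiM J (\<lambda>_. borel)"
      unfolding measurable_cong_sets[OF sets_gauss refl] by (auto intro!: measurable_restrict_subset)
    have S: "?S \<in> sets (gauss \<sigma> (I \<union> J))" by measurable
    have "emeasure (gauss \<sigma> (I \<union> J)) ?S = emeasure (distr (gauss \<sigma> I \<Otimes>\<^sub>M gauss \<sigma> J) (gauss \<sigma> (I \<union> J)) (merge I J)) ?S"
      unfolding gauss_def using PS.distr_merge[OF disj fin] by simp
    also have "\<dots> = emeasure (gauss \<sigma> I \<Otimes>\<^sub>M gauss \<sigma> J) (merge I J -` ?S \<inter> space (gauss \<sigma> I \<Otimes>\<^sub>M gauss \<sigma> J))"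
      using mm S by (rule emeasure_distr)
    also have "merge I J -` ?S \<inter> space (gauss \<sigma> I \<Otimes>\<^sub>M gauss \<sigma> J) = B \<times> C"
    proof -
      have m: "restrict (merge I J (x, y)) I = x" "restrict (merge I J (x, y)) J = y" "merge I J (x, y) \<in> space (gauss \<sigma> (I \<union> J))"
        if "x \<in> space (gauss \<sigma> I)" "y \<in> space (gauss \<sigma> J)" for x y
        using that disj by (auto simp: merge_def fun_eq_iff PiE_def extensional_def space_PiM)
      have BC: "B \<subseteq> space (gauss \<sigma> I)" "C \<subseteq> space (gauss \<sigma> J)"
        using sets.sets_into_space[OF B] sets.sets_into_space[OF C] by (auto simp: space_PiM)
      show ?thesis
        using BC by (auto simp: space_pair_measure m m[OF subsetD[OF BC(1)] subsetD[OF BC(2)]] simp del: space_gauss restrict_merge)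
    qed
    also have "emeasure (gauss \<sigma> I \<Otimes>\<^sub>M gauss \<sigma> J) (B \<times> C) = emeasure (gauss \<sigma> I) B * emeasure (gauss \<sigma> J) C"
      using B C by (intro J.emeasure_pair_measure_Times) auto
    finally show ?thesis .
  qed
  have main: "emeasure M {\<omega>\<in>space M. (\<omega>, restrict (Z \<omega>) I) \<in> K \<and> restrict (Z \<omega>) J \<in> C}
      = (\<integral>\<^sup>+\<omega>. emeasure (gauss \<sigma> I) (Pair \<omega> -` K) \<partial>M) * emeasure (gauss \<sigma> J) C"
    if K [measurable]: "K \<in> sets (G \<Otimes>\<^sub>M PiM I (\<lambda>_. borel))" and C [measurable]: "C \<in> sets (PiM J (\<lambda>_. borel))" for K C
  proof -
    define K' where "K' = {p \<in> space (G \<Otimes>\<^sub>M PiM (I \<union> J) (\<lambda>_. borel :: real measure)).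
        (fst p, restrict (snd p) I) \<in> K \<and> restrict (snd p) J \<in> C}"
    have [measurable]: "(\<lambda>x. restrict x I) \<in> PiM (I \<union> J) (\<lambda>_. borel) \<rightarrow>\<^sub>M PiM I (\<lambda>_. borel :: real measure)"
        "(\<lambda>x. restrict x J) \<in> PiM (I \<union> J) (\<lambda>_. borel) \<rightarrow>\<^sub>M PiM J (\<lambda>_. borel :: real measure)"
      by (auto intro!: measurable_restrict_subset)
    have K': "K' \<in> sets (G \<Otimes>\<^sub>M PiM (I \<union> J) (\<lambda>_. borel))" unfolding K'_def by measurable
    have rr: "restrict (restrict x (I \<union> J)) I = restrict x I" "restrict (restrict x (I \<union> J)) J = restrict x J" for x :: "'i \<Rightarrow> real"
      by (auto simp: fun_eq_iff)
    have "{\<omega>\<in>space M. (\<omega>, restrict (Z \<omega>) I) \<in> K \<and> restrict (Z \<omega>) J \<in> C} = {\<omega>\<in>space M. (\<omega>, restrict (Z \<omega>) (I \<union> J)) \<in> K'}"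
      by (auto simp: K'_def sG space_pair_measure space_PiM rr)
    then have "emeasure M {\<omega>\<in>space M. (\<omega>, restrict (Z \<omega>) I) \<in> K \<and> restrict (Z \<omega>) J \<in> C}
        = (\<integral>\<^sup>+\<omega>. emeasure (gauss \<sigma> (I \<union> J)) (Pair \<omega> -` K') \<partial>M)"
      using gaussian_given_emeasure[OF assms(1,2) Z K'] by simp
    also have "\<dots> = (\<integral>\<^sup>+\<omega>. emeasure (gauss \<sigma> I) (Pair \<omega> -` K) * emeasure (gauss \<sigma> J) C \<partial>M)"
    proof (intro nn_integral_cong)
      fix \<omega> assume w: "\<omega> \<in> space M"
      have "Pair \<omega> -` K' = {x \<in> space (gauss \<sigma> (I \<union> J)). restrict x I \<in> Pair \<omega> -` K \<and> restrict x J \<in> C}"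
        using w sG by (auto simp: K'_def space_pair_measure space_PiM)
      then show "emeasure (gauss \<sigma> (I \<union> J)) (Pair \<omega> -` K') = emeasure (gauss \<sigma> I) (Pair \<omega> -` K) * emeasure (gauss \<sigma> J) C"
        using prod[OF sets_Pair1[OF K, of \<omega>] C] by simp
    qed
    also have "\<dots> = (\<integral>\<^sup>+\<omega>. emeasure (gauss \<sigma> I) (Pair \<omega> -` K) \<partial>M) * emeasure (gauss \<sigma> J) C"
    proof (rule nn_integral_multc)
      have "(\<lambda>\<omega>. emeasure (gauss \<sigma> I) (Pair \<omega> -` K)) \<in> borel_measurable G"
        using I.measurable_emeasure_Pair[of K G] K by (simp add: sets_pair_measure_cong[OF refl sets_gauss])
      then show "(\<lambda>\<omega>. emeasure (gauss \<sigma> I) (Pair \<omega> -` K)) \<in> borel_measurable M"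
        by (rule measurable_from_subalg[OF sub])
    qed
    finally show ?thesis .
  qed
  have adj: "A \<in> sets (adjoin G I Z) \<Longrightarrow> \<exists>K\<in>sets (G \<Otimes>\<^sub>M PiM I (\<lambda>_. borel)). A = {\<omega>\<in>space M. (\<omega>, restrict (Z \<omega>) I) \<in> K}" for A
    unfolding adjoin_def
    by (subst (asm) sets_vimage_algebra2) (auto simp: space_pair_measure space_PiM sG)
  have "subalgebra M (adjoin G I Z)"
    unfolding subalgebra_def
  proof safe
    fix A assume "A \<in> sets (adjoin G I Z)"
    from adj[OF this] obtain K where [measurable]: "K \<in> sets (G \<Otimes>\<^sub>M PiM I (\<lambda>_. borel))" and A: "A = {\<omega>\<in>space M. (\<omega>, restrict (Z \<omega>) I) \<in> K}"
      by auto
    show "A \<in> sets M" unfolding A using pairM by measurable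
  qed (auto simp: adjoin_def sG)
  moreover have "emeasure M {\<omega>\<in>A. restrict (Z \<omega>) J \<in> C} = emeasure M A * emeasure (gauss \<sigma> J) C"
    if A: "A \<in> sets (adjoin G I Z)" and C: "C \<in> sets (PiM J (\<lambda>_. borel))" for A C
  proof -
    from adj[OF A] obtain K where K: "K \<in> sets (G \<Otimes>\<^sub>M PiM I (\<lambda>_. borel))" and A: "A = {\<omega>\<in>space M. (\<omega>, restrict (Z \<omega>) I) \<in> K}"
      by auto
    have "emeasure M {\<omega>\<in>A. restrict (Z \<omega>) J \<in> C} = (\<integral>\<^sup>+\<omega>. emeasure (gauss \<sigma> I) (Pair \<omega> -` K) \<partial>M) * emeasure (gauss \<sigma> J) C"
      using main[OF K C] by (simp add: A conj_assoc)
    also have "(\<integral>\<^sup>+\<omega>. emeasure (gauss \<sigma> I) (Pair \<omega> -` K) \<partial>M) = emeasure M A"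
    proof -
      \<comment> \<open>The case in which \<open>C\<close> is the whole space identifies the
        remaining integral with the measure of \<open>A\<close>.\<close>
      have "emeasure M A = (\<integral>\<^sup>+\<omega>. emeasure (gauss \<sigma> I) (Pair \<omega> -` K) \<partial>M) * emeasure (gauss \<sigma> J) (space (PiM J (\<lambda>_. borel)))"
        using main[OF K sets.top] by (simp add: A space_PiM)
      moreover have "emeasure (gauss \<sigma> J) (space (PiM J (\<lambda>_. borel))) = 1"
        using J.emeasure_space_1 by (simp add: space_PiM)
      ultimately show ?thesis by simp
    qed
    finally show ?thesis .
  qed
  ultimately show ?thesis using Zi by (simp add: gaussian_given_def)
qed

subsection \<open>Conditional laws of independent matrices\<close>

text \<open>Lower orthants with rational corners are countable in number, closed under intersection,
  and generate the sigma-algebra. Countability is the point: it lets almost sure equalities, one for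
  each event, be combined into an almost sure equality of measures.\<close>

lemma mat_borel_determining:
  obtains E where "countable E" "E \<subseteq> sets (mat_borel m n)"
    "\<forall>\<mu>\<in>space (prob_algebra (mat_borel m n)). \<forall>\<nu>\<in>space (prob_algebra (mat_borel m n)).
       (\<forall>B\<in>E. measure \<mu> B = measure \<nu> B) \<longrightarrow> \<mu> = \<nu>"
proof -
  define cell where "cell b = {A \<in> carrier_mat m n. \<forall>i<m. \<forall>j<n. A $$ (i, j) \<le> b (i, j)}"
    for b :: "nat \<times> nat \<Rightarrow> real"
  define E where "E = cell ` ({..<m} \<times> {..<n} \<rightarrow>\<^sub>E \<rat>)"
  have cE: "countable E"
    unfolding E_def by (intro countable_image countable_PiE) (auto simp: countable_rat)
  have cellE: "cell b \<in> E" if "\<And>i j. i < m \<Longrightarrow> j < n \<Longrightarrow> b (i, j) \<in> \<rat>" for b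
  proof -
    have "cell b = cell (restrict b ({..<m} \<times> {..<n}))" by (auto simp: cell_def)
    moreover have "restrict b ({..<m} \<times> {..<n}) \<in> {..<m} \<times> {..<n} \<rightarrow>\<^sub>E \<rat>"
      using that by (intro restrict_PiE_iff[THEN iffD2]) auto
    ultimately show ?thesis unfolding E_def by (rule image_eqI)
  qed
  have EP: "E \<subseteq> Pow (carrier_mat m n)" by (auto simp: E_def cell_def)
  have Es: "E \<subseteq> sets (mat_borel m n)"
  proof
    fix B assume "B \<in> E"
    then obtain b where B: "B = cell b" by (auto simp: E_def)
    have [measurable]: "(\<lambda>A. A $$ (i, j)) \<in> borel_measurable (mat_borel m n)" if "i < m" "j < n" for i j
      using that measurable_ident[of "mat_borel m n"] unfolding measurable_mat_borel_iff by auto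
    have "{A \<in> space (mat_borel m n). \<forall>i\<in>{..<m}. \<forall>j\<in>{..<n}. A $$ (i, j) \<le> b (i, j)} \<in> sets (mat_borel m n)"
      by measurable
    moreover have "{A \<in> space (mat_borel m n). \<forall>i\<in>{..<m}. \<forall>j\<in>{..<n}. A $$ (i, j) \<le> b (i, j)} = B"
      unfolding B cell_def by auto
    ultimately show "B \<in> sets (mat_borel m n)" by simp
  qed
  have gen: "sets (mat_borel m n) = sigma_sets (carrier_mat m n) E"
  proof
    show "sigma_sets (carrier_mat m n) E \<subseteq> sets (mat_borel m n)"
      using sets.sigma_sets_subset[OF Es] by simp
    let ?S = "sigma (carrier_mat m n) E"
    have sp: "space ?S = carrier_mat m n" using EP by simp
    have rat: "{A \<in> space ?S. A $$ (i, j) \<le> r} \<in> sets ?S" if "i < m" "j < n" "r \<in> \<rat>" for i j r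
    proof -
      \<comment> \<open>One entry is bounded by \<open>r\<close> and all others by \<open>k\<close>;
        the union over \<open>k\<close> removes the other bounds.\<close>
      have "cell (\<lambda>p. if p = (i, j) then r else real k) \<in> sets ?S" for k :: nat
        using cellE[of "\<lambda>p. if p = (i, j) then r else real k"] EP that by auto
      then have "(\<Union>k. cell (\<lambda>p. if p = (i, j) then r else real k)) \<in> sets ?S" by (intro sets.countable_UN) auto
      moreover have "(\<Union>k. cell (\<lambda>p. if p = (i, j) then r else real k)) = {A \<in> space ?S. A $$ (i, j) \<le> r}"
      proof (intro equalityI subsetI)
        fix A assume A: "A \<in> {A \<in> space ?S. A $$ (i, j) \<le> r}"
        obtain k where k: "Max (insert 0 ((\<lambda>p. A $$ p) ` ({..<m} \<times> {..<n}))) \<le> real k" using real_arch_simple by blast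
        have "A $$ (i', j') \<le> real k" if "i' < m" "j' < n" for i' j'
          using that by (intro order_trans[OF _ k] Max_ge) auto
        with A show "A \<in> (\<Union>k. cell (\<lambda>p. if p = (i, j) then r else real k))" by (auto simp: cell_def sp)
      qed (use that in \<open>force simp: cell_def sp\<close>)
      ultimately show ?thesis by simp
    qed
    have "(\<lambda>A. A) \<in> ?S \<rightarrow>\<^sub>M mat_borel m n"
      unfolding measurable_mat_borel_iff
    proof (intro conjI allI impI)
      fix i j assume ij: "i < m" "j < n"
      show "(\<lambda>A. A $$ (i, j)) \<in> borel_measurable ?S"
      proof (rule borel_measurableI_le)
        fix y :: real
        \<comment> \<open>A real bound is the countable intersection of the rational bounds above
          it.\<close>
        have "{A \<in> space ?S. A $$ (i, j) \<le> y} = {A \<in> space ?S. \<forall>r\<in>{r\<in>\<rat>. y < r}. A $$ (i, j) \<le> r}"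
        proof (intro Collect_cong conj_cong refl iffI ballI)
          fix A :: "real mat" assume *: "\<forall>r\<in>{r \<in> \<rat>. y < r}. A $$ (i, j) \<le> r"
          show "A $$ (i, j) \<le> y"
          proof (rule ccontr)
            assume "\<not> A $$ (i, j) \<le> y"
            then obtain r where "r \<in> \<rat>" "y < r" "r < A $$ (i, j)"
              using Rats_dense_in_real[of y "A $$ (i, j)"] by auto
            with * show False by force
          qed
        qed auto
        also have "\<dots> \<in> sets ?S"
        proof (rule sets.sets_Collect_countable_All')
          show "countable {r \<in> \<rat>. y < r}" by (rule countable_subset[OF _ countable_rat]) auto
        qed (use rat[OF ij] in blast)
        finally show "{A \<in> space ?S. A $$ (i, j) \<le> y} \<in> sets ?S" .
      qed
    qed (simp add: sp)
    note m = this
    show "sets (mat_borel m n) \<subseteq> sigma_sets (carrier_mat m n) E"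
    proof
      fix B assume B: "B \<in> sets (mat_borel m n)"
      then have "B \<subseteq> carrier_mat m n" using sets.sets_into_space[OF B] by simp
      then show "B \<in> sigma_sets (carrier_mat m n) E"
        using measurable_sets[OF m B] EP by (simp add: sp Int_absorb2)
    qed
  qed
  show thesis
  proof (rule that[OF cE Es], intro ballI impI)
    fix \<mu> \<nu> :: "real mat measure"
    assume p: "\<mu> \<in> space (prob_algebra (mat_borel m n))" "\<nu> \<in> space (prob_algebra (mat_borel m n))"
      and e: "\<forall>B\<in>E. measure \<mu> B = measure \<nu> B"
    then have s: "sets \<mu> = sets (mat_borel m n)" "sets \<nu> = sets (mat_borel m n)"
      by (auto simp: space_prob_algebra)
    interpret \<mu>: prob_space \<mu> using p by (simp add: space_prob_algebra)
    interpret \<nu>: prob_space \<nu> using p by (simp add: space_prob_algebra)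
    \<comment> \<open>The orthants with constant corner \<open>k\<close> exhaust the space and have
      finite measure, as the uniqueness criterion requires.\<close>
    show "\<mu> = \<nu>"
    proof (rule measure_eqI_generator_eq[where E=E and \<Omega>="carrier_mat m n" and A="\<lambda>k. cell (\<lambda>_. real k)"])
      show "Int_stable E"
      proof (rule Int_stableI)
        fix B C assume "B \<in> E" "C \<in> E"
        then obtain b c where BC: "B = cell b" "C = cell c" and bc: "b \<in> ({..<m} \<times> {..<n} \<rightarrow>\<^sub>E \<rat>)" "c \<in> ({..<m} \<times> {..<n} \<rightarrow>\<^sub>E \<rat>)"
          by (auto simp: E_def)
        have "B \<inter> C = cell (\<lambda>p. min (b p) (c p))" unfolding BC by (auto simp: cell_def)
        also have "\<dots> \<in> E"
        proof (rule cellE)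
          fix i j assume "i < m" "j < n"
          then have "(i, j) \<in> {..<m} \<times> {..<n}" by simp
          then show "min (b (i, j)) (c (i, j)) \<in> \<rat>"
            using bc[THEN PiE_mem, of "(i, j)"] by (simp add: min_def)
        qed
        finally show "B \<inter> C \<in> E" .
      qed
      show "(\<Union>k. cell (\<lambda>_. real k)) = carrier_mat m n"
      proof (intro equalityI subsetI)
        fix A :: "real mat" assume A: "A \<in> carrier_mat m n"
        obtain k where k: "Max (insert 0 ((\<lambda>p. A $$ p) ` ({..<m} \<times> {..<n}))) \<le> real k" using real_arch_simple by blast
        have "A $$ (i', j') \<le> real k" if "i' < m" "j' < n" for i' j'
          using that by (intro order_trans[OF _ k] Max_ge) auto
        with A show "A \<in> (\<Union>k. cell (\<lambda>_. real k))" by (auto simp: cell_def)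
      qed (auto simp: cell_def)
      show "emeasure \<mu> B = emeasure \<nu> B" if "B \<in> E" for B
        using e that by (simp add: \<mu>.emeasure_eq_measure \<nu>.emeasure_eq_measure)
      show "range (\<lambda>k. cell (\<lambda>_. real k)) \<subseteq> E"
        by (intro image_subsetI cellE) simp
      show "sets \<mu> = sigma_sets (carrier_mat m n) E" "sets \<nu> = sigma_sets (carrier_mat m n) E"
        by (simp_all only: s gen)
    qed (use EP in auto)
  qed
qed

lemma (in prob_space) indep_set_mono:
  assumes "indep_set A B" "A' \<subseteq> A" "B' \<subseteq> B"
  shows "indep_set A' B'"
  using assms unfolding indep_sets2_eq by blast

text \<open>Over an event of \<open>G\<close>, independence turns the integral of
  \<open>\<phi> (Y \<omega>)\<close> into a product, so the constant has the property that
  characterises the conditional expectation.\<close>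

lemma (in prob_space) real_cond_exp_indep:
  fixes \<phi> :: "'b \<Rightarrow> real"
  assumes sub: "subalgebra M G" and Y: "Y \<in> M \<rightarrow>\<^sub>M N"
    and ind: "indep_set (sets (vimage_algebra (space M) Y N)) (sets G)"
    and \<phi>: "\<phi> \<in> borel_measurable N" and int: "integrable M (\<lambda>\<omega>. \<phi> (Y \<omega>))"
  shows "AE \<omega> in M. real_cond_exp M G (\<lambda>\<omega>. \<phi> (Y \<omega>)) \<omega> = (\<integral>x. \<phi> x \<partial>distr M N Y)"
proof -
  interpret finite_measure_subalgebra M G by unfold_locales (rule sub)
  have sG: "space G = space M" using sub by (simp add: subalgebra_def)
  \<comment> \<open>Independence of random variables is phrased with the fields generated by their
    preimages; these lie in every field for which the variable is measurable.\<close>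
  have gen: "sigma_sets (space M) {f -` B \<inter> space M |B. B \<in> sets borel} \<subseteq> sets H"
    if "f \<in> borel_measurable H" "space H = space M" for f :: "'a \<Rightarrow> real" and H
    using sets.sigma_sets_subset[of "{f -` B \<inter> space M |B. B \<in> sets borel}" H]
      measurable_sets[OF that(1)] that(2) by auto
  have \<phi>Y: "(\<lambda>\<omega>. \<phi> (Y \<omega>)) \<in> borel_measurable (vimage_algebra (space M) Y N)"
    by (rule measurable_compose[OF measurable_vimage_algebra1 \<phi>]) (use measurable_space[OF Y] in auto)
  have "(\<integral>\<omega>\<in>A. \<phi> (Y \<omega>) \<partial>M) = (\<integral>\<omega>\<in>A. (\<integral>x. \<phi> x \<partial>distr M N Y) \<partial>M)" if A: "A \<in> sets G" for A
  proof -
    have AM: "A \<in> sets M" using A sub by (auto simp: subalgebra_def)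
    have "indep_var borel (\<lambda>\<omega>. \<phi> (Y \<omega>)) borel (indicator A :: _ \<Rightarrow> real)"
      unfolding indep_var_eq
    proof (intro conjI indep_set_mono[OF ind] gen \<phi>Y)
      show "(\<lambda>\<omega>. \<phi> (Y \<omega>)) \<in> borel_measurable M" using measurable_compose[OF Y \<phi>] .
    qed (use A AM sG in auto)
    then have "expectation (\<lambda>\<omega>. \<phi> (Y \<omega>) * indicator A \<omega>) = expectation (\<lambda>\<omega>. \<phi> (Y \<omega>)) * expectation (indicator A)"
      by (rule indep_var_lebesgue_integral) (use int AM in \<open>auto simp: less_top[symmetric]\<close>)
    then show ?thesis
      using AM by (simp add: set_lebesgue_integral_def mult.commute integral_distr[OF Y \<phi>])
  qed
  then show ?thesis by (intro real_cond_exp_charact) (use int in auto)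
qed

lemma (in prob_space) regular_cond_law_indep:
  assumes sub: "subalgebra M G" and Y: "Y \<in> M \<rightarrow>\<^sub>M N"
    and ind: "indep_set (sets (vimage_algebra (space M) Y N)) (sets G)"
  shows "regular_cond_law M G N Y (\<lambda>_. distr M N Y)"
  unfolding regular_cond_law_def
proof (intro conjI ballI)
  show "(\<lambda>_. distr M N Y) \<in> G \<rightarrow>\<^sub>M prob_algebra N"
    using prob_space_distr[OF Y] by (intro measurable_const) (simp add: space_prob_algebra)
  fix B assume B: "B \<in> sets N"
  have "integrable M (\<lambda>\<omega>. indicator B (Y \<omega>) :: real)"
    using B Y by (intro integrable_const_bound[of _ 1]) (auto simp: indicator_def)
  from real_cond_exp_indep[OF sub Y ind _ this] B Y
  show "AE \<omega> in M. real_cond_exp M G (\<lambda>\<omega>. indicator B (Y \<omega>)) \<omega> = measure (distr M N Y) B"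
    by simp
qed

text \<open>On each event of a countable determining class both kernels are versions of the same
  conditional probability, so almost surely they agree on the entire class.\<close>

lemma (in prob_space) regular_cond_law_unique:
  assumes \<kappa>: "regular_cond_law M G (mat_borel m n) Y \<kappa>"
    and \<mu>: "regular_cond_law M G (mat_borel m n) Y (\<lambda>_. \<mu>)" and "space G = space M"
  shows "AE \<omega> in M. \<kappa> \<omega> = \<mu>"
proof -
  obtain E where E: "countable E" "E \<subseteq> sets (mat_borel m n)"
    "\<forall>\<mu>\<in>space (prob_algebra (mat_borel m n)). \<forall>\<nu>\<in>space (prob_algebra (mat_borel m n)).
       (\<forall>B\<in>E. measure \<mu> B = measure \<nu> B) \<longrightarrow> \<mu> = \<nu>"
    by (rule mat_borel_determining[of m n])
  have "AE \<omega> in M. measure (\<kappa> \<omega>) B = measure \<mu> B" if "B \<in> E" for B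
  proof -
    have B: "B \<in> sets (mat_borel m n)" using that E(2) by auto
    have "AE \<omega> in M. real_cond_exp M G (\<lambda>\<omega>. indicator B (Y \<omega>)) \<omega> = measure (\<kappa> \<omega>) B"
      "AE \<omega> in M. real_cond_exp M G (\<lambda>\<omega>. indicator B (Y \<omega>)) \<omega> = measure \<mu> B"
      using \<kappa> \<mu> B unfolding regular_cond_law_def by blast+
    then show ?thesis by eventually_elim simp
  qed
  then have ae: "AE \<omega> in M. \<forall>B\<in>E. measure (\<kappa> \<omega>) B = measure \<mu> B"
    using E(1) by (simp add: AE_ball_countable)
  have sp: "\<kappa> \<omega> \<in> space (prob_algebra (mat_borel m n))" "\<mu> \<in> space (prob_algebra (mat_borel m n))"
    if "\<omega> \<in> space M" for \<omega>
    using \<kappa> \<mu> that \<open>space G = space M\<close> unfolding regular_cond_law_def by (auto dest: measurable_space)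
  show ?thesis
    using ae AE_space by eventually_elim (use E(3) sp in blast)
qed

text \<open>Moving an almost sure statement from \<open>M\<close> to the law of the transcript needs
  the set of good transcripts to be measurable. The determining class writes it as a countable
  intersection.\<close>

lemma sets_Collect_kernel_eq:
  assumes \<kappa>: "\<kappa> \<in> K \<rightarrow>\<^sub>M prob_algebra (mat_borel m n)" and \<mu>: "\<mu> \<in> space (prob_algebra (mat_borel m n))"
  shows "{h \<in> space K. \<kappa> h = \<mu>} \<in> sets K"
proof -
  obtain E where E: "countable E" "E \<subseteq> sets (mat_borel m n)"
    "\<forall>\<mu>\<in>space (prob_algebra (mat_borel m n)). \<forall>\<nu>\<in>space (prob_algebra (mat_borel m n)).
       (\<forall>B\<in>E. measure \<mu> B = measure \<nu> B) \<longrightarrow> \<mu> = \<nu>"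
    by (rule mat_borel_determining[of m n])
  have "\<kappa> h = \<mu> \<longleftrightarrow> (\<forall>B\<in>E. measure (\<kappa> h) B = measure \<mu> B)" if "h \<in> space K" for h
    using measurable_space[OF \<kappa> that] \<mu> E(3) by auto
  then have "{h \<in> space K. \<kappa> h = \<mu>} = {h \<in> space K. \<forall>B\<in>E. measure (\<kappa> h) B = measure \<mu> B}" by auto
  also have "\<dots> \<in> sets K"
  proof (rule sets.sets_Collect_countable_All'[OF _ E(1)])
    fix B assume "B \<in> E"
    then have B: "B \<in> sets (mat_borel m n)" using E(2) by auto
    have [measurable]: "(\<lambda>h. measure (\<kappa> h) B) \<in> borel_measurable K"
      using measurable_compose[OF measurable_prob_algebraD[OF \<kappa>] measurable_measure_subprob_algebra[OF B]] .
    show "{h \<in> space K. measure (\<kappa> h) B = measure \<mu> B} \<in> sets K" by measurable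
  qed
  finally show ?thesis .
qed

subsection \<open>Householder matrices\<close>

text \<open>For \<open>w = 0\<close> the quotients are \<open>0 / 0 = 0\<close> and this is the identity matrix.\<close>

definition householder :: "nat \<Rightarrow> (nat \<Rightarrow> real) \<Rightarrow> real mat" where
  "householder n w = mat n n (\<lambda>(i, j). of_bool (i = j) - 2 * w i * w j / (\<Sum>k<n. (w k)\<^sup>2))"

lemma householder_carrier [simp]: "householder n w \<in> carrier_mat n n"
  by (simp add: householder_def)

lemma dim_householder [simp]: "dim_row (householder n w) = n" "dim_col (householder n w) = n"
  by (simp_all add: householder_def)

lemma orthogonal_real_mat_carrier: "orthogonal_real_mat n A \<Longrightarrow> A \<in> carrier_mat n n"
  by (simp add: orthogonal_real_mat_def)

lemma orthogonal_real_mat_one: "orthogonal_real_mat n (1\<^sub>m n)"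
  by (simp add: orthogonal_real_mat_def)

lemma orthogonal_real_mat_mult:
  assumes "orthogonal_real_mat n A" "orthogonal_real_mat n B"
  shows "orthogonal_real_mat n (A * B)"
proof -
  note [simp] = orthogonal_real_mat_carrier[OF assms(1)] orthogonal_real_mat_carrier[OF assms(2)]
  have [simp]: "P * R \<in> carrier_mat n n" if "P \<in> carrier_mat n n" "R \<in> carrier_mat n n" for P R :: "real mat"
    using that by (rule mult_carrier_mat)
  have "A * B * transpose_mat (A * B) = A * (B * transpose_mat B) * transpose_mat A"
    by (simp add: transpose_mult[of _ n n _ n] assoc_mult_mat[of _ n n _ n _ n])
  moreover have "transpose_mat (A * B) * (A * B) = transpose_mat B * (transpose_mat A * A) * B"
    by (simp add: transpose_mult[of _ n n _ n] assoc_mult_mat[of _ n n _ n _ n])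
  ultimately show ?thesis
    using assms by (simp add: orthogonal_real_mat_def right_mult_one_mat[of A n n] right_mult_one_mat[of "transpose_mat B" n n])
qed

lemma index_householder_mult:
  assumes A: "A \<in> carrier_mat n m" and "i < n" "j < m"
  shows "(householder n w * A) $$ (i, j) = A $$ (i, j) - 2 * w i * (\<Sum>k<n. w k * A $$ (k, j)) / (\<Sum>k<n. (w k)\<^sup>2)"
proof -
  have "(householder n w * A) $$ (i, j)
      = (\<Sum>k<n. (of_bool (i = k) - 2 * w i * w k / (\<Sum>k<n. (w k)\<^sup>2)) * A $$ (k, j))"
    using assms by (simp add: scalar_prod_def householder_def row_def atLeast0LessThan)
  also have "\<dots> = (\<Sum>k<n. of_bool (i = k) * A $$ (k, j) - 2 * w i / (\<Sum>k<n. (w k)\<^sup>2) * (w k * A $$ (k, j)))"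
    by (intro sum.cong) (auto simp: algebra_simps)
  also have "\<dots> = (\<Sum>k<n. of_bool (i = k) * A $$ (k, j)) - 2 * w i / (\<Sum>k<n. (w k)\<^sup>2) * (\<Sum>k<n. w k * A $$ (k, j))"
    by (simp only: sum_subtractf sum_distrib_left)
  also have "(\<Sum>k<n. of_bool (i = k) * A $$ (k, j)) = A $$ (i, j)"
    using \<open>i < n\<close> by (simp add: of_bool_def if_distrib[of "\<lambda>x. x * _"] cong: if_cong)
  finally show ?thesis by simp
qed

lemma transpose_householder: "transpose_mat (householder n w) = householder n w"
  by (intro eq_matI) (auto simp: householder_def mult.commute mult.left_commute)

lemma index_mult_householder:
  assumes A: "A \<in> carrier_mat m n" and "i < m" "j < n"
  shows "(A * householder n w) $$ (i, j) = A $$ (i, j) - 2 * w j * (\<Sum>k<n. w k * A $$ (i, k)) / (\<Sum>k<n. (w k)\<^sup>2)"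
proof -
  have "A * householder n w = transpose_mat (householder n w * transpose_mat A)"
    using A by (simp add: transpose_mult[of _ n n _ m] transpose_householder)
  then have "(A * householder n w) $$ (i, j) = (householder n w * transpose_mat A) $$ (j, i)"
    using assms by simp
  also have "\<dots> = A $$ (i, j) - 2 * w j * (\<Sum>k<n. w k * A $$ (i, k)) / (\<Sum>k<n. (w k)\<^sup>2)"
    using assms by (subst index_householder_mult) auto
  finally show ?thesis .
qed

text \<open>A reflection is symmetric and its own inverse.\<close>

lemma orthogonal_householder: "orthogonal_real_mat n (householder n w)"
proof -
  let ?N = "\<Sum>k<n. (w k)\<^sup>2"
  have "householder n w * householder n w = 1\<^sub>m n"
  proof (rule eq_matI)
    fix i j assume "i < dim_row (1\<^sub>m n :: real mat)" "j < dim_col (1\<^sub>m n :: real mat)"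
    then have ij: "i < n" "j < n" by auto
    have "(\<Sum>k<n. w k * householder n w $$ (k, j)) = (\<Sum>k<n. w k * of_bool (k = j) - 2 * w j / ?N * (w k)\<^sup>2)"
      using ij by (intro sum.cong) (auto simp: householder_def algebra_simps power2_eq_square)
    also have "\<dots> = (\<Sum>k<n. w k * of_bool (k = j)) - 2 * w j / ?N * ?N"
      by (simp only: sum_subtractf sum_distrib_left)
    also have "(\<Sum>k<n. w k * of_bool (k = j)) = w j"
      using ij by (simp add: of_bool_def if_distrib[of "\<lambda>x. _ * x"] cong: if_cong)
    finally have "(householder n w * householder n w) $$ (i, j)
        = of_bool (i = j) - 2 * w i * w j / ?N - 2 * w i * (w j - 2 * w j / ?N * ?N) / ?N"
      using ij by (subst index_householder_mult[of _ n n]) (auto simp: householder_def)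
    also have "\<dots> = of_bool (i = j)"
      by (cases "?N = 0") (auto simp: field_simps)
    finally show "(householder n w * householder n w) $$ (i, j) = 1\<^sub>m n $$ (i, j)"
      using ij by simp
  qed (auto simp: householder_def)
  then show ?thesis by (simp add: orthogonal_real_mat_def transpose_householder)
qed

text \<open>For a unit vector \<open>u\<close> this evaluates the denominator of the reflection
  exchanging \<open>u\<close> and the \<open>t\<close>-th unit vector as
  \<open>2 * (1 - u t)\<close>.\<close>

lemma sum_square_diff_unit:
  fixes u :: "nat \<Rightarrow> real"
  assumes "t < n"
  shows "(\<Sum>k<n. (u k - of_bool (k = t))\<^sup>2) = (\<Sum>k<n. (u k)\<^sup>2) + 1 - 2 * u t"
proof -
  have "(\<Sum>k<n. (u k - of_bool (k = t))\<^sup>2) = (\<Sum>k<n. (u k)\<^sup>2 + (of_bool (k = t) - 2 * u k * of_bool (k = t)))"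
    by (intro sum.cong) (auto simp: power2_eq_square algebra_simps)
  also have "\<dots> = (\<Sum>k<n. (u k)\<^sup>2) + (\<Sum>k<n. if k = t then 1 - 2 * u k else 0)"
    unfolding sum.distrib by (intro arg_cong2[where f="(+)"] sum.cong) auto
  finally show ?thesis using assms by simp
qed

text \<open>The Householder matrix of \<open>u - e\<^sub>t\<close> exchanges the unit vectors \<open>u\<close> and \<open>e\<^sub>t\<close>.\<close>

lemma householder_row:
  assumes "t < n" "j < n" and u: "(\<Sum>k<n. (u k)\<^sup>2) = 1"
  shows "householder n (\<lambda>k. u k - of_bool (k = t)) $$ (t, j) = u j"
proof -
  let ?N = "\<Sum>k<n. (u k - of_bool (k = t))\<^sup>2"
  have N: "?N = 2 * (1 - u t)" using sum_square_diff_unit[OF \<open>t < n\<close>, of u] u by simp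
  show ?thesis
  proof (cases "u t = 1")
    case True
    then have "?N = 0" using N by simp
    then have "\<forall>k<n. u k = of_bool (k = t)" by (subst (asm) sum_nonneg_eq_0_iff) auto
    then show ?thesis using assms by (auto simp: householder_def)
  next
    case False
    then show ?thesis using assms unfolding householder_def N by (auto simp: field_simps)
  qed
qed

text \<open>For positive \<rho>, \<open>z\<close> is parallel to the difference of \<open>r\<close>
  and \<rho> times the \<open>t\<close>-th unit vector. These have equal length, so the reflection
  exchanges them. For \<rho> = 0 the vector \<open>r\<close> is zero and any reflection fixes it.
  The left-hand side has the shape produced by \<open>index_mult_householder\<close>.\<close>

lemma householder_annihilates:
  fixes r :: "nat \<Rightarrow> real"
  assumes "t < n" "j < n"
  defines "\<rho> \<equiv> sqrt (\<Sum>k<n. (r k)\<^sup>2)"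
  defines "z \<equiv> \<lambda>k. r k / \<rho> - of_bool (k = t)"
  shows "r j - 2 * z j * (\<Sum>k<n. z k * r k) / (\<Sum>k<n. (z k)\<^sup>2) = \<rho> * of_bool (j = t)"
proof (cases "\<rho> = 0")
  case True
  then have "\<forall>k<n. r k = 0" unfolding \<rho>_def by (subst (asm) real_sqrt_eq_zero_cancel_iff, subst (asm) sum_nonneg_eq_0_iff) auto
  then show ?thesis using assms True by simp
next
  case False
  have \<rho>2: "(\<Sum>k<n. (r k)\<^sup>2) = \<rho>\<^sup>2" unfolding \<rho>_def by (simp add: sum_nonneg)
  have 1: "(\<Sum>k<n. (r k / \<rho>)\<^sup>2) = 1"
    using False by (simp add: power_divide sum_divide_distrib[symmetric] \<rho>2)
  have N: "(\<Sum>k<n. (z k)\<^sup>2) = 2 * (1 - r t / \<rho>)"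
    unfolding z_def using sum_square_diff_unit[OF \<open>t < n\<close>, of "\<lambda>k. r k / \<rho>"] 1 by simp
  have "(\<Sum>k<n. z k * r k) = (\<Sum>k<n. (r k)\<^sup>2 / \<rho> - (if k = t then r k else 0))"
    by (intro sum.cong) (auto simp: z_def power2_eq_square algebra_simps)
  also have "\<dots> = \<rho> - r t"
    using False \<open>t < n\<close> by (simp add: sum_subtractf sum_divide_distrib[symmetric] \<rho>2) (simp add: power2_eq_square)
  finally have zr: "(\<Sum>k<n. z k * r k) = \<rho> - r t" .
  show ?thesis
  \<comment> \<open>If \<open>r t = \<rho>\<close>, then \<open>r\<close> already points along the
    unit vector, \<open>z\<close> is zero and the reflection is the identity; otherwise the
    denominator is nonzero.\<close>
  proof (cases "r t = \<rho>")
    case True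
    then have "(\<Sum>k<n. (z k)\<^sup>2) = 0" using N False by simp
    then have "z j = 0" using assms by (subst (asm) sum_nonneg_eq_0_iff) auto
    then show ?thesis using False by (auto simp: z_def field_simps split: if_splits)
  next
    case ne: False
    have "2 * z j * (\<Sum>k<n. z k * r k) / (\<Sum>k<n. (z k)\<^sup>2) = z j * \<rho>"
      unfolding zr N using False ne by (simp add: field_simps)
    then show ?thesis using False by (simp add: z_def algebra_simps)
  qed
qed

lemma orthogonal_mult_vec_norm:
  assumes "orthogonal_real_mat n U" "y \<in> carrier_vec n"
  shows "transpose_mat U *\<^sub>v (U *\<^sub>v y) = y" "(U *\<^sub>v y) \<bullet> (U *\<^sub>v y) = y \<bullet> y"
proof -
  have U: "U \<in> carrier_mat n n" using assms(1) by (rule orthogonal_real_mat_carrier)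
  show 1: "transpose_mat U *\<^sub>v (U *\<^sub>v y) = y"
    using assms U by (simp add: assoc_mult_mat_vec[of _ n n _ n, symmetric] orthogonal_real_mat_def)
  have "(transpose_mat U *\<^sub>v (U *\<^sub>v y)) \<bullet> y = (U *\<^sub>v y) \<bullet> (U *\<^sub>v y)"
    by (rule transpose_vec_mult_scalar) (use U assms in auto)
  then show "(U *\<^sub>v y) \<bullet> (U *\<^sub>v y) = y \<bullet> y" unfolding 1 by simp
qed

text \<open>If \<open>L = U X Q\<close> then \<open>U X X\<^sup>T U\<^sup>T = L L\<^sup>T\<close>.\<close>

lemma mult_gram_row:
  assumes U: "orthogonal_real_mat d U" and Q: "orthogonal_real_mat s Q" and X: "X \<in> carrier_mat d s"
    and "t < d" and i: "i < d"
  shows "(U *\<^sub>v ((X * transpose_mat X) *\<^sub>v row U t)) $ i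
       = (\<Sum>j<s. (U * X * Q) $$ (i, j) * (U * X * Q) $$ (t, j))"
proof -
  have Uc [simp]: "U \<in> carrier_mat d d" and Qc [simp]: "Q \<in> carrier_mat s s"
    using U Q by (auto simp: orthogonal_real_mat_def)
  have T: "transpose_mat (U * X * Q) = transpose_mat Q * (transpose_mat X * transpose_mat U)"
    using X by (simp add: transpose_mult[of _ d s _ s] transpose_mult[of _ d d _ s] mult_carrier_mat[of _ d d])
  have UX: "U * X \<in> carrier_mat d s" using X by (simp add: mult_carrier_mat[of _ d d])
  have XU: "transpose_mat X * transpose_mat U \<in> carrier_mat s d"
    using X by (simp add: mult_carrier_mat[of _ s d])
  have "(U * X * Q) * transpose_mat (U * X * Q) = U * X * (Q * (transpose_mat Q * (transpose_mat X * transpose_mat U)))"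
    unfolding T using UX XU by (intro assoc_mult_mat[of _ d s _ s _ d]) (auto simp: mult_carrier_mat[of _ s s])
  also have "Q * (transpose_mat Q * (transpose_mat X * transpose_mat U)) = Q * transpose_mat Q * (transpose_mat X * transpose_mat U)"
    using XU by (intro assoc_mult_mat[symmetric, of _ s s _ s _ d]) auto
  also have "\<dots> = transpose_mat X * transpose_mat U"
    using Q left_mult_one_mat[OF XU] by (simp add: orthogonal_real_mat_def)
  finally have LL: "(U * X * Q) * transpose_mat (U * X * Q) = U * X * (transpose_mat X * transpose_mat U)" .
  have rU: "row U t \<in> carrier_vec d" using Uc \<open>t < d\<close> by (intro row_carrier_vec)
  have "U *\<^sub>v ((X * transpose_mat X) *\<^sub>v row U t) = U *\<^sub>v (X *\<^sub>v (transpose_mat X *\<^sub>v row U t))"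
    using X rU by (simp add: assoc_mult_mat_vec[of X d s "transpose_mat X" d])
  also have "\<dots> = (U * X) *\<^sub>v (transpose_mat X *\<^sub>v row U t)"
    using X rU by (intro assoc_mult_mat_vec[symmetric, of _ d d _ s]) (auto intro!: mult_mat_vec_carrier[of _ s d])
  also have "transpose_mat X *\<^sub>v row U t = col (transpose_mat X * transpose_mat U) t"
    using X \<open>t < d\<close> carrier_matD[OF Uc] by (subst col_mult2[of _ s d _ d]) auto
  also have "(U * X) *\<^sub>v \<dots> = col (U * X * (transpose_mat X * transpose_mat U)) t"
    using UX XU \<open>t < d\<close> by (subst col_mult2[of _ d s _ d]) auto
  also have "\<dots> $ i = (U * X * (transpose_mat X * transpose_mat U)) $$ (i, t)"
    using UX XU i \<open>t < d\<close> by (subst index_col) auto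
  also have "\<dots> = ((U * X * Q) * transpose_mat (U * X * Q)) $$ (i, t)" unfolding LL ..
  also have "\<dots> = (\<Sum>j<s. (U * X * Q) $$ (i, j) * (U * X * Q) $$ (t, j))"
    using i \<open>t < d\<close> by (simp add: scalar_prod_def atLeast0LessThan carrier_matD[OF Uc] carrier_matD[OF Qc])
  finally show ?thesis .
qed

subsection \<open>Random reflections of Gaussian matrices\<close>

text \<open>For each frozen \<open>\<omega>\<close> the map composes reflections in orthogonal
  directions and so preserves \<open>gauss\<close>, which is what \<open>gaussian_given_map\<close>
  asks for.\<close>

lemma gaussian_given_reflects:
  fixes w :: "'w \<Rightarrow> 'l \<Rightarrow> 'i \<Rightarrow> real"
  assumes M: "prob_space M" "0 < \<sigma>" and fin: "finite I" "finite L" and Z: "gaussian_given M G \<sigma> I Z"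
    and w: "\<And>l i. l \<in> L \<Longrightarrow> i \<in> I \<Longrightarrow> (\<lambda>\<omega>. w \<omega> l i) \<in> borel_measurable G"
    and orth: "\<And>\<omega> l l'. l \<in> L \<Longrightarrow> l' \<in> L \<Longrightarrow> l \<noteq> l' \<Longrightarrow> (\<Sum>k\<in>I. w \<omega> l k * w \<omega> l' k) = 0"
    and Z': "\<And>\<omega> i. \<omega> \<in> space M \<Longrightarrow> i \<in> I \<Longrightarrow> Z' \<omega> i = reflects I L (w \<omega>) (Z \<omega>) i"
  shows "gaussian_given M G \<sigma> I Z'"
proof (rule gaussian_given_map[OF M Z, where T="\<lambda>\<omega>. reflects I L (w \<omega>)"])
  have wp [measurable]: "(\<lambda>p. w (fst p) l i) \<in> borel_measurable (G \<Otimes>\<^sub>M PiM I (\<lambda>_. borel :: real measure))"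
    if "l \<in> L" "i \<in> I" for l i
    using measurable_compose[OF measurable_fst w[OF that]] .
  have xp [measurable]: "(\<lambda>p. snd p i) \<in> borel_measurable (G \<Otimes>\<^sub>M PiM I (\<lambda>_. borel :: real measure))"
    if "i \<in> I" for i
    using measurable_compose[OF measurable_snd measurable_component_singleton[OF that]] .
  show "(\<lambda>(\<omega>, x). reflects I L (w \<omega>) x) \<in> G \<Otimes>\<^sub>M PiM I (\<lambda>_. borel) \<rightarrow>\<^sub>M PiM I (\<lambda>_. borel)"
    unfolding reflects_def split_beta
    by (intro measurable_restrict borel_measurable_diff borel_measurable_sum borel_measurable_divide
          borel_measurable_times borel_measurable_power borel_measurable_const wp xp)
  show "distr (gauss \<sigma> I) (PiM I (\<lambda>_. borel)) (reflects I L (w \<omega>)) = gauss \<sigma> I" for \<omega>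
    using M fin orth by (intro distr_gauss_reflects) auto
  show "Z' \<omega> i = reflects I L (w \<omega>) (restrict (Z \<omega>) I) i" if "\<omega> \<in> space M" "i \<in> I" for \<omega> i
    unfolding Z'[OF that] by (auto simp: reflects_def intro!: sum.cong)
qed

text \<open>Multiplying by a reflection from the left reflects every column in the same vector. On
  the family of all entries the directions are the copies of \<open>w\<close> placed in column
  \<open>l\<close> and padded with zeros; copies in different columns have disjoint supports and are
  therefore orthogonal.\<close>

lemma gaussian_given_reflect_columns:
  fixes w :: "'w \<Rightarrow> 'i \<Rightarrow> real" and A :: "'i set" and B :: "'j set"
  assumes M: "prob_space M" "0 < \<sigma>" and fin: "finite A" "finite B" and Z: "gaussian_given M G \<sigma> (A \<times> B) Z"
    and w: "\<And>i. i \<in> A \<Longrightarrow> (\<lambda>\<omega>. w \<omega> i) \<in> borel_measurable G"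
    and Z': "\<And>\<omega> i j. \<omega> \<in> space M \<Longrightarrow> i \<in> A \<Longrightarrow> j \<in> B \<Longrightarrow>
      Z' \<omega> (i, j) = Z \<omega> (i, j) - 2 * w \<omega> i * (\<Sum>k\<in>A. w \<omega> k * Z \<omega> (k, j)) / (\<Sum>k\<in>A. (w \<omega> k)\<^sup>2)"
  shows "gaussian_given M G \<sigma> (A \<times> B) Z'"
proof (rule gaussian_given_reflects[OF M _ _ Z, where L=B and w="\<lambda>\<omega> l (i, j). if j = l then w \<omega> i else 0"])
  show "(\<lambda>\<omega>. case p of (i, j) \<Rightarrow> if j = l then w \<omega> i else 0) \<in> borel_measurable G"
    if "l \<in> B" "p \<in> A \<times> B" for l p
    using that w by (auto split: prod.split)
  have sum: "(\<Sum>p\<in>A \<times> B. (case p of (i, j) \<Rightarrow> if j = l then f i j else 0)) = (\<Sum>i\<in>A. f i l)"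
    if "l \<in> B" for f :: "'i \<Rightarrow> 'j \<Rightarrow> real" and l
    using that fin by (simp add: sum.cartesian_product[symmetric])
  fix \<omega> p assume "\<omega> \<in> space M" and p: "p \<in> A \<times> B"
  obtain i j where ij: "p = (i, j)" "i \<in> A" "j \<in> B" using p by auto
  have "(\<Sum>k\<in>A \<times> B. (case k of (i, j) \<Rightarrow> if j = l then w \<omega> i else 0) * Z \<omega> k) = (\<Sum>k\<in>A. w \<omega> k * Z \<omega> (k, l))"
    if "l \<in> B" for l
    by (rule trans[OF _ sum[OF that, of "\<lambda>i j. w \<omega> i * Z \<omega> (i, j)"]]) (auto intro!: sum.cong)
  moreover have "(\<Sum>k\<in>A \<times> B. (case k of (i, j) \<Rightarrow> if j = l then w \<omega> i else 0)\<^sup>2) = (\<Sum>k\<in>A. (w \<omega> k)\<^sup>2)"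
    if "l \<in> B" for l
    by (rule trans[OF _ sum[OF that, of "\<lambda>i j. (w \<omega> i)\<^sup>2"]]) (auto intro!: sum.cong)
  ultimately have "reflects (A \<times> B) B (\<lambda>l (i, j). if j = l then w \<omega> i else 0) (Z \<omega>) p
      = Z \<omega> (i, j) - (\<Sum>l\<in>B. 2 * (if j = l then w \<omega> i else 0) * (\<Sum>k\<in>A. w \<omega> k * Z \<omega> (k, l)) / (\<Sum>k\<in>A. (w \<omega> k)\<^sup>2))"
    using ij by (simp add: reflects_def)
  also have "(\<Sum>l\<in>B. 2 * (if j = l then w \<omega> i else 0) * (\<Sum>k\<in>A. w \<omega> k * Z \<omega> (k, l)) / (\<Sum>k\<in>A. (w \<omega> k)\<^sup>2))
      = (\<Sum>l\<in>B. if j = l then 2 * w \<omega> i * (\<Sum>k\<in>A. w \<omega> k * Z \<omega> (k, l)) / (\<Sum>k\<in>A. (w \<omega> k)\<^sup>2) else 0)"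
    by (intro sum.cong) auto
  finally show "Z' \<omega> p = reflects (A \<times> B) B (\<lambda>l (i, j). if j = l then w \<omega> i else 0) (Z \<omega>) p"
    using Z'[OF \<open>\<omega> \<in> space M\<close>] ij fin by simp
qed (use fin in \<open>auto intro!: sum.neutral\<close>)

text \<open>The counterpart for multiplication from the right, with \<open>w\<close> copied into row
  \<open>l\<close>.\<close>

lemma gaussian_given_reflect_rows:
  fixes w :: "'w \<Rightarrow> 'j \<Rightarrow> real" and A :: "'i set" and B :: "'j set"
  assumes M: "prob_space M" "0 < \<sigma>" and fin: "finite A" "finite B" and Z: "gaussian_given M G \<sigma> (A \<times> B) Z"
    and w: "\<And>j. j \<in> B \<Longrightarrow> (\<lambda>\<omega>. w \<omega> j) \<in> borel_measurable G"
    and Z': "\<And>\<omega> i j. \<omega> \<in> space M \<Longrightarrow> i \<in> A \<Longrightarrow> j \<in> B \<Longrightarrow>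
      Z' \<omega> (i, j) = Z \<omega> (i, j) - 2 * w \<omega> j * (\<Sum>k\<in>B. w \<omega> k * Z \<omega> (i, k)) / (\<Sum>k\<in>B. (w \<omega> k)\<^sup>2)"
  shows "gaussian_given M G \<sigma> (A \<times> B) Z'"
proof (rule gaussian_given_reflects[OF M _ _ Z, where L=A and w="\<lambda>\<omega> l (i, j). if i = l then w \<omega> j else 0"])
  show "(\<lambda>\<omega>. case p of (i, j) \<Rightarrow> if i = l then w \<omega> j else 0) \<in> borel_measurable G"
    if "l \<in> A" "p \<in> A \<times> B" for l p
    using that w by (auto split: prod.split)
  have sum: "(\<Sum>p\<in>A \<times> B. (case p of (i, j) \<Rightarrow> if i = l then f i j else 0)) = (\<Sum>j\<in>B. f l j)"
    if "l \<in> A" for f :: "'i \<Rightarrow> 'j \<Rightarrow> real" and l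
    using that fin by (simp add: sum.cartesian_product[symmetric] sum.swap[of _ B A])
  fix \<omega> p assume "\<omega> \<in> space M" and p: "p \<in> A \<times> B"
  obtain i j where ij: "p = (i, j)" "i \<in> A" "j \<in> B" using p by auto
  have "(\<Sum>k\<in>A \<times> B. (case k of (i, j) \<Rightarrow> if i = l then w \<omega> j else 0) * Z \<omega> k) = (\<Sum>k\<in>B. w \<omega> k * Z \<omega> (l, k))"
    if "l \<in> A" for l
    by (rule trans[OF _ sum[OF that, of "\<lambda>i j. w \<omega> j * Z \<omega> (i, j)"]]) (auto intro!: sum.cong)
  moreover have "(\<Sum>k\<in>A \<times> B. (case k of (i, j) \<Rightarrow> if i = l then w \<omega> j else 0)\<^sup>2) = (\<Sum>k\<in>B. (w \<omega> k)\<^sup>2)"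
    if "l \<in> A" for l
    by (rule trans[OF _ sum[OF that, of "\<lambda>i j. (w \<omega> j)\<^sup>2"]]) (auto intro!: sum.cong)
  ultimately have "reflects (A \<times> B) A (\<lambda>l (i, j). if i = l then w \<omega> j else 0) (Z \<omega>) p
      = Z \<omega> (i, j) - (\<Sum>l\<in>A. 2 * (if i = l then w \<omega> j else 0) * (\<Sum>k\<in>B. w \<omega> k * Z \<omega> (l, k)) / (\<Sum>k\<in>B. (w \<omega> k)\<^sup>2))"
    using ij by (simp add: reflects_def)
  also have "(\<Sum>l\<in>A. 2 * (if i = l then w \<omega> j else 0) * (\<Sum>k\<in>B. w \<omega> k * Z \<omega> (l, k)) / (\<Sum>k\<in>B. (w \<omega> k)\<^sup>2))
      = (\<Sum>l\<in>A. if i = l then 2 * w \<omega> j * (\<Sum>k\<in>B. w \<omega> k * Z \<omega> (l, k)) / (\<Sum>k\<in>B. (w \<omega> k)\<^sup>2) else 0)"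
    by (intro sum.cong) auto
  finally show "Z' \<omega> p = reflects (A \<times> B) A (\<lambda>l (i, j). if i = l then w \<omega> j else 0) (Z \<omega>) p"
    using Z'[OF \<open>\<omega> \<in> space M\<close>] ij fin by simp
qed (use fin in \<open>auto intro!: sum.neutral\<close>)

text \<open>A box with one side \<open>{0}\<close> is null because the normal law has no atoms. This
  is the source of the positive diagonal.\<close>

lemma gaussian_given_AE_nonzero:
  fixes Z :: "'w \<Rightarrow> 'i \<Rightarrow> real"
  assumes M: "prob_space M" "0 < \<sigma>" and fin: "finite I" and i: "i \<in> I" and Z: "gaussian_given M G \<sigma> I Z"
  shows "AE \<omega> in M. Z \<omega> i \<noteq> 0"
proof -
  interpret n: prob_space "density lborel (normal_density 0 \<sigma>)"
    using M by (intro prob_space_normal_density)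
  interpret PS: product_sigma_finite "\<lambda>_::'i. density lborel (normal_density 0 \<sigma>)" ..
  have sub: "subalgebra M G" and Zi: "\<And>i. i \<in> I \<Longrightarrow> (\<lambda>\<omega>. Z \<omega> i) \<in> borel_measurable M"
    using Z by (auto simp: gaussian_given_def)
  have sp: "space M \<in> sets G" using sub by (metis sets.top subalgebra_def)
  define B where "B = Pi\<^sub>E I (\<lambda>j. if j = i then {0 :: real} else UNIV)"
  have B: "B \<in> sets (PiM I (\<lambda>_. borel))"
    unfolding B_def using fin by (intro sets_PiM_I_finite) auto
  have "emeasure (gauss \<sigma> I) B = (\<Prod>j\<in>I. emeasure (density lborel (normal_density 0 \<sigma>)) (if j = i then {0} else UNIV))"
    unfolding B_def gauss_def using fin by (intro PS.emeasure_PiM) auto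
  also have "emeasure (density lborel (normal_density 0 \<sigma>)) {0} = 0"
    by (subst emeasure_density) (auto simp: nn_integral_0_iff_AE intro!: AE_I'[of "{0}"])
  then have "(\<Prod>j\<in>I. emeasure (density lborel (normal_density 0 \<sigma>)) (if j = i then {0} else UNIV)) = 0"
    using fin i by (auto intro!: prod_zero)
  finally have "emeasure M {\<omega>\<in>space M. restrict (Z \<omega>) I \<in> B} = 0"
    using Z sp B by (auto simp: gaussian_given_def)
  moreover have "{\<omega>\<in>space M. restrict (Z \<omega>) I \<in> B} = {\<omega>\<in>space M. \<not> Z \<omega> i \<noteq> 0}"
    using i by (auto simp: B_def PiE_iff split: if_splits)
  ultimately show ?thesis
    by (intro AE_I[where N="{\<omega>\<in>space M. \<not> Z \<omega> i \<noteq> 0}"]) (use Zi[OF i] in auto)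
qed

subsection \<open>Adaptive queries\<close>

lemma subalgebra_vimage_algebra:
  assumes f: "f \<in> N \<rightarrow>\<^sub>M K" and "space N = \<Omega>"
  shows "subalgebra N (vimage_algebra \<Omega> f K)"
  using measurable_sets[OF f] measurable_space[OF f] assms(2)
  by (auto simp: subalgebra_def sets_vimage_algebra2)

locale adaptive_queries = prob_space M
  for M :: "'w measure" and S :: "'e measure" and d s q :: nat and X W :: "'w \<Rightarrow> real mat"
    and \<xi> :: "'w \<Rightarrow> 'e" and v :: "nat \<Rightarrow> 'w \<Rightarrow> real vec" and F :: "nat \<Rightarrow> 'w measure" +
  assumes W_eq: "W = (\<lambda>\<omega>. X \<omega> * transpose_mat (X \<omega>))"
    and F_eq: "F = (\<lambda>t. query_algebra M S d \<xi> W v t)"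
    and dims: "1 \<le> s" "s < d" "q \<le> s"
    and X_measurable: "X \<in> M \<rightarrow>\<^sub>M mat_borel d s"
    and X_indep: "indep_vars (\<lambda>_. borel) (\<lambda>ij \<omega>. X \<omega> $$ ij) ({..<d} \<times> {..<s})"
    and X_normal: "\<And>i j. i < d \<Longrightarrow> j < s \<Longrightarrow>
           distributed M lborel (\<lambda>\<omega>. X \<omega> $$ (i, j)) (normal_density 0 (sqrt (1 / real d)))"
    and \<xi>_measurable: "\<xi> \<in> M \<rightarrow>\<^sub>M S"
    and \<xi>_indep: "indep_set (sets (vimage_algebra (space M) \<xi> S)) (sets (vimage_algebra (space M) X (mat_borel d s)))"
    and v_measurable: "\<And>t. t < q \<Longrightarrow> v (Suc t) \<in> F t \<rightarrow>\<^sub>M vec_borel d"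
    and v_orthonormal: "\<And>\<omega> i j. \<omega> \<in> space M \<Longrightarrow> i \<in> {1..q} \<Longrightarrow> j \<in> {1..q} \<Longrightarrow>
           v i \<omega> \<bullet> v j \<omega> = (if i = j then 1 else 0)"
begin

abbreviation "\<sigma> \<equiv> sqrt (1 / real d)"

lemma sigma_pos: "0 < \<sigma>"
  using dims by simp

lemma X_carrier: "\<omega> \<in> space M \<Longrightarrow> X \<omega> \<in> carrier_mat d s"
  using measurable_space[OF X_measurable] by simp

lemma space_F [simp]: "space (F t) = space M"
  by (simp add: F_eq query_algebra_def)

lemma v_carrier: "i \<in> {1..q} \<Longrightarrow> \<omega> \<in> space M \<Longrightarrow> v i \<omega> \<in> carrier_vec d"
  using measurable_space[OF v_measurable[of "i - 1"]] by auto

lemma W_carrier: "\<omega> \<in> space M \<Longrightarrow> W \<omega> \<in> carrier_mat d d"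
  using X_carrier[of \<omega>] by (auto simp: W_eq intro!: mult_carrier_mat[of _ d s])

text \<open>Measurability for a pulled-back field needs the transcript to take values in the target
  space; queries are known to have length \<open>d\<close> only up to index \<open>q\<close>, whence
  the bound on \<open>t\<close>.\<close>

lemma transcript_measurable:
  assumes "t \<le> q"
  shows "transcript \<xi> W v t \<in> F t \<rightarrow>\<^sub>M transcript_space S d t"
  unfolding F_eq query_algebra_def
proof (rule measurable_vimage_algebra1, rule funcsetI)
  fix \<omega> assume w: "\<omega> \<in> space M"
  have "v i \<omega> \<in> carrier_vec d" "W \<omega> *\<^sub>v v i \<omega> \<in> carrier_vec d" if "i \<in> {1..t}" for i
    using that assms v_carrier[OF _ w, of i] mult_mat_vec_carrier[OF W_carrier[OF w]] by auto
  then show "transcript \<xi> W v t \<omega> \<in> space (transcript_space S d t)"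
    using measurable_space[OF \<xi>_measurable w]
    by (auto simp: transcript_def transcript_space_def space_pair_measure space_PiM)
qed

lemma F_measurable:
  assumes "t \<le> q"
  shows "\<xi> \<in> F t \<rightarrow>\<^sub>M S"
    and "i \<in> {1..t} \<Longrightarrow> v i \<in> F t \<rightarrow>\<^sub>M vec_borel d"
    and "i \<in> {1..t} \<Longrightarrow> (\<lambda>\<omega>. W \<omega> *\<^sub>v v i \<omega>) \<in> F t \<rightarrow>\<^sub>M vec_borel d"
proof -
  note m = transcript_measurable[OF assms, unfolded transcript_space_def]
  show "\<xi> \<in> F t \<rightarrow>\<^sub>M S"
    using measurable_compose[OF m measurable_fst] by (simp add: transcript_def)
  assume i: "i \<in> {1..t}"
  have p: "(\<lambda>\<omega>. snd (transcript \<xi> W v t \<omega>) i) \<in> F t \<rightarrow>\<^sub>M vec_borel d \<Otimes>\<^sub>M vec_borel d"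
    by (rule measurable_compose[OF measurable_compose[OF m measurable_snd] measurable_component_singleton[OF i]])
  show "v i \<in> F t \<rightarrow>\<^sub>M vec_borel d"
    using measurable_compose[OF p measurable_fst] i by (simp add: transcript_def)
  show "(\<lambda>\<omega>. W \<omega> *\<^sub>v v i \<omega>) \<in> F t \<rightarrow>\<^sub>M vec_borel d"
    using measurable_compose[OF p measurable_snd] i by (simp add: transcript_def)
qed

text \<open>The universal property of the query field. Every inclusion of a query field in another
  field is proved through it, so only the seed, the queries and the replies have to be
  examined.\<close>

lemma F_least:
  assumes "space N = space M" "\<xi> \<in> N \<rightarrow>\<^sub>M S"
    and "\<And>i. i \<in> {1..t} \<Longrightarrow> v i \<in> N \<rightarrow>\<^sub>M vec_borel d"
    and "\<And>i. i \<in> {1..t} \<Longrightarrow> (\<lambda>\<omega>. W \<omega> *\<^sub>v v i \<omega>) \<in> N \<rightarrow>\<^sub>M vec_borel d"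
  shows "subalgebra N (F t)"
  unfolding F_eq query_algebra_def
proof (rule subalgebra_vimage_algebra)
  show "transcript \<xi> W v t \<in> N \<rightarrow>\<^sub>M transcript_space S d t"
    unfolding transcript_def transcript_space_def
    by (intro measurable_Pair measurable_restrict assms)
qed fact

lemma F_Suc: "Suc t \<le> q \<Longrightarrow> subalgebra (F (Suc t)) (F t)"
  by (rule F_least) (auto intro: F_measurable)

lemma F_0: "subalgebra (vimage_algebra (space M) \<xi> S) (F 0)"
  by (rule F_least) (auto intro!: measurable_vimage_algebra1 measurable_space[OF \<xi>_measurable])

text \<open>Base of the induction: before any query the transcript consists of the seed alone, and
  the seed is independent of \<open>X\<close>.\<close>

lemma gaussian_given_X: "gaussian_given M (F 0) \<sigma> ({..<d} \<times> {..<s}) (\<lambda>\<omega> ij. X \<omega> $$ ij)"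
proof -
  let ?I = "{..<d} \<times> {..<s}"
  let ?Z = "\<lambda>\<omega>. restrict (\<lambda>ij. X \<omega> $$ ij) ?I"
  have Xi: "(\<lambda>\<omega>. X \<omega> $$ ij) \<in> borel_measurable M" if "ij \<in> ?I" for ij
    using X_measurable that by (auto simp: measurable_mat_borel_iff)
  have X0: "X \<in> vimage_algebra (space M) X (mat_borel d s) \<rightarrow>\<^sub>M mat_borel d s"
    using X_carrier by (intro measurable_vimage_algebra1) auto
  have Z0: "?Z \<in> vimage_algebra (space M) X (mat_borel d s) \<rightarrow>\<^sub>M PiM ?I (\<lambda>_. borel)"
    using X0 by (intro measurable_restrict) (auto simp: measurable_mat_borel_iff)
  have Z: "?Z \<in> M \<rightarrow>\<^sub>M PiM ?I (\<lambda>_. borel)"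
    using Xi by (intro measurable_restrict)
  have "distr M (PiM ?I (\<lambda>_. borel)) ?Z = (\<Pi>\<^sub>M ij\<in>?I. distr M borel (\<lambda>\<omega>. X \<omega> $$ ij))"
    \<comment> \<open>The criterion for independence by the joint law requires a non-empty index
      set, which \<open>dims\<close> guarantees.\<close>
    using X_indep dims Xi by (subst (asm) indep_vars_iff_distr_eq_PiM') (auto simp: lessThan_empty_iff)
  also have "\<dots> = gauss \<sigma> ?I"
    unfolding gauss_def
  proof (rule PiM_cong[OF refl])
    fix ij assume ij: "ij \<in> ?I"
    have "distr M borel (\<lambda>\<omega>. X \<omega> $$ ij) = distr M lborel (\<lambda>\<omega>. X \<omega> $$ ij)"
      by (rule distr_cong) auto
    also have "\<dots> = density lborel (normal_density 0 \<sigma>)"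
      using X_normal[of "fst ij" "snd ij"] ij by (auto simp: distributed_distr_eq_density)
    finally show "distr M borel (\<lambda>\<omega>. X \<omega> $$ ij) = density lborel (normal_density 0 \<sigma>)" .
  qed
  finally have law: "distr M (PiM ?I (\<lambda>_. borel)) ?Z = gauss \<sigma> ?I" .
  have "emeasure M {\<omega> \<in> A. ?Z \<omega> \<in> B} = emeasure M A * emeasure (gauss \<sigma> ?I) B"
    if A: "A \<in> sets (F 0)" and B: "B \<in> sets (PiM ?I (\<lambda>_. borel))" for A B
  proof -
    have A': "A \<in> sets (vimage_algebra (space M) \<xi> S)" using A F_0 by (auto simp: subalgebra_def)
    then have "A \<subseteq> space M" using sets.sets_into_space[OF A'] by simp
    then have eq: "{\<omega> \<in> A. ?Z \<omega> \<in> B} = A \<inter> (?Z -` B \<inter> space M)" by auto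
    have "prob (A \<inter> (?Z -` B \<inter> space M)) = prob A * prob (?Z -` B \<inter> space M)"
      using \<xi>_indep A' measurable_sets[OF Z0 B] unfolding indep_sets2_eq by simp
    then show ?thesis
      unfolding eq law[symmetric] by (subst emeasure_distr[OF Z B]) (simp add: emeasure_eq_measure ennreal_mult)
  qed
  moreover have "subalgebra M (F 0)"
    by (rule F_least) (auto intro: \<xi>_measurable)
  ultimately show ?thesis using Xi by (simp add: gaussian_given_def)
qed

text \<open>The induction invariant. Zeros above the diagonal and \<open>G\<close>-measurability of
  the first \<open>t\<close> columns are demanded at every sample point, since the next inclusion of
  fields tolerates no null set. The functions \<open>f\<close> are the observable versions of these
  columns, equal to them only almost surely. Row \<open>i\<close> of \<open>U\<close> is query
  \<open>Suc i\<close> because rows are counted from 0.\<close>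

definition stage :: "nat \<Rightarrow> ('w \<Rightarrow> real mat) \<Rightarrow> 'w measure \<Rightarrow> ('w \<Rightarrow> real mat) \<Rightarrow> bool" where
  "stage t U G Q \<longleftrightarrow>
     U \<in> F t \<rightarrow>\<^sub>M mat_borel d d \<and>
     (\<forall>\<omega>\<in>space M. orthogonal_real_mat d (U \<omega>) \<and> (\<forall>i<t. row (U \<omega>) i = v (Suc i) \<omega>)) \<and>
     subalgebra M G \<and> subalgebra G (F t) \<and>
     Q \<in> G \<rightarrow>\<^sub>M mat_borel s s \<and> (\<forall>\<omega>\<in>space M. orthogonal_real_mat s (Q \<omega>)) \<and>
     (\<forall>\<omega>\<in>space M. \<forall>i<t. \<forall>j<s. i < j \<longrightarrow> (U \<omega> * X \<omega> * Q \<omega>) $$ (i, j) = 0) \<and>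
     (\<forall>i<d. \<forall>j<t. (\<lambda>\<omega>. (U \<omega> * X \<omega> * Q \<omega>) $$ (i, j)) \<in> borel_measurable G) \<and>
     (\<exists>f. (\<forall>i<d. \<forall>j<t. f i j \<in> borel_measurable (F t)) \<and>
        (AE \<omega> in M. \<forall>i<d. \<forall>j<t. (U \<omega> * X \<omega> * Q \<omega>) $$ (i, j) = f i j \<omega>)) \<and>
     (AE \<omega> in M. \<forall>i<t. 0 < (U \<omega> * X \<omega> * Q \<omega>) $$ (i, i)) \<and>
     gaussian_given M G \<sigma> ({t..<d} \<times> {t..<s}) (\<lambda>\<omega> ij. (U \<omega> * X \<omega> * Q \<omega>) $$ ij)"

lemma stage_0: "stage 0 (\<lambda>_. 1\<^sub>m d) (F 0) (\<lambda>_. 1\<^sub>m s)"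
proof -
  have L: "1\<^sub>m d * X \<omega> * 1\<^sub>m s = X \<omega>" if "\<omega> \<in> space M" for \<omega>
    using X_carrier[OF that] by simp
  have g: "gaussian_given M (F 0) \<sigma> ({0..<d} \<times> {0..<s}) (\<lambda>\<omega> ij. X \<omega> $$ ij)"
    using gaussian_given_X by (simp only: atLeast0LessThan)
  have "gaussian_given M (F 0) \<sigma> ({0..<d} \<times> {0..<s}) (\<lambda>\<omega> ij. (1\<^sub>m d * X \<omega> * 1\<^sub>m s) $$ ij)"
    by (rule gaussian_given_cong[OF g]) (simp add: L)
  moreover have "subalgebra M (F 0)" using gaussian_given_X by (simp add: gaussian_given_def)
  ultimately show ?thesis
    unfolding stage_def
    by (auto simp: measurable_mat_borel_iff orthogonal_real_mat_one subalgebra_def)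
qed

lemma stage_Suc:
  assumes st: "stage t U G Q" and tq: "t < q"
  shows "\<exists>U G Q. stage (Suc t) U G Q"
proof -
  have t: "t < s" "t < d" "s < d" "Suc t \<le> q" using tq dims by auto
  define L where "L \<omega> = U \<omega> * X \<omega> * Q \<omega>" for \<omega>
  note st' = st[unfolded stage_def, folded L_def]
  have U_F: "U \<in> F t \<rightarrow>\<^sub>M mat_borel d d"
    and U_orth: "\<And>\<omega>. \<omega> \<in> space M \<Longrightarrow> orthogonal_real_mat d (U \<omega>)"
    and U_row: "\<And>\<omega> i. \<omega> \<in> space M \<Longrightarrow> i < t \<Longrightarrow> row (U \<omega>) i = v (Suc i) \<omega>"
    and MG: "subalgebra M G" and GF: "subalgebra G (F t)"
    and Q_G: "Q \<in> G \<rightarrow>\<^sub>M mat_borel s s"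
    and Q_orth: "\<And>\<omega>. \<omega> \<in> space M \<Longrightarrow> orthogonal_real_mat s (Q \<omega>)"
    and L_zero: "\<And>\<omega> i j. \<omega> \<in> space M \<Longrightarrow> i < t \<Longrightarrow> j < s \<Longrightarrow> i < j \<Longrightarrow> L \<omega> $$ (i, j) = 0"
    and L_G: "\<And>i j. i < d \<Longrightarrow> j < t \<Longrightarrow> (\<lambda>\<omega>. L \<omega> $$ (i, j)) \<in> borel_measurable G"
    and L_pos: "AE \<omega> in M. \<forall>i<t. 0 < L \<omega> $$ (i, i)"
    and L_gauss: "gaussian_given M G \<sigma> ({t..<d} \<times> {t..<s}) (\<lambda>\<omega> ij. L \<omega> $$ ij)"
    using st' by auto
  have "\<exists>f. (\<forall>i<d. \<forall>j<t. f i j \<in> borel_measurable (F t)) \<and>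
      (AE \<omega> in M. \<forall>i<d. \<forall>j<t. L \<omega> $$ (i, j) = f i j \<omega>)"
    using st' by blast
  then obtain f where f: "\<And>i j. i < d \<Longrightarrow> j < t \<Longrightarrow> f i j \<in> borel_measurable (F t)"
      and Lf: "AE \<omega> in M. \<forall>i<d. \<forall>j<t. L \<omega> $$ (i, j) = f i j \<omega>"
    by blast
  note [simp] = carrier_matD[OF orthogonal_real_mat_carrier[OF U_orth]] carrier_matD[OF orthogonal_real_mat_carrier[OF Q_orth]]
    carrier_matD[OF X_carrier]
  have Uc [simp]: "U \<omega> \<in> carrier_mat d d" if "\<omega> \<in> space M" for \<omega>
    by (rule orthogonal_real_mat_carrier[OF U_orth[OF that]])
  have Qc [simp]: "Q \<omega> \<in> carrier_mat s s" if "\<omega> \<in> space M" for \<omega>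
    by (rule orthogonal_real_mat_carrier[OF Q_orth[OF that]])
  note Xc [simp] = X_carrier
  have Lc [simp]: "L \<omega> \<in> carrier_mat d s" if "\<omega> \<in> space M" for \<omega>
    unfolding L_def by (rule mult_carrier_mat[OF mult_carrier_mat[OF Uc[OF that] Xc[OF that]] Qc[OF that]])
  have vc: "v (Suc t) \<omega> \<in> carrier_vec d" if "\<omega> \<in> space M" for \<omega>
    using v_carrier[OF _ that, of "Suc t"] t by simp
  have sG: "space G = space M" using MG by (simp add: subalgebra_def)
  have FG: "h \<in> borel_measurable G" if "h \<in> borel_measurable (F t)" for h :: "'w \<Rightarrow> real"
    using that by (rule measurable_from_subalg[OF GF])
  have FF: "h \<in> borel_measurable (F (Suc t))" if "h \<in> borel_measurable (F t)" for h :: "'w \<Rightarrow> real"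
    using that by (rule measurable_from_subalg[OF F_Suc[OF t(4)]])
  have U_entry: "(\<lambda>\<omega>. U \<omega> $$ (i, j)) \<in> borel_measurable (F t)" if "i < d" "j < d" for i j
    using U_F that by (simp add: measurable_mat_borel_iff)
  have v_entry: "(\<lambda>\<omega>. v (Suc t) \<omega> $ j) \<in> borel_measurable (F t)" if "j < d" for j
    using v_measurable[OF tq] that by (simp add: measurable_vec_borel_iff)

  \<comment> \<open>The row reflection that installs the next query\<close>
  define u where "u \<omega> k = (U \<omega> *\<^sub>v v (Suc t) \<omega>) $ k" for \<omega> k
  have u_sum: "u \<omega> k = (\<Sum>j<d. U \<omega> $$ (k, j) * v (Suc t) \<omega> $ j)" if "\<omega> \<in> space M" "k < d" for \<omega> k
    using that vc[OF that(1)] by (simp add: u_def scalar_prod_def atLeast0LessThan)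
  have u_F: "(\<lambda>\<omega>. u \<omega> k) \<in> borel_measurable (F t)" if "k < d" for k
  proof (subst measurable_cong)
    show "u \<omega> k = (\<Sum>j<d. U \<omega> $$ (k, j) * v (Suc t) \<omega> $ j)" if "\<omega> \<in> space (F t)" for \<omega>
      using u_sum that \<open>k < d\<close> by simp
    show "(\<lambda>\<omega>. \<Sum>j<d. U \<omega> $$ (k, j) * v (Suc t) \<omega> $ j) \<in> borel_measurable (F t)"
      using that by (intro borel_measurable_sum borel_measurable_times U_entry v_entry) auto
  qed
  \<comment> \<open>Entry \<open>k\<close> is the inner product of the new query with row
    \<open>k\<close> of \<open>U\<close>, which for \<open>k < t\<close> is an earlier
    query.\<close>
  have u_zero: "u \<omega> k = 0" if "\<omega> \<in> space M" "k < t" for \<omega> k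
    using that t U_row[OF that] v_orthonormal[OF that(1), of "Suc k" "Suc t"] by (simp add: u_def)
  have u_norm: "(\<Sum>k<d. (u \<omega> k)\<^sup>2) = 1" if "\<omega> \<in> space M" for \<omega>
  proof -
    have "(U \<omega> *\<^sub>v v (Suc t) \<omega>) \<bullet> (U \<omega> *\<^sub>v v (Suc t) \<omega>) = 1"
      using orthogonal_mult_vec_norm(2)[OF U_orth[OF that] vc[OF that]] v_orthonormal[OF that, of "Suc t" "Suc t"] t by simp
    then show ?thesis using that by (simp add: u_def scalar_prod_def atLeast0LessThan power2_eq_square)
  qed
  \<comment> \<open>Reflecting in this difference exchanges \<open>u\<close> and the
    \<open>t\<close>-th unit vector. It vanishes before index \<open>t\<close>, so the finished rows
    of \<open>U\<close> and \<open>L\<close> stay in place.\<close>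
  define w where "w \<omega> = (\<lambda>k. u \<omega> k - of_bool (k = t))" for \<omega>
  have w_F: "(\<lambda>\<omega>. w \<omega> k) \<in> borel_measurable (F t)" if "k < d" for k
    unfolding w_def using u_F[OF that] by (intro borel_measurable_diff) auto
  have w_zero: "w \<omega> k = 0" if "\<omega> \<in> space M" "k < t" for \<omega> k
    using u_zero[OF that] that by (simp add: w_def)

  define U' where "U' \<omega> = householder d (w \<omega>) * U \<omega>" for \<omega>
  define L1 where "L1 \<omega> = householder d (w \<omega>) * L \<omega>" for \<omega>
  have U'_orth: "orthogonal_real_mat d (U' \<omega>)" if "\<omega> \<in> space M" for \<omega>
    unfolding U'_def using that by (intro orthogonal_real_mat_mult orthogonal_householder U_orth)
  have U'c [simp]: "U' \<omega> \<in> carrier_mat d d" if "\<omega> \<in> space M" for \<omega>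
    using U'_orth[OF that] by (rule orthogonal_real_mat_carrier)
  note [simp] = carrier_matD[OF U'c]
  have U'_idx: "U' \<omega> $$ (i, j) = U \<omega> $$ (i, j) - 2 * w \<omega> i * (\<Sum>k<d. w \<omega> k * U \<omega> $$ (k, j)) / (\<Sum>k<d. (w \<omega> k)\<^sup>2)"
    if "\<omega> \<in> space M" "i < d" "j < d" for \<omega> i j
    unfolding U'_def using that by (intro index_householder_mult[of _ d d]) auto
  have U'_F: "U' \<in> F t \<rightarrow>\<^sub>M mat_borel d d"
    unfolding measurable_mat_borel_iff
  proof (intro conjI allI impI)
    fix i j assume ij: "i < d" "j < d"
    show "(\<lambda>\<omega>. U' \<omega> $$ (i, j)) \<in> borel_measurable (F t)"
    proof (subst measurable_cong)
      show "U' \<omega> $$ (i, j) = U \<omega> $$ (i, j) - 2 * w \<omega> i * (\<Sum>k<d. w \<omega> k * U \<omega> $$ (k, j)) / (\<Sum>k<d. (w \<omega> k)\<^sup>2)"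
        if "\<omega> \<in> space (F t)" for \<omega> using U'_idx that ij by simp
      show "(\<lambda>\<omega>. U \<omega> $$ (i, j) - 2 * w \<omega> i * (\<Sum>k<d. w \<omega> k * U \<omega> $$ (k, j)) / (\<Sum>k<d. (w \<omega> k)\<^sup>2)) \<in> borel_measurable (F t)"
        using ij by (intro borel_measurable_diff borel_measurable_divide borel_measurable_times borel_measurable_sum
            borel_measurable_power borel_measurable_const U_entry w_F) auto
    qed
  qed auto
  have U'_row: "row (U' \<omega>) i = v (Suc i) \<omega>" if w: "\<omega> \<in> space M" and i: "i < Suc t" for \<omega> i
  proof (cases "i = t")
    case False
    then have "i < t" using i by simp
    have "row (U' \<omega>) i = row (U \<omega>) i"
      using w \<open>i < t\<close> t U'_idx[OF w, of i] by (intro eq_vecI) (auto simp: w_zero)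
    then show ?thesis using U_row[OF w \<open>i < t\<close>] by simp
  next
    case True
    have "row (U' \<omega>) t = v (Suc t) \<omega>"
    proof (rule eq_vecI)
      show "dim_vec (row (U' \<omega>) t) = dim_vec (v (Suc t) \<omega>)" using w vc[OF w] by simp
      fix j assume "j < dim_vec (v (Suc t) \<omega>)"
      then have j: "j < d" using vc[OF w] by simp
      \<comment> \<open>Row \<open>t\<close> of the reflection is \<open>u\<close>, and the
        transpose of the orthogonal matrix \<open>U\<close> carries \<open>u\<close> back to the
        query.\<close>
      have "row (U' \<omega>) t $ j = (\<Sum>k<d. householder d (w \<omega>) $$ (t, k) * U \<omega> $$ (k, j))"
        using w j t by (simp add: U'_def scalar_prod_def atLeast0LessThan)
      also have "\<dots> = (\<Sum>k<d. U \<omega> $$ (k, j) * (U \<omega> *\<^sub>v v (Suc t) \<omega>) $ k)"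
        unfolding w_def using t householder_row[OF t(2) _ u_norm[OF w]]
        by (intro sum.cong) (auto simp: u_def simp del: index_mult_mat_vec)
      also have "\<dots> = row (transpose_mat (U \<omega>)) j \<bullet> (U \<omega> *\<^sub>v v (Suc t) \<omega>)"
        unfolding scalar_prod_def using w j
        by (intro sum.cong) (auto simp: atLeast0LessThan simp del: index_mult_mat_vec)
      also have "\<dots> = (transpose_mat (U \<omega>) *\<^sub>v (U \<omega> *\<^sub>v v (Suc t) \<omega>)) $ j"
        using w j by (intro index_mult_mat_vec[symmetric]) simp
      also have "\<dots> = v (Suc t) \<omega> $ j"
        using orthogonal_mult_vec_norm(1)[OF U_orth[OF w] vc[OF w]] by simp
      finally show "row (U' \<omega>) t $ j = v (Suc t) \<omega> $ j" .
    qed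
    then show ?thesis using True by simp
  qed
  have L1_eq: "L1 \<omega> = U' \<omega> * X \<omega> * Q \<omega>" if "\<omega> \<in> space M" for \<omega>
    unfolding L1_def L_def U'_def using that
    by (simp add: assoc_mult_mat[of _ d d _ d _ s] assoc_mult_mat[of _ d d _ s _ s] mult_carrier_mat[of _ d d _ s])
  have L1c [simp]: "L1 \<omega> \<in> carrier_mat d s" if "\<omega> \<in> space M" for \<omega>
    unfolding L1_def using that by (intro mult_carrier_mat[of _ d d]) auto
  have L1_idx: "L1 \<omega> $$ (i, j) = L \<omega> $$ (i, j) - 2 * w \<omega> i * (\<Sum>k<d. w \<omega> k * L \<omega> $$ (k, j)) / (\<Sum>k<d. (w \<omega> k)\<^sup>2)"
    if "\<omega> \<in> space M" "i < d" "j < s" for \<omega> i j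
    unfolding L1_def using that by (intro index_householder_mult[of _ d s]) auto

  \<comment> \<open>The column reflection that clears row \<open>t\<close> to the right of the
    diagonal\<close>
  define r where "r \<omega> j = (if t \<le> j then L1 \<omega> $$ (t, j) else 0)" for \<omega> j
  define \<rho> where "\<rho> \<omega> = sqrt (\<Sum>j<s. (r \<omega> j)\<^sup>2)" for \<omega>
  define z where "z \<omega> = (\<lambda>j. r \<omega> j / \<rho> \<omega> - of_bool (j = t))" for \<omega>
  \<comment> \<open>If \<open>\<rho> \<omega> = 0\<close> then \<open>z \<omega> = - e\<^sub>t\<close>, and the reflection still fixes \<open>r \<omega> = 0\<close>.\<close>
  define Q' where "Q' \<omega> = Q \<omega> * householder s (z \<omega>)" for \<omega>
  define L' where "L' \<omega> = L1 \<omega> * householder s (z \<omega>)" for \<omega>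
  have Q'_orth: "orthogonal_real_mat s (Q' \<omega>)" if "\<omega> \<in> space M" for \<omega>
    unfolding Q'_def using that by (intro orthogonal_real_mat_mult orthogonal_householder Q_orth)
  have L'_eq: "L' \<omega> = U' \<omega> * X \<omega> * Q' \<omega>" if "\<omega> \<in> space M" for \<omega>
    unfolding L'_def L1_eq[OF that] Q'_def using that
    by (intro assoc_mult_mat[of _ d s _ s _ s]) (auto intro!: mult_carrier_mat[of _ d d])
  have L'_idx: "L' \<omega> $$ (i, j) = L1 \<omega> $$ (i, j) - 2 * z \<omega> j * (\<Sum>k<s. z \<omega> k * L1 \<omega> $$ (i, k)) / (\<Sum>k<s. (z \<omega> k)\<^sup>2)"
    if "\<omega> \<in> space M" "i < d" "j < s" for \<omega> i j
    unfolding L'_def using that by (intro index_mult_householder[of _ d s]) auto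
  \<comment> \<open>In \<open>r\<close> the entries before column \<open>t\<close> were replaced by
    0 for this purpose: the reflection then spares the finished columns.\<close>
  have z_zero: "z \<omega> k = 0" if "k < t" for \<omega> k
    using that by (simp add: z_def r_def)
  have L'_left: "L' \<omega> $$ (i, j) = L1 \<omega> $$ (i, j)" if "\<omega> \<in> space M" "i < d" "j < t" for \<omega> i j
    using L'_idx[OF that(1,2), of j] that t by (simp add: z_zero)
  have L1_top: "L1 \<omega> $$ (i, j) = L \<omega> $$ (i, j)" if "\<omega> \<in> space M" "i < t" "j < s" for \<omega> i j
    using L1_idx[OF that(1) _ that(3), of i] that t by (simp add: w_zero)
  \<comment> \<open>A row above \<open>t\<close> is already zero from column \<open>t\<close> on,
    while \<open>z\<close> is zero before column \<open>t\<close>; the row is orthogonal to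
    \<open>z\<close> and is not moved.\<close>
  have L'_top: "L' \<omega> $$ (i, j) = L \<omega> $$ (i, j)" if w: "\<omega> \<in> space M" and ij: "i < t" "j < s" for \<omega> i j
  proof -
    have "(\<Sum>k<s. z \<omega> k * L1 \<omega> $$ (i, k)) = 0"
    proof (rule sum.neutral, rule ballI)
      fix k assume "k \<in> {..<s}"
      then show "z \<omega> k * L1 \<omega> $$ (i, k) = 0"
        using z_zero[of k \<omega>] L1_top[OF w \<open>i < t\<close>, of k] L_zero[OF w \<open>i < t\<close>, of k] ij by (cases "k < t") auto
    qed
    then show ?thesis using L'_idx[OF w _ \<open>j < s\<close>, of i] L1_top[OF w] ij t by simp
  qed
  have L'_t: "L' \<omega> $$ (t, j) = \<rho> \<omega> * of_bool (j = t)" if w: "\<omega> \<in> space M" and j: "t \<le> j" "j < s" for \<omega> j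
  proof -
    have "(\<Sum>k<s. z \<omega> k * L1 \<omega> $$ (t, k)) = (\<Sum>k<s. z \<omega> k * r \<omega> k)"
      by (intro sum.cong refl) (auto simp: r_def z_zero)
    then have "L' \<omega> $$ (t, j) = r \<omega> j - 2 * z \<omega> j * (\<Sum>k<s. z \<omega> k * r \<omega> k) / (\<Sum>k<s. (z \<omega> k)\<^sup>2)"
      using L'_idx[OF w t(2) j(2)] j by (simp add: r_def)
    also have "\<dots> = \<rho> \<omega> * of_bool (j = t)"
      unfolding z_def \<rho>_def by (rule householder_annihilates[OF t(1) j(2)])
    finally show ?thesis .
  qed

  \<comment> \<open>The enlarged sigma-field and the remaining Gaussian block\<close>
  let ?I = "{t} \<times> {t..<s}" and ?J = "{Suc t..<d} \<times> {t..<s}"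
  let ?I' = "{Suc t..<d} \<times> {t}" and ?J' = "{Suc t..<d} \<times> {Suc t..<s}"
  \<comment> \<open>The direction \<open>z\<close> is a function of \<open>r\<close>, so
    \<open>r\<close> has to be known before the columns are reflected; the new column exists only
    after that reflection. Hence two enlargements.\<close>
  define G1 where "G1 = adjoin G ?I (\<lambda>\<omega> ij. L1 \<omega> $$ ij)"
  define G2 where "G2 = adjoin G1 ?I' (\<lambda>\<omega> ij. L' \<omega> $$ ij)"
  have sG1: "space G1 = space M" by (simp add: G1_def adjoin_def sG)
  have sG2: "space G2 = space M" by (simp add: G2_def adjoin_def sG1)
  have G1G: "subalgebra G1 G" unfolding G1_def by (rule subalgebra_adjoin)
  have G2G1: "subalgebra G2 G1" unfolding G2_def by (rule subalgebra_adjoin)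
  \<comment> \<open>As \<open>w\<close> and \<open>z\<close> vanish before index \<open>t\<close>,
    reflections of the full matrix act on the block as reflections of the block alone.\<close>
  have low: "(\<Sum>k<n. g k) = (\<Sum>k\<in>{t..<n}. g k)" if "\<And>k. k < t \<Longrightarrow> g k = 0" for g :: "nat \<Rightarrow> real" and n
    by (intro sum.mono_neutral_right) (use that in \<open>auto simp: not_le\<close>)
  have gauss1: "gaussian_given M G \<sigma> ({t..<d} \<times> {t..<s}) (\<lambda>\<omega> ij. L1 \<omega> $$ ij)"
  proof (rule gaussian_given_reflect_columns[OF prob_space_axioms sigma_pos _ _ L_gauss, where w=w])
    fix \<omega> i j assume w: "\<omega> \<in> space M" and ij: "i \<in> {t..<d}" "j \<in> {t..<s}"
    have "(\<Sum>k<d. w \<omega> k * L \<omega> $$ (k, j)) = (\<Sum>k\<in>{t..<d}. w \<omega> k * L \<omega> $$ (k, j))"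
      "(\<Sum>k<d. (w \<omega> k)\<^sup>2) = (\<Sum>k\<in>{t..<d}. (w \<omega> k)\<^sup>2)"
      by (rule low; simp add: w_zero[OF w])+
    then show "L1 \<omega> $$ (i, j) = L \<omega> $$ (i, j) - 2 * w \<omega> i * (\<Sum>k\<in>{t..<d}. w \<omega> k * L \<omega> $$ (k, j)) / (\<Sum>k\<in>{t..<d}. (w \<omega> k)\<^sup>2)"
      using L1_idx[OF w, of i j] ij by simp
  qed (auto intro!: FG w_F)
  have "?I \<union> ?J = {t..<d} \<times> {t..<s}" using t by auto
  then have gauss2: "gaussian_given M G1 \<sigma> ?J (\<lambda>\<omega> ij. L1 \<omega> $$ ij)"
    unfolding G1_def using gauss1
    by (intro gaussian_given_split[OF prob_space_axioms sigma_pos]) auto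
  have r_G1: "(\<lambda>\<omega>. r \<omega> j) \<in> borel_measurable G1" if "j < s" for j
    using that measurable_adjoin[of "(t, j)" ?I "\<lambda>\<omega> ij. L1 \<omega> $$ ij" G] by (cases "t \<le> j") (auto simp: r_def G1_def)
  have \<rho>_G1: "\<rho> \<in> borel_measurable G1"
    unfolding \<rho>_def[abs_def] using r_G1 by (intro measurable_compose[OF _ borel_measurable_sqrt] borel_measurable_sum borel_measurable_power) auto
  have z_G1: "(\<lambda>\<omega>. z \<omega> j) \<in> borel_measurable G1" if "j < s" for j
    unfolding z_def using r_G1[OF that] \<rho>_G1 by (intro borel_measurable_diff borel_measurable_divide) auto
  have gauss3: "gaussian_given M G1 \<sigma> ?J (\<lambda>\<omega> ij. L' \<omega> $$ ij)"
  proof (rule gaussian_given_reflect_rows[OF prob_space_axioms sigma_pos _ _ gauss2, where w=z])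
    fix \<omega> i j assume w: "\<omega> \<in> space M" and ij: "i \<in> {Suc t..<d}" "j \<in> {t..<s}"
    have "(\<Sum>k<s. z \<omega> k * L1 \<omega> $$ (i, k)) = (\<Sum>k\<in>{t..<s}. z \<omega> k * L1 \<omega> $$ (i, k))"
      "(\<Sum>k<s. (z \<omega> k)\<^sup>2) = (\<Sum>k\<in>{t..<s}. (z \<omega> k)\<^sup>2)"
      by (rule low; simp add: z_zero)+
    then show "L' \<omega> $$ (i, j) = L1 \<omega> $$ (i, j) - 2 * z \<omega> j * (\<Sum>k\<in>{t..<s}. z \<omega> k * L1 \<omega> $$ (i, k)) / (\<Sum>k\<in>{t..<s}. (z \<omega> k)\<^sup>2)"
      using L'_idx[OF w, of i j] ij by simp
  qed (auto intro!: z_G1)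
  have "?I' \<union> ?J' = ?J" using t by auto
  then have gauss4: "gaussian_given M G2 \<sigma> ?J' (\<lambda>\<omega> ij. L' \<omega> $$ ij)"
    unfolding G2_def using gauss3
    by (intro gaussian_given_split[OF prob_space_axioms sigma_pos]) auto
  have MG2: "subalgebra M G2" using gauss4 by (simp add: gaussian_given_def)

  have G1_G2: "h \<in> borel_measurable G2" if "h \<in> borel_measurable G1" for h :: "'w \<Rightarrow> real"
    using that by (rule measurable_from_subalg[OF G2G1])
  have G_G2: "h \<in> borel_measurable G2" if "h \<in> borel_measurable G" for h :: "'w \<Rightarrow> real"
    using measurable_from_subalg[OF G1G that] by (rule G1_G2)
  have L'_G2: "(\<lambda>\<omega>. L' \<omega> $$ (i, j)) \<in> borel_measurable G2" if i: "i < d" and j: "j < Suc t" for i j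
  proof -
    \<comment> \<open>Old columns were reflected by a vector measurable for \<open>F t\<close>. In
      column \<open>t\<close> the entries above the diagonal are zero, the diagonal entry is \<rho>,
      and those below it were adjoined.\<close>
    consider "j < t" | "j = t" "i < t" | "j = t" "i = t" | "j = t" "t < i" using j by linarith
    then show ?thesis
    proof cases
      case 1
      have "(\<lambda>\<omega>. L \<omega> $$ (i, j) - 2 * w \<omega> i * (\<Sum>k<d. w \<omega> k * L \<omega> $$ (k, j)) / (\<Sum>k<d. (w \<omega> k)\<^sup>2)) \<in> borel_measurable G"
        using i 1 by (intro borel_measurable_diff borel_measurable_divide borel_measurable_times borel_measurable_sum
            borel_measurable_power borel_measurable_const FG[OF w_F] L_G) auto
      then show ?thesis
        using i 1 t by (intro measurable_cong[THEN iffD2, OF _ G_G2]) (auto simp: L'_left L1_idx sG2)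
    next
      case 2
      then show ?thesis
        using t by (intro measurable_cong[THEN iffD2, OF _ borel_measurable_const[where c=0]]) (auto simp: L'_top L_zero sG2)
    next
      case 3
      then show ?thesis
        using t by (intro measurable_cong[THEN iffD2, OF _ G1_G2[OF \<rho>_G1]]) (auto simp: L'_t sG2)
    next
      case 4
      then show ?thesis
        using i measurable_adjoin[of "(i, t)" ?I' "\<lambda>\<omega> ij. L' \<omega> $$ ij" G1] by (auto simp: G2_def)
    qed
  qed

  \<comment> \<open>The reply expressed through the first \<open>t + 1\<close> columns\<close>
  define y where "y \<omega> i = (U' \<omega> *\<^sub>v (W \<omega> *\<^sub>v v (Suc t) \<omega>)) $ i" for \<omega> i
  have y_eq: "y \<omega> i = (\<Sum>j<Suc t. L' \<omega> $$ (i, j) * L' \<omega> $$ (t, j))" if w: "\<omega> \<in> space M" and i: "i < d" for \<omega> i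
  proof -
    have "y \<omega> i = (\<Sum>j<s. L' \<omega> $$ (i, j) * L' \<omega> $$ (t, j))"
      using mult_gram_row[OF U'_orth[OF w] Q'_orth[OF w] Xc[OF w] t(2) i] w
      by (simp add: y_def W_eq U'_row L'_eq del: index_mult_mat_vec index_mult_mat)
    \<comment> \<open>Row \<open>t\<close> of \<open>L'\<close> vanishes beyond column
      \<open>t\<close>, so the hidden block drops out of the reply.\<close>
    also have "\<dots> = (\<Sum>j<Suc t. L' \<omega> $$ (i, j) * L' \<omega> $$ (t, j))"
      using t by (intro sum.mono_neutral_right) (auto simp: L'_t[OF w])
    finally show ?thesis .
  qed
  \<comment> \<open>As \<open>U'\<close> is orthogonal and measurable for \<open>F t\<close>, the
    reply and its coordinates \<open>y\<close> can each be computed from the other.\<close>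
  have Wv_eq: "(W \<omega> *\<^sub>v v (Suc t) \<omega>) $ k = (\<Sum>i<d. U' \<omega> $$ (i, k) * y \<omega> i)" if w: "\<omega> \<in> space M" and k: "k < d" for \<omega> k
  proof -
    have Wv: "W \<omega> *\<^sub>v v (Suc t) \<omega> \<in> carrier_vec d"
      using W_carrier[OF w] vc[OF w] by (rule mult_mat_vec_carrier)
    have "(W \<omega> *\<^sub>v v (Suc t) \<omega>) $ k = (transpose_mat (U' \<omega>) *\<^sub>v (U' \<omega> *\<^sub>v (W \<omega> *\<^sub>v v (Suc t) \<omega>))) $ k"
      by (simp only: orthogonal_mult_vec_norm(1)[OF U'_orth[OF w] Wv])
    also have "\<dots> = row (transpose_mat (U' \<omega>)) k \<bullet> (U' \<omega> *\<^sub>v (W \<omega> *\<^sub>v v (Suc t) \<omega>))"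
      using w k by (subst index_mult_mat_vec) auto
    also have "\<dots> = (\<Sum>i<d. U' \<omega> $$ (i, k) * y \<omega> i)"
      unfolding scalar_prod_def y_def using w k
      by (intro sum.cong) (auto simp: atLeast0LessThan simp del: index_mult_mat_vec)
    finally show ?thesis .
  qed
  have U'_entry: "(\<lambda>\<omega>. U' \<omega> $$ (i, j)) \<in> borel_measurable (F t)" if "i < d" "j < d" for i j
    using U'_F that by (simp add: measurable_mat_borel_iff)
  have y_F: "(\<lambda>\<omega>. y \<omega> i) \<in> borel_measurable (F (Suc t))" if i: "i < d" for i
  proof (subst measurable_cong)
    have Wv: "(\<lambda>\<omega>. W \<omega> *\<^sub>v v (Suc t) \<omega>) \<in> F (Suc t) \<rightarrow>\<^sub>M vec_borel d"
      using F_measurable(3)[OF t(4), of "Suc t"] by simp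
    show "y \<omega> i = (\<Sum>k<d. U' \<omega> $$ (i, k) * (W \<omega> *\<^sub>v v (Suc t) \<omega>) $ k)" if "\<omega> \<in> space (F (Suc t))" for \<omega>
      unfolding y_def using that i measurable_space[OF Wv that]
      by (subst index_mult_mat_vec)
        (auto simp: scalar_prod_def atLeast0LessThan carrier_matD[OF W_carrier] simp del: index_mult_mat_vec)
    show "(\<lambda>\<omega>. \<Sum>k<d. U' \<omega> $$ (i, k) * (W \<omega> *\<^sub>v v (Suc t) \<omega>) $ k) \<in> borel_measurable (F (Suc t))"
      using i Wv by (intro borel_measurable_sum borel_measurable_times FF[OF U'_entry])
        (auto simp: measurable_vec_borel_iff simp del: index_mult_mat_vec)
  qed
  \<comment> \<open>The inclusion must hold for every event, so the reply is written as a polynomial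
    in entries of \<open>U'\<close> and \<open>L'\<close> that are measurable for \<open>G2\<close>,
    without any division.\<close>
  have G2F: "subalgebra G2 (F (Suc t))"
  proof (rule F_least[OF sG2])
    have G2Ft: "subalgebra G2 (F t)"
      using G2G1 G1G GF by (auto simp: subalgebra_def)
    show "\<xi> \<in> G2 \<rightarrow>\<^sub>M S"
      using F_measurable(1)[of t] tq by (intro measurable_from_subalg[OF G2Ft]) auto
    fix i assume i: "i \<in> {1..Suc t}"
    show "v i \<in> G2 \<rightarrow>\<^sub>M vec_borel d"
      using F_measurable(2)[of t i] v_measurable[OF tq] i tq
      by (intro measurable_from_subalg[OF G2Ft]) (cases "i = Suc t", auto)
    show "(\<lambda>\<omega>. W \<omega> *\<^sub>v v i \<omega>) \<in> G2 \<rightarrow>\<^sub>M vec_borel d"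
    proof (cases "i = Suc t")
      case False
      then show ?thesis
        using F_measurable(3)[of t i] i tq by (intro measurable_from_subalg[OF G2Ft]) auto
    next
      case True
      have "(\<lambda>\<omega>. (W \<omega> *\<^sub>v v (Suc t) \<omega>) $ k) \<in> borel_measurable G2" if k: "k < d" for k
      proof (subst measurable_cong)
        show "(W \<omega> *\<^sub>v v (Suc t) \<omega>) $ k = (\<Sum>i<d. U' \<omega> $$ (i, k) * (\<Sum>j<Suc t. L' \<omega> $$ (i, j) * L' \<omega> $$ (t, j)))"
          if "\<omega> \<in> space G2" for \<omega>
          using that k by (simp add: sG2 Wv_eq y_eq del: index_mult_mat_vec)
        show "(\<lambda>\<omega>. \<Sum>i<d. U' \<omega> $$ (i, k) * (\<Sum>j<Suc t. L' \<omega> $$ (i, j) * L' \<omega> $$ (t, j))) \<in> borel_measurable G2"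
          using k t by (intro borel_measurable_sum borel_measurable_times G_G2[OF FG[OF U'_entry]] L'_G2) auto
      qed
      then show ?thesis
        using True mult_mat_vec_carrier[OF W_carrier vc]
        by (auto simp: measurable_vec_borel_iff sG2 simp del: index_mult_mat_vec)
    qed
  qed

  \<comment> \<open>\<open>y = L' L'\<^sup>T e\<^sub>t\<close> is observed, so column \<open>t\<close> of \<open>L'\<close> can be solved for once the earlier columns
    are known. The division by \<open>\<rho>\<close> makes this an almost sure statement only.\<close>
  define f1 where "f1 i j \<omega> = f i j \<omega> - 2 * w \<omega> i * (\<Sum>k<d. w \<omega> k * f k j \<omega>) / (\<Sum>k<d. (w \<omega> k)\<^sup>2)" for i j \<omega>
  define b where "b \<omega> = sqrt (y \<omega> t - (\<Sum>j<t. f1 t j \<omega> * f1 t j \<omega>))" for \<omega>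
  define f' where "f' i j \<omega> = (if j < t then f1 i j \<omega> else if i < t then 0 else if i = t then b \<omega>
      else (y \<omega> i - (\<Sum>j<t. f1 i j \<omega> * f1 t j \<omega>)) / b \<omega>)" for i j \<omega>
  have f1_F: "f1 i j \<in> borel_measurable (F (Suc t))" if "i < d" "j < t" for i j
    unfolding f1_def[abs_def] using that
    by (intro FF borel_measurable_diff borel_measurable_divide borel_measurable_times borel_measurable_sum
            borel_measurable_power borel_measurable_const w_F f) auto
  have b_F: "b \<in> borel_measurable (F (Suc t))"
    unfolding b_def[abs_def] using t
    by (intro measurable_compose[OF _ borel_measurable_sqrt] borel_measurable_diff borel_measurable_sum borel_measurable_times y_F f1_F) auto
  have f'_F: "f' i j \<in> borel_measurable (F (Suc t))" if "i < d" "j < Suc t" for i j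
  proof -
    consider "j < t" | "\<not> j < t" "i < t" | "\<not> j < t" "i = t" | "\<not> j < t" "t < i" by linarith
    then show ?thesis
    proof cases
      case 4
      then show ?thesis unfolding f'_def[abs_def] using t that
        by (auto intro!: borel_measurable_divide borel_measurable_diff borel_measurable_sum borel_measurable_times y_F f1_F b_F)
    qed (use that f1_F b_F in \<open>auto simp: f'_def[abs_def]\<close>)
  qed
  \<comment> \<open>One nonzero entry of \<open>r\<close> already makes \<rho> positive. Since
    \<open>t < s\<close>, the entry \<open>(t, t)\<close> belongs to the Gaussian block.\<close>
  have "AE \<omega> in M. L1 \<omega> $$ (t, t) \<noteq> 0"
    using t by (intro gaussian_given_AE_nonzero[OF prob_space_axioms sigma_pos _ _ gauss1]) auto
  then have \<rho>_pos: "AE \<omega> in M. 0 < \<rho> \<omega>"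
  proof eventually_elim
    fix \<omega> assume "L1 \<omega> $$ (t, t) \<noteq> 0"
    then have "0 < (r \<omega> t)\<^sup>2" by (simp add: r_def)
    also have "\<dots> \<le> (\<Sum>j<s. (r \<omega> j)\<^sup>2)" using t by (intro member_le_sum) auto
    finally show "0 < \<rho> \<omega>" by (simp add: \<rho>_def)
  qed
  have L'f': "AE \<omega> in M. \<forall>i<d. \<forall>j<Suc t. L' \<omega> $$ (i, j) = f' i j \<omega>"
    using Lf \<rho>_pos AE_space
  proof eventually_elim
    fix \<omega> assume e: "\<forall>i<d. \<forall>j<t. L \<omega> $$ (i, j) = f i j \<omega>" and \<rho>: "0 < \<rho> \<omega>" and w: "\<omega> \<in> space M"
    have left: "L' \<omega> $$ (i, j) = f1 i j \<omega>" if "i < d" "j < t" for i j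
      using that e t by (simp add: L'_left w L1_idx f1_def)
    have diag: "L' \<omega> $$ (t, t) = \<rho> \<omega>" using L'_t[OF w, of t] t by simp
    have ye: "y \<omega> i = (\<Sum>j<t. f1 i j \<omega> * f1 t j \<omega>) + L' \<omega> $$ (i, t) * \<rho> \<omega>" if "i < d" for i
      using y_eq[OF w that] that t by (simp add: left diag)
    \<comment> \<open>For \<open>i = t\<close> the last term of \<open>ye\<close> is
      \<open>\<rho> \<omega> * \<rho> \<omega>\<close>, so \<open>b\<close> is the root of a square,
      and positivity of \<rho> settles the sign.\<close>
    have b: "b \<omega> = \<rho> \<omega>"
      using ye[of t] t \<rho> by (simp add: b_def diag)
    show "\<forall>i<d. \<forall>j<Suc t. L' \<omega> $$ (i, j) = f' i j \<omega>"
    proof (intro allI impI)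
      fix i j assume "i < d" "j < Suc t"
      then show "L' \<omega> $$ (i, j) = f' i j \<omega>"
        using left[of i j] diag ye[of i] L'_top[OF w, of i t] L_zero[OF w, of i t] t b \<rho>
        by (cases "j < t"; cases i t rule: linorder_cases) (auto simp: f'_def less_Suc_eq)
    qed
  qed
  have L'_pos: "AE \<omega> in M. \<forall>i<Suc t. 0 < L' \<omega> $$ (i, i)"
    using L_pos \<rho>_pos AE_space
  proof eventually_elim
    fix \<omega> assume "\<forall>i<t. 0 < L \<omega> $$ (i, i)" "0 < \<rho> \<omega>" "\<omega> \<in> space M"
    then show "\<forall>i<Suc t. 0 < L' \<omega> $$ (i, i)"
      using t by (auto simp: less_Suc_eq L'_top L'_t)
  qed

  \<comment> \<open>Assembling stage \<open>t + 1\<close>\<close>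
  have Q'_G2: "Q' \<in> G2 \<rightarrow>\<^sub>M mat_borel s s"
    unfolding measurable_mat_borel_iff
  proof (intro conjI allI impI)
    show "Q' \<in> space G2 \<rightarrow> carrier_mat s s"
      using Q'_orth by (auto simp: sG2 orthogonal_real_mat_carrier)
    fix i j assume ij: "i < s" "j < s"
    have Q_entry: "(\<lambda>\<omega>. Q \<omega> $$ (i, k)) \<in> borel_measurable G2" if "k < s" for k
      using Q_G ij that by (intro G_G2) (simp add: measurable_mat_borel_iff)
    show "(\<lambda>\<omega>. Q' \<omega> $$ (i, j)) \<in> borel_measurable G2"
    proof (subst measurable_cong)
      show "Q' \<omega> $$ (i, j) = Q \<omega> $$ (i, j) - 2 * z \<omega> j * (\<Sum>k<s. z \<omega> k * Q \<omega> $$ (i, k)) / (\<Sum>k<s. (z \<omega> k)\<^sup>2)"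
        if "\<omega> \<in> space G2" for \<omega>
        unfolding Q'_def using ij that by (intro index_mult_householder[of _ s s]) (auto simp: sG2)
      show "(\<lambda>\<omega>. Q \<omega> $$ (i, j) - 2 * z \<omega> j * (\<Sum>k<s. z \<omega> k * Q \<omega> $$ (i, k)) / (\<Sum>k<s. (z \<omega> k)\<^sup>2)) \<in> borel_measurable G2"
        using ij by (intro borel_measurable_diff borel_measurable_divide borel_measurable_times borel_measurable_sum
            borel_measurable_power borel_measurable_const Q_entry G1_G2[OF z_G1]) auto
    qed
  qed
  have eq: "\<And>\<omega>. \<omega> \<in> space M \<Longrightarrow> U' \<omega> * X \<omega> * Q' \<omega> = L' \<omega>" by (simp add: L'_eq)
  have zero: "L' \<omega> $$ (i, j) = 0" if "\<omega> \<in> space M" "i < Suc t" "j < s" "i < j" for \<omega> i j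
    using that L'_top[of \<omega> i j] L_zero[of \<omega> i j] L'_t[of \<omega> j] by (cases "i = t") auto
  have AE_eq: "AE \<omega> in M. U' \<omega> * X \<omega> * Q' \<omega> = L' \<omega>"
    using AE_space by eventually_elim (rule eq)
  have "stage (Suc t) U' G2 Q'"
    unfolding stage_def
  proof (intro conjI exI[of _ f'])
    show "U' \<in> F (Suc t) \<rightarrow>\<^sub>M mat_borel d d"
      by (rule measurable_from_subalg[OF F_Suc[OF t(4)] U'_F])
    show "\<forall>\<omega>\<in>space M. orthogonal_real_mat d (U' \<omega>) \<and> (\<forall>i<Suc t. row (U' \<omega>) i = v (Suc i) \<omega>)"
      using U'_orth U'_row by blast
    show "\<forall>i<d. \<forall>j<Suc t. (\<lambda>\<omega>. (U' \<omega> * X \<omega> * Q' \<omega>) $$ (i, j)) \<in> borel_measurable G2"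
    proof (intro allI impI)
      fix i j assume "i < d" "j < Suc t"
      from L'_G2[OF this] show "(\<lambda>\<omega>. (U' \<omega> * X \<omega> * Q' \<omega>) $$ (i, j)) \<in> borel_measurable G2"
        by (rule measurable_cong[THEN iffD1, rotated]) (simp add: eq sG2)
    qed
    show "\<forall>i<d. \<forall>j<Suc t. f' i j \<in> borel_measurable (F (Suc t))" using f'_F by blast
    show "AE \<omega> in M. \<forall>i<d. \<forall>j<Suc t. (U' \<omega> * X \<omega> * Q' \<omega>) $$ (i, j) = f' i j \<omega>"
      using L'f' AE_eq by eventually_elim simp
    show "AE \<omega> in M. \<forall>i<Suc t. 0 < (U' \<omega> * X \<omega> * Q' \<omega>) $$ (i, i)"
      using L'_pos AE_eq by eventually_elim simp
    show "gaussian_given M G2 \<sigma> ({Suc t..<d} \<times> {Suc t..<s}) (\<lambda>\<omega> ij. (U' \<omega> * X \<omega> * Q' \<omega>) $$ ij)"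
      by (rule gaussian_given_cong[OF gauss4]) (simp add: eq)
  qed (use MG2 G2F Q'_G2 Q'_orth zero eq in auto)
  then show ?thesis by blast
qed

lemma stage_exists: "t \<le> q \<Longrightarrow> \<exists>U G Q. stage t U G Q"
proof (induction t)
  case 0
  then show ?case using stage_0 by blast
next
  case (Suc t)
  then show ?case using stage_Suc[of t] by auto
qed

end

section \<open>From the invariant to the blocks and their laws\<close>

lemma gaussian_mat_shift:
  assumes "0 < c" "t \<le> d" "t \<le> s"
  shows "gaussian_mat c (d - t) (s - t) = distr (gauss (sqrt c) ({t..<d} \<times> {t..<s})) (mat_borel (d - t) (s - t))
    (\<lambda>x. mat (d - t) (s - t) (\<lambda>(i, j). x (i + t, j + t)))"
proof -
  let ?I = "{..<d - t} \<times> {..<s - t}" and ?K = "{t..<d} \<times> {t..<s}"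
  let ?N = "\<lambda>_ :: nat \<times> nat. density lborel (normal_density 0 (sqrt c))"
  let ?f = "\<lambda>p :: nat \<times> nat. (fst p + t, snd p + t)"
  \<comment> \<open>Independent identically distributed coordinates may be relabelled along an
    injection. For \<open>t = s\<close> both index sets are empty and the law is a point
    mass.\<close>
  have re: "gauss (sqrt c) ?I = distr (gauss (sqrt c) ?K) (gauss (sqrt c) ?I) (\<lambda>x. \<lambda>p\<in>?I. x (?f p))"
    unfolding gauss_def
    by (rule distr_PiM_reindex[where M="?N", symmetric])
      (use assms in \<open>auto intro!: prob_space_normal_density inj_onI\<close>)
  have m: "mat (d - t) (s - t) \<in> gauss (sqrt c) ?I \<rightarrow>\<^sub>M mat_borel (d - t) (s - t)"
    unfolding measurable_mat_borel_iff by (auto simp: measurable_cong_sets[OF sets_gauss refl])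
  have r: "(\<lambda>x. \<lambda>p\<in>?I. x (?f p)) \<in> gauss (sqrt c) ?K \<rightarrow>\<^sub>M gauss (sqrt c) ?I"
    unfolding measurable_cong_sets[OF sets_gauss sets_gauss]
    by (intro measurable_restrict measurable_component_singleton) auto
  have "gaussian_mat c (d - t) (s - t) = distr (gauss (sqrt c) ?I) (mat_borel (d - t) (s - t)) (mat (d - t) (s - t))"
    by (simp add: gaussian_mat_def gauss_def)
  also have "\<dots> = distr (gauss (sqrt c) ?K) (mat_borel (d - t) (s - t)) (mat (d - t) (s - t) \<circ> (\<lambda>x. \<lambda>p\<in>?I. x (?f p)))"
    by (subst re) (rule distr_distr[OF m r])
  also have "mat (d - t) (s - t) \<circ> (\<lambda>x. \<lambda>p\<in>?I. x (?f p)) = (\<lambda>x. mat (d - t) (s - t) (\<lambda>(i, j). x (i + t, j + t)))"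
    by (auto simp: fun_eq_iff intro!: eq_matI)
  finally show ?thesis .
qed

context adaptive_queries
begin

text \<open>The product formula of \<open>gaussian_given\<close> is pulled back along the map that
  assembles a matrix from its entries. The event \<open>space M\<close> then yields the law, and
  general events of \<open>G\<close> yield independence.\<close>

lemma gaussian_given_block:
  fixes L :: "'w \<Rightarrow> real mat"
  assumes "t \<le> s" and L: "gaussian_given M G \<sigma> ({t..<d} \<times> {t..<s}) (\<lambda>\<omega> ij. L \<omega> $$ ij)"
  defines "D \<equiv> \<lambda>\<omega>. mat (d - t) (s - t) (\<lambda>(i, j). L \<omega> $$ (i + t, j + t))"
    and "N \<equiv> mat_borel (d - t) (s - t)"
  shows "D \<in> M \<rightarrow>\<^sub>M N"
    and "distr M N D = gaussian_mat (1 / real d) (d - t) (s - t)"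
    and "indep_set (sets (vimage_algebra (space M) D N)) (sets G)"
proof -
  let ?I = "{t..<d} \<times> {t..<s}" and ?\<gamma> = "gaussian_mat (1 / real d) (d - t) (s - t)"
  have MG: "subalgebra M G" and Li: "\<And>ij. ij \<in> ?I \<Longrightarrow> (\<lambda>\<omega>. L \<omega> $$ ij) \<in> borel_measurable M"
    using L by (auto simp: gaussian_given_def)
  show D: "D \<in> M \<rightarrow>\<^sub>M N"
    unfolding N_def measurable_mat_borel_iff D_def by (auto intro!: Li)
  define h where "h x = mat (d - t) (s - t) (\<lambda>(i, j). x (i + t, j + t))" for x :: "nat \<times> nat \<Rightarrow> real"
  have h: "h \<in> gauss \<sigma> ?I \<rightarrow>\<^sub>M N"
    unfolding N_def measurable_mat_borel_iff h_def
    by (auto simp: measurable_cong_sets[OF sets_gauss refl] intro!: measurable_component_singleton)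
  have \<gamma>: "?\<gamma> = distr (gauss \<sigma> ?I) N h"
    unfolding N_def h_def[abs_def] using dims \<open>t \<le> s\<close> by (intro gaussian_mat_shift) auto
  have Dh: "D \<omega> = h (restrict (\<lambda>ij. L \<omega> $$ ij) ?I)" for \<omega>
    unfolding D_def h_def by (auto intro!: eq_matI)
  have key: "emeasure M (A \<inter> (D -` B \<inter> space M)) = emeasure M A * emeasure ?\<gamma> B"
    if A: "A \<in> sets G" and B: "B \<in> sets N" for A B
  proof -
    have AM: "A \<subseteq> space M" using sets.sets_into_space[OF A] MG by (simp add: subalgebra_def)
    have hB: "h -` B \<inter> space (gauss \<sigma> ?I) \<in> sets (PiM ?I (\<lambda>_. borel))"
      using measurable_sets[OF h B] by simp
    have eq: "A \<inter> (D -` B \<inter> space M) = {\<omega>\<in>A. restrict (\<lambda>ij. L \<omega> $$ ij) ?I \<in> h -` B \<inter> space (gauss \<sigma> ?I)}"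
      using AM by (auto simp: Dh)
    show ?thesis
      unfolding eq \<gamma> emeasure_distr[OF h B] using L A hB unfolding gaussian_given_def by blast
  qed
  have sp: "space M \<in> sets G" using MG by (metis sets.top subalgebra_def)
  show law: "distr M N D = ?\<gamma>"
  proof (rule measure_eqI)
    fix B assume "B \<in> sets (distr M N D)"
    then have B: "B \<in> sets N" by simp
    have "emeasure (distr M N D) B = emeasure M (space M \<inter> (D -` B \<inter> space M))"
      unfolding emeasure_distr[OF D B] by (rule arg_cong[where f="emeasure M"]) auto
    then show "emeasure (distr M N D) B = emeasure ?\<gamma> B"
      using key[OF sp B] by (simp add: emeasure_space_1)
  qed (simp add: gaussian_mat_def N_def)
  show "indep_set (sets (vimage_algebra (space M) D N)) (sets G)"
    unfolding indep_sets2_eq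
  proof (intro conjI ballI)
    show "sets (vimage_algebra (space M) D N) \<subseteq> events"
      using subalgebra_vimage_algebra[OF D refl] by (simp add: subalgebra_def)
    show "sets G \<subseteq> events" using MG by (simp add: subalgebra_def)
    fix E A assume "E \<in> sets (vimage_algebra (space M) D N)" and A: "A \<in> sets G"
    then obtain B where E: "E = D -` B \<inter> space M" and B: "B \<in> sets N"
      using measurable_space[OF D] by (subst (asm) sets_vimage_algebra2) auto
    have "emeasure M (E \<inter> A) = emeasure M E * emeasure M A"
      using key[OF A B] emeasure_distr[OF D B] unfolding law E by (simp add: Int_ac mult.commute)
    then show "prob (E \<inter> A) = prob E * prob A"
      by (simp add: emeasure_eq_measure ennreal_mult'[symmetric])
  qed
qed

text \<open>\<open>A\<close> and \<open>C\<close> are built from the observable versions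
  \<open>f\<close>, which makes them measurable for \<open>F t\<close> but confines the block
  equation to almost every sample point. \<open>D\<close> is cut out of the true product, so its law
  and its independence of \<open>G\<close> come directly from the invariant.\<close>

lemma stage_blocks:
  assumes st: "stage t U G Q" and "t \<le> q"
  obtains A C D where
    "A \<in> F t \<rightarrow>\<^sub>M mat_borel t t" "C \<in> F t \<rightarrow>\<^sub>M mat_borel (d - t) t" "D \<in> M \<rightarrow>\<^sub>M mat_borel (d - t) (s - t)"
    "AE \<omega> in M. U \<omega> * X \<omega> * Q \<omega> = four_block_mat (A \<omega>) (0\<^sub>m t (s - t)) (C \<omega>) (D \<omega>)"
    "AE \<omega> in M. lower_triangular_pos (A \<omega>)"
    "distr M (mat_borel (d - t) (s - t)) D = gaussian_mat (1 / real d) (d - t) (s - t)"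
    "indep_set (sets (vimage_algebra (space M) D (mat_borel (d - t) (s - t)))) (sets G)"
proof -
  have t: "t \<le> s" "t < d" using assms dims by auto
  define L where "L \<omega> = U \<omega> * X \<omega> * Q \<omega>" for \<omega>
  note st' = st[unfolded stage_def, folded L_def]
  have Lc: "L \<omega> \<in> carrier_mat d s" if "\<omega> \<in> space M" for \<omega>
  proof -
    have "U \<omega> \<in> carrier_mat d d" "Q \<omega> \<in> carrier_mat s s"
      using st' that by (auto intro: orthogonal_real_mat_carrier)
    then show ?thesis
      unfolding L_def by (intro mult_carrier_mat[OF mult_carrier_mat[OF _ X_carrier[OF that]]])
  qed
  have L_zero: "\<And>\<omega> i j. \<omega> \<in> space M \<Longrightarrow> i < t \<Longrightarrow> j < s \<Longrightarrow> i < j \<Longrightarrow> L \<omega> $$ (i, j) = 0"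
    and L_pos: "AE \<omega> in M. \<forall>i<t. 0 < L \<omega> $$ (i, i)"
    and L_gauss: "gaussian_given M G \<sigma> ({t..<d} \<times> {t..<s}) (\<lambda>\<omega> ij. L \<omega> $$ ij)"
    using st' by auto
  have "\<exists>f. (\<forall>i<d. \<forall>j<t. f i j \<in> borel_measurable (F t)) \<and>
      (AE \<omega> in M. \<forall>i<d. \<forall>j<t. L \<omega> $$ (i, j) = f i j \<omega>)"
    using st' by blast
  then obtain f where f: "\<And>i j. i < d \<Longrightarrow> j < t \<Longrightarrow> f i j \<in> borel_measurable (F t)"
      and Lf: "AE \<omega> in M. \<forall>i<d. \<forall>j<t. L \<omega> $$ (i, j) = f i j \<omega>"
    by blast
  define A where "A \<omega> = mat t t (\<lambda>(i, j). f i j \<omega>)" for \<omega>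
  define C where "C \<omega> = mat (d - t) t (\<lambda>(i, j). f (i + t) j \<omega>)" for \<omega>
  define D where "D \<omega> = mat (d - t) (s - t) (\<lambda>(i, j). L \<omega> $$ (i + t, j + t))" for \<omega>
  note D = gaussian_given_block[OF t(1) L_gauss, folded D_def[abs_def]]
  show thesis
  proof
    show "A \<in> F t \<rightarrow>\<^sub>M mat_borel t t"
      using f t by (auto simp: measurable_mat_borel_iff A_def)
    show "C \<in> F t \<rightarrow>\<^sub>M mat_borel (d - t) t"
      using f t by (auto simp: measurable_mat_borel_iff C_def)
    show "AE \<omega> in M. U \<omega> * X \<omega> * Q \<omega> = four_block_mat (A \<omega>) (0\<^sub>m t (s - t)) (C \<omega>) (D \<omega>)"
      using Lf AE_space
    proof eventually_elim
      fix \<omega> assume e: "\<forall>i<d. \<forall>j<t. L \<omega> $$ (i, j) = f i j \<omega>" and w: "\<omega> \<in> space M"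
      have "L \<omega> = four_block_mat (A \<omega>) (0\<^sub>m t (s - t)) (C \<omega>) (D \<omega>)"
        using Lc[OF w] t e by (intro eq_matI) (auto simp: A_def C_def D_def L_zero[OF w])
      then show "U \<omega> * X \<omega> * Q \<omega> = four_block_mat (A \<omega>) (0\<^sub>m t (s - t)) (C \<omega>) (D \<omega>)"
        by (simp only: L_def)
    qed
    show "AE \<omega> in M. lower_triangular_pos (A \<omega>)"
      using Lf L_pos AE_space
    proof eventually_elim
      fix \<omega> assume e: "\<forall>i<d. \<forall>j<t. L \<omega> $$ (i, j) = f i j \<omega>" and p: "\<forall>i<t. 0 < L \<omega> $$ (i, i)" and w: "\<omega> \<in> space M"
      have "f i j \<omega> = L \<omega> $$ (i, j)" if "i < t" "j < t" for i j
        using e that t by auto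
      then show "lower_triangular_pos (A \<omega>)"
        using L_zero[OF w] p t by (auto simp: lower_triangular_pos_def A_def)
    qed
  qed (fact D)+
qed

end

theorem lemma4p1:
  fixes M :: "'w measure" and S :: "'e measure"
    and d s q :: nat
    and X W :: "'w \<Rightarrow> real Matrix.mat"
    and \<xi> :: "'w \<Rightarrow> 'e"
    and v :: "nat \<Rightarrow> 'w \<Rightarrow> real Matrix.vec"
    and F :: "nat \<Rightarrow> 'w measure"
    and \<gamma> :: "nat \<Rightarrow> real Matrix.mat measure"
  defines "W \<equiv> \<lambda>\<omega>. X \<omega> * transpose_mat (X \<omega>)"
    and "F \<equiv> \<lambda>t. query_algebra M S d \<xi> W v t"
    and "\<gamma> \<equiv> \<lambda>t. gaussian_mat (1 / real d) (d - t) (s - t)"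
  assumes "prob_space M"
    and "1 \<le> s" and "s < d" and "q \<le> s"
    and "X \<in> M \<rightarrow>\<^sub>M mat_borel d s"
    and "prob_space.indep_vars M (\<lambda>_. borel) (\<lambda>ij \<omega>. X \<omega> $$ ij) ({..<d} \<times> {..<s})"
    and "\<And>i j. i < d \<Longrightarrow> j < s \<Longrightarrow>
           distributed M lborel (\<lambda>\<omega>. X \<omega> $$ (i, j)) (normal_density 0 (sqrt (1 / real d)))"
    and "standard_borel S"
    and "\<xi> \<in> M \<rightarrow>\<^sub>M S"
    and "prob_space.indep_set M
           (sets (vimage_algebra (space M) \<xi> S)) (sets (vimage_algebra (space M) X (mat_borel d s)))"
    and "\<And>t. t < q \<Longrightarrow> v (Suc t) \<in> F t \<rightarrow>\<^sub>M vec_borel d"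
    and "\<And>\<omega> i j. \<omega> \<in> space M \<Longrightarrow> i \<in> {1..q} \<Longrightarrow> j \<in> {1..q} \<Longrightarrow>
           scalar_prod (v i \<omega>) (v j \<omega>) = (if i = j then 1 else 0)"
  shows "\<forall>t\<le>q. \<exists>U G Q A C D.
      U \<in> F t \<rightarrow>\<^sub>M mat_borel d d \<and>
      (\<forall>\<omega>\<in>space M. orthogonal_real_mat d (U \<omega>) \<and> (\<forall>i<t. row (U \<omega>) i = v (Suc i) \<omega>)) \<and>
      subalgebra M G \<and> subalgebra G (F t) \<and>
      Q \<in> G \<rightarrow>\<^sub>M mat_borel s s \<and>
      (\<forall>\<omega>\<in>space M. orthogonal_real_mat s (Q \<omega>)) \<and>
      A \<in> F t \<rightarrow>\<^sub>M mat_borel t t \<and>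
      C \<in> F t \<rightarrow>\<^sub>M mat_borel (d - t) t \<and>
      D \<in> M \<rightarrow>\<^sub>M mat_borel (d - t) (s - t) \<and>
      (AE \<omega> in M. U \<omega> * X \<omega> * Q \<omega> = four_block_mat (A \<omega>) (0\<^sub>m t (s - t)) (C \<omega>) (D \<omega>)) \<and>
      (AE \<omega> in M. lower_triangular_pos (A \<omega>)) \<and>
      (\<forall>\<phi> :: real Matrix.mat \<Rightarrow> real.
         \<phi> \<in> borel_measurable (mat_borel (d - t) (s - t)) \<and>
         (\<exists>b. \<forall>x\<in>carrier_mat (d - t) (s - t). \<bar>\<phi> x\<bar> \<le> b) \<longrightarrow>
         (AE \<omega> in M. real_cond_exp M G (\<lambda>\<omega>. \<phi> (D \<omega>)) \<omega> = (\<integral>x. \<phi> x \<partial>\<gamma> t)) \<and>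
         (AE \<omega> in M. real_cond_exp M (F t) (\<lambda>\<omega>. \<phi> (D \<omega>)) \<omega> = (\<integral>x. \<phi> x \<partial>\<gamma> t))) \<and>
      prob_space.indep_set M
        (sets (vimage_algebra (space M) D (mat_borel (d - t) (s - t)))) (sets G) \<and>
      regular_cond_law M (F t) (mat_borel (d - t) (s - t)) D (\<lambda>_. \<gamma> t) \<and>
      (\<forall>\<kappa>. regular_cond_law M (F t) (mat_borel (d - t) (s - t)) D \<kappa> \<longrightarrow>
         (AE \<omega> in M. \<kappa> \<omega> = \<gamma> t)) \<and>
      (\<forall>\<kappa> \<in> transcript_space S d t \<rightarrow>\<^sub>M prob_algebra (mat_borel (d - t) (s - t)).
         regular_cond_law M (F t) (mat_borel (d - t) (s - t)) D
           (\<lambda>\<omega>. \<kappa> (transcript \<xi> W v t \<omega>)) \<longrightarrow>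
         (AE h in distr M (transcript_space S d t) (transcript \<xi> W v t). \<kappa> h = \<gamma> t))"
proof (intro allI impI)
  fix t assume t: "t \<le> q"
  interpret prob_space M by fact
  interpret adaptive_queries M S d s q X W \<xi> v F
    by unfold_locales (use assms in \<open>auto simp: W_def F_def\<close>)
  obtain U G Q where st: "stage t U G Q" using stage_exists[OF t] by blast
  have U: "U \<in> F t \<rightarrow>\<^sub>M mat_borel d d"
      "\<forall>\<omega>\<in>space M. orthogonal_real_mat d (U \<omega>) \<and> (\<forall>i<t. row (U \<omega>) i = v (Suc i) \<omega>)"
    and MG: "subalgebra M G" and GF: "subalgebra G (F t)"
    and Q: "Q \<in> G \<rightarrow>\<^sub>M mat_borel s s" "\<forall>\<omega>\<in>space M. orthogonal_real_mat s (Q \<omega>)"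
    using st unfolding stage_def by blast+
  obtain A C D where blocks: "A \<in> F t \<rightarrow>\<^sub>M mat_borel t t" "C \<in> F t \<rightarrow>\<^sub>M mat_borel (d - t) t"
      "AE \<omega> in M. U \<omega> * X \<omega> * Q \<omega> = four_block_mat (A \<omega>) (0\<^sub>m t (s - t)) (C \<omega>) (D \<omega>)"
      "AE \<omega> in M. lower_triangular_pos (A \<omega>)"
    and D: "D \<in> M \<rightarrow>\<^sub>M mat_borel (d - t) (s - t)"
    and law: "distr M (mat_borel (d - t) (s - t)) D = gaussian_mat (1 / real d) (d - t) (s - t)"
    and indG: "indep_set (sets (vimage_algebra (space M) D (mat_borel (d - t) (s - t)))) (sets G)"
    by (rule stage_blocks[OF st t])
  let ?N = "mat_borel (d - t) (s - t)"
  have \<gamma>: "\<gamma> t = distr M ?N D" by (simp add: law \<gamma>_def)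
  have MF: "subalgebra M (F t)" using MG GF by (auto simp: subalgebra_def)
  \<comment> \<open>Passing to the smaller field keeps independence; this is how the hidden
    rotations disappear from the conclusion.\<close>
  have indF: "indep_set (sets (vimage_algebra (space M) D ?N)) (sets (F t))"
    using indG GF by (intro indep_set_mono[OF indG]) (auto simp: subalgebra_def)
  have int: "integrable M (\<lambda>\<omega>. \<phi> (D \<omega>))"
    if "\<phi> \<in> borel_measurable ?N" "\<forall>x\<in>carrier_mat (d - t) (s - t). \<bar>\<phi> x\<bar> \<le> b" for \<phi> :: "real mat \<Rightarrow> real" and b
    using that measurable_space[OF D] measurable_compose[OF D that(1)]
    by (intro integrable_const_bound[of _ b]) auto
  have cond: "\<forall>\<phi> :: real mat \<Rightarrow> real.
      \<phi> \<in> borel_measurable ?N \<and> (\<exists>b. \<forall>x\<in>carrier_mat (d - t) (s - t). \<bar>\<phi> x\<bar> \<le> b) \<longrightarrow>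
      (AE \<omega> in M. real_cond_exp M G (\<lambda>\<omega>. \<phi> (D \<omega>)) \<omega> = (\<integral>x. \<phi> x \<partial>\<gamma> t)) \<and>
      (AE \<omega> in M. real_cond_exp M (F t) (\<lambda>\<omega>. \<phi> (D \<omega>)) \<omega> = (\<integral>x. \<phi> x \<partial>\<gamma> t))"
    using int unfolding \<gamma>
    by (auto intro!: real_cond_exp_indep[OF MG D indG] real_cond_exp_indep[OF MF D indF])
  have reg: "regular_cond_law M (F t) ?N D (\<lambda>_. \<gamma> t)"
    unfolding \<gamma> by (rule regular_cond_law_indep[OF MF D indF])
  have uniq: "\<forall>\<kappa>. regular_cond_law M (F t) ?N D \<kappa> \<longrightarrow> (AE \<omega> in M. \<kappa> \<omega> = \<gamma> t)"
    using regular_cond_law_unique[OF _ reg space_F] by blast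
  \<comment> \<open>Here null sets are those of the law of the transcript. Composing the kernel with
    the transcript reduces the claim to \<open>uniq\<close>, once the set of good transcripts is
    known to be measurable.\<close>
  have trans: "\<forall>\<kappa> \<in> transcript_space S d t \<rightarrow>\<^sub>M prob_algebra ?N.
      regular_cond_law M (F t) ?N D (\<lambda>\<omega>. \<kappa> (transcript \<xi> W v t \<omega>)) \<longrightarrow>
      (AE h in distr M (transcript_space S d t) (transcript \<xi> W v t). \<kappa> h = \<gamma> t)"
  proof (intro ballI impI, subst AE_distr_iff)
    fix \<kappa> assume \<kappa>: "\<kappa> \<in> transcript_space S d t \<rightarrow>\<^sub>M prob_algebra ?N"
      and "regular_cond_law M (F t) ?N D (\<lambda>\<omega>. \<kappa> (transcript \<xi> W v t \<omega>))"
    then show "AE \<omega> in M. \<kappa> (transcript \<xi> W v t \<omega>) = \<gamma> t" using uniq by blast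
    show "transcript \<xi> W v t \<in> M \<rightarrow>\<^sub>M transcript_space S d t"
      by (rule measurable_from_subalg[OF MF transcript_measurable[OF t]])
    have "\<gamma> t \<in> space (prob_algebra ?N)"
      unfolding \<gamma> using prob_space_distr[OF D] by (simp add: space_prob_algebra)
    then show "{h \<in> space (transcript_space S d t). \<kappa> h = \<gamma> t} \<in> sets (transcript_space S d t)"
      by (rule sets_Collect_kernel_eq[OF \<kappa>])
  qed
  show "\<exists>U G Q A C D.
      U \<in> F t \<rightarrow>\<^sub>M mat_borel d d \<and>
      (\<forall>\<omega>\<in>space M. orthogonal_real_mat d (U \<omega>) \<and> (\<forall>i<t. row (U \<omega>) i = v (Suc i) \<omega>)) \<and>
      subalgebra M G \<and> subalgebra G (F t) \<and>
      Q \<in> G \<rightarrow>\<^sub>M mat_borel s s \<and>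
      (\<forall>\<omega>\<in>space M. orthogonal_real_mat s (Q \<omega>)) \<and>
      A \<in> F t \<rightarrow>\<^sub>M mat_borel t t \<and>
      C \<in> F t \<rightarrow>\<^sub>M mat_borel (d - t) t \<and>
      D \<in> M \<rightarrow>\<^sub>M mat_borel (d - t) (s - t) \<and>
      (AE \<omega> in M. U \<omega> * X \<omega> * Q \<omega> = four_block_mat (A \<omega>) (0\<^sub>m t (s - t)) (C \<omega>) (D \<omega>)) \<and>
      (AE \<omega> in M. lower_triangular_pos (A \<omega>)) \<and>
      (\<forall>\<phi> :: real Matrix.mat \<Rightarrow> real.
         \<phi> \<in> borel_measurable (mat_borel (d - t) (s - t)) \<and>
         (\<exists>b. \<forall>x\<in>carrier_mat (d - t) (s - t). \<bar>\<phi> x\<bar> \<le> b) \<longrightarrow>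
         (AE \<omega> in M. real_cond_exp M G (\<lambda>\<omega>. \<phi> (D \<omega>)) \<omega> = (\<integral>x. \<phi> x \<partial>\<gamma> t)) \<and>
         (AE \<omega> in M. real_cond_exp M (F t) (\<lambda>\<omega>. \<phi> (D \<omega>)) \<omega> = (\<integral>x. \<phi> x \<partial>\<gamma> t))) \<and>
      prob_space.indep_set M
        (sets (vimage_algebra (space M) D (mat_borel (d - t) (s - t)))) (sets G) \<and>
      regular_cond_law M (F t) (mat_borel (d - t) (s - t)) D (\<lambda>_. \<gamma> t) \<and>
      (\<forall>\<kappa>. regular_cond_law M (F t) (mat_borel (d - t) (s - t)) D \<kappa> \<longrightarrow>
         (AE \<omega> in M. \<kappa> \<omega> = \<gamma> t)) \<and>
      (\<forall>\<kappa> \<in> transcript_space S d t \<rightarrow>\<^sub>M prob_algebra (mat_borel (d - t) (s - t)).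
         regular_cond_law M (F t) (mat_borel (d - t) (s - t)) D
           (\<lambda>\<omega>. \<kappa> (transcript \<xi> W v t \<omega>)) \<longrightarrow>
         (AE h in distr M (transcript_space S d t) (transcript \<xi> W v t). \<kappa> h = \<gamma> t))"
    by (rule exI[of _ U], rule exI[of _ G], rule exI[of _ Q], rule exI[of _ A], rule exI[of _ C], rule exI[of _ D],
        intro conjI)
      (fact U MG GF Q blocks D cond indG reg uniq trans)+
qed

end
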